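(* Let $n$ be even and let $Y,Z$ be $n\times n$ matrices. Then $$\overline{\mathrm{pf}}(Y)\,\overline{\mathrm{pf}}(Z)=\sum(-1)^{i_1(\deg_Y c_1+\deg_Z c_1+1)+\cdots+i_q(\deg_Y c_q+\deg_Z c_q+1)}\,\sigma_{i_1}(c_1)\cdots\sigma_{i_q}(c_q),$$ where the sum ranges over the $\stackrel{ct}{=}$-equivalence classes of multisets $\{\underbrace{c_1,\ldots,c_1}_{i_1},\ldots,\underbrace{c_q,\ldots,c_q}_{i_q}\}_m$ such that (1) $c_1,\ldots,c_q$ are primitive words in the letters $Y,Y^t,Z,Z^t$ that are pairwise different with respect to $\stackrel{ct}{=}$; (2) the words $c_1,\ldots,c_q$ are products of words $AB$, where $A\in\{Y,Y^t\}$ and $B\in\{Z,Z^t\}$; (3) $i_1(\deg_Y c_1+\deg_{Y^t}c_1)+\cdots+i_q(\deg_Y c_q+\deg_{Y^t}c_q)=n/2$ and $i_1(\deg_Z c_1+\deg_{Z^t}c_1)+\cdots+i_q(\deg_Z c_q+\deg_{Z^t}c_q)=n/2$.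
   Context: $K$ is an infinite field of arbitrary characteristic, and all matrices have entries in some commutative unital $K$-algebra. For a skew-symmetric $n\times n$ matrix $X=(x_{ij})$ with $n$ even, $\mathrm{pf}(X)=\sum\mathrm{sgn}(\pi)\prod_{i=1}^{n/2}x_{\pi(2i-1),\pi(2i)}$, the sum over $\pi\in\mathcal{S}_n$ with $\pi(1)<\pi(3)<\cdots<\pi(n-1)$ and $\pi(2i-1)<\pi(2i)$ for all $1\le i\le n/2$. For an arbitrary $n\times n$ matrix $X$, $\overline{\mathrm{pf}}(X)=\mathrm{pf}(X-X^t)$, where $X^t$ is the transpose. The elements $\sigma_k(X)$ are defined by $\det(\lambda E-X)=\lambda^n-\sigma_1(X)\lambda^{n-1}+\cdots+(-1)^n\sigma_n(X)$, and $\sigma_i(c)$ for a word $c$ means $\sigma_i$ of the corresponding product of matrices. Words are formal words in the four letters $Y,Y^t,Z,Z^t$, with $(u_1\cdots u_r)^t=u_r^t\cdots u_1^t$ and $(u^t)^t=u$. $\deg_a w$ is the number of occurrences of the letter $a$ in $w$ (so $Y$ and $Y^t$ are counted as different letters). A word is primitive if it is not of the form $u_0\cdots u_0$ with more than one factor. Write $a\stackrel{ct}{=}b$ if some cyclic permutation of $a$ equals $b$ or $b^t$. Two multisets of words are $\stackrel{ct}{=}$-equivalent if they have the same size and each $\stackrel{ct}{=}$-class of words occurs in both with the same multiplicity. The multiplicities $i_1,\ldots,i_q$ are positive integers. *)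

theory Defs
  imports
    "Jordan_Normal_Form.Char_Poly"
    "HOL-Library.Multiset"
begin

(* The field acts through an explicit scalar multiplication. *)
locale comm_unital_algebra = vector_space scale
  for scale :: "'k::field \<Rightarrow> 'a::comm_ring_1 \<Rightarrow> 'a" +
  assumes scale_mult_left: "scale r (x * y) = scale r x * y"

(* Indices are 0-based: x_{pi(2i-1),pi(2i)} for 1 <= i <= n/2 becomes
   X (p (2i), p (2i+1)) for i < n/2. Only meant for even n and skew-symmetric X. *)
definition pf :: "'a::comm_ring_1 mat \<Rightarrow> 'a" where
  "pf X = (let n = dim_row X in
     \<Sum>p | p permutes {0..<n} \<and>
          strict_mono_on {..<n div 2} (\<lambda>i. p (2 * i)) \<and>
          (\<forall>i<n div 2. p (2 * i) < p (2 * i + 1)).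
       signof p * (\<Prod>i<n div 2. X $$ (p (2 * i), p (2 * i + 1))))"

definition pf_bar :: "'a::comm_ring_1 mat \<Rightarrow> 'a" where
  "pf_bar X = pf (X - transpose_mat X)"

definition sigma :: "nat \<Rightarrow> 'a::comm_ring_1 mat \<Rightarrow> 'a" where
  "sigma k X = (if k \<le> dim_row X then (-1) ^ k * coeff (char_poly X) (dim_row X - k) else 0)"

lemma char_poly_sigma:
  fixes X :: "'a::comm_ring_1 mat"
  assumes X: "X \<in> carrier_mat n n"
  shows "char_poly X = (\<Sum>k\<le>n. monom ((-1) ^ k * sigma k X) (n - k))"
proof -
  have deg: "degree (char_poly X) \<le> n"
    using degree_monic_char_poly[OF X] by simp
  have "char_poly X = (\<Sum>i\<le>n. monom (coeff (char_poly X) i) i)"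
    using poly_as_sum_of_monoms'[OF deg] by simp
  also have "\<dots> = (\<Sum>k\<le>n. monom (coeff (char_poly X) (n - k)) (n - k))"
    by (rule sum.reindex_bij_witness[of _ "\<lambda>k. n - k" "\<lambda>k. n - k"]) auto
  also have "\<dots> = (\<Sum>k\<le>n. monom ((-1) ^ k * sigma k X) (n - k))"
    using X by (intro sum.cong refl)
      (auto simp: sigma_def mult.assoc[symmetric] power_add[symmetric] mult_2[symmetric])
  finally show ?thesis .
qed

datatype letter = LY | LYt | LZ | LZt

type_synonym lword = "letter list"

fun letter_tr :: "letter \<Rightarrow> letter" where
  "letter_tr LY = LYt"
| "letter_tr LYt = LY"
| "letter_tr LZ = LZt"
| "letter_tr LZt = LZ"

definition word_tr :: "lword \<Rightarrow> lword" where
  "word_tr w = rev (map letter_tr w)"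

(* Y and Yt are counted as different letters. *)
definition deg :: "letter \<Rightarrow> lword \<Rightarrow> nat" where
  "deg a w = count_list w a"

(* The empty word is not primitive. *)
definition primitive_word :: "lword \<Rightarrow> bool" where
  "primitive_word w \<longleftrightarrow> \<not> (\<exists>u k. k > 1 \<and> w = concat (replicate k u))"

definition ct_eq :: "lword \<Rightarrow> lword \<Rightarrow> bool" where
  "ct_eq a b \<longleftrightarrow> (\<exists>k. rotate k a = b \<or> rotate k a = word_tr b)"

definition ct_eq_mset :: "lword multiset \<Rightarrow> lword multiset \<Rightarrow> bool" where
  "ct_eq_mset M N \<longleftrightarrow> size M = size N \<and>
     (\<forall>w. size {#u \<in># M. ct_eq u w#} = size {#u \<in># N. ct_eq u w#})"

fun letter_mat :: "'a mat \<Rightarrow> 'a mat \<Rightarrow> letter \<Rightarrow> 'a mat" where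
  "letter_mat Y Z LY = Y"
| "letter_mat Y Z LYt = transpose_mat Y"
| "letter_mat Y Z LZ = Z"
| "letter_mat Y Z LZt = transpose_mat Z"

definition word_mat :: "nat \<Rightarrow> 'a::comm_ring_1 mat \<Rightarrow> 'a mat \<Rightarrow> lword \<Rightarrow> 'a mat" where
  "word_mat n Y Z w = foldr (\<lambda>a M. letter_mat Y Z a * M) w (1\<^sub>m n)"

definition product_of_AB :: "lword \<Rightarrow> bool" where
  "product_of_AB w \<longleftrightarrow>
     (\<exists>ws. w = concat ws \<and> (\<forall>v\<in>set ws. \<exists>A\<in>{LY, LYt}. \<exists>B\<in>{LZ, LZt}. v = [A, B]))"

(* A multiset M encodes the data c_1,...,c_q (its distinct elements) together with the
   multiplicities i_j = count M c_j > 0; distinct elements must be ct-inequivalent. *)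
definition admissible :: "nat \<Rightarrow> lword multiset set" where
  "admissible n = {M.
     (\<forall>c\<in>#M. primitive_word c) \<and>
     (\<forall>c\<in>#M. \<forall>d\<in>#M. c \<noteq> d \<longrightarrow> \<not> ct_eq c d) \<and>
     (\<forall>c\<in>#M. product_of_AB c) \<and>
     (\<Sum>c\<in>set_mset M. count M c * (deg LY c + deg LYt c)) = n div 2 \<and>
     (\<Sum>c\<in>set_mset M. count M c * (deg LZ c + deg LZt c)) = n div 2}"

definition ct_rel :: "nat \<Rightarrow> (lword multiset \<times> lword multiset) set" where
  "ct_rel n = {(M, N). M \<in> admissible n \<and> N \<in> admissible n \<and> ct_eq_mset M N}"

(* Depends only on the ct_rel-class of M: sigma_i is invariant under cyclic shifts and
   transposition, and the parity of deg LY c + deg LZ c is too when c is admissible.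
   Hence the_elem (summand n Y Z ` C) is its common value on a class C. *)
definition summand :: "nat \<Rightarrow> 'a::comm_ring_1 mat \<Rightarrow> 'a mat \<Rightarrow> lword multiset \<Rightarrow> 'a" where
  "summand n Y Z M =
     (-1) ^ (\<Sum>c\<in>set_mset M. count M c * (deg LY c + deg LZ c + 1)) *
     (\<Prod>c\<in>set_mset M. sigma (count M c) (word_mat n Y Z c))"

end

theory Submission
  imports
    Defs
    "HOL-Library.FuncSet"
    "HOL-Library.Countable"
    "HOL-Library.Multiset_Order"
    "HOL-Library.Poly_Mapping"
    "HOL-Computational_Algebra.Formal_Power_Series"
begin

text \<open>
  Put \<open>A = Y - Y\<^sup>t\<close>, \<open>B = Z - Z\<^sup>t\<close> and \<open>T\<^sub>j = tr((A B)\<^sup>j)\<close>. Both sides of the identity are the coefficient \<open>e\<^sub>m\<close>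
  (\<open>m = n/2\<close>) of a sequence with \<open>e\<^sub>0 = 1\<close> and \<open>2k e\<^sub>k = - (T\<^sub>1 e\<^sub>k\<^sub>-\<^sub>1 + \<dots> + T\<^sub>k e\<^sub>0)\<close>; informally, both are the
  top coefficient of the square root of \<open>det (1 - t A B)\<close>.

  On the Pfaffian side, \<open>pf A pf B\<close> is, up to the factor \<open>(2\<^sup>m m!)\<^sup>2\<close>, the sum over all functions \<open>f\<close> from \<open>2m\<close>
  positions to indices of \<open>a(f 0, f 1) a(f 2, f 3) \<dots>\<close> times the Pfaffian of \<open>b(f i, f j)\<close>: functions that are
  not injective contribute \<open>0\<close>. Expanding the second Pfaffian along position \<open>0\<close> either splits off a trace or
  glues two factors \<open>a\<close> into \<open>a b a\<close>, and iterating this gives the recursion.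

  On the other side, the sum over multisets is a coefficient of the product over \<open>ct\<close>-classes of primitive
  words \<open>c\<close> of the polynomials \<open>det (1 \<mp> t\<^sup>l c)\<close>, where \<open>2l\<close> is the length of \<open>c\<close>. By Newton's identities its
  logarithmic derivative is a sum of traces of powers of primitive words. Every word is a power of a unique
  primitive word, and no admissible word is equivalent to its own transpose by a cyclic shift, so each class
  contributes exactly \<open>2l\<close> words of the expansion of \<open>T\<^sub>j\<close>, which yields the same recursion.

  The recursion determines \<open>e\<^sub>m\<close> only if integers can be cancelled, so the argument is run for matrices with
  entries in a polynomial ring over the integers and the result is specialized.
\<close>

subsection \<open>Pfaffians as sums over all permutations\<close>

text \<open>A product of two Pfaffians of one fixed size obeys no recursion by itself. The sum over
  functions keeps the index range \<open>n\<close> fixed while the number \<open>m\<close> of blocks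
  varies; for skew \<open>a\<close>, \<open>b\<close> over a domain of characteristic 0,
  \<open>pf_pairing n m\<close> with constant kernel \<open>a\<close> is
  \<open>(2^m * fact m)^2\<close> times the sum, over all index sets S of size 2m, of the products
  of the Pfaffians of the two S-submatrices. Only the last member of this family,
  \<open>n = 2 * m\<close>, is the product wanted; the others feed the recursion. The constant
  counts, once for each Pfaffian, the orderings of m pairs and of the two entries of each pair.

  Gluing destroys the equality of the m kernels, so the pairing takes one kernel per block. A single
  exceptional kernel suffices: it is always some (A B)^k A, which is again skew, so gluing at either
  end of a block gives the same value, and the blocks are interchangeable, so its place is
  irrelevant.

  On the word side the factor 2k of the recursion comes from the size 2l of a class: the Euler
  derivative of a factor in t^l yields only l.\<close>

text \<open>For skew \<open>b\<close> this is \<open>2^m * fact m\<close> times the Pfaffian of the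
  matrix with entries \<open>b (f i) (f j)\<close>. Summing over all permutations makes the
  behaviour under permutations of the positions immediate, and \<open>f\<close> may repeat
  indices.\<close>

definition perm_pf :: "nat \<Rightarrow> (nat \<Rightarrow> nat \<Rightarrow> 'a::comm_ring_1) \<Rightarrow> (nat \<Rightarrow> nat) \<Rightarrow> 'a" where
  "perm_pf m b f = (\<Sum>\<rho> | \<rho> permutes {..<2 * m}.
     signof \<rho> * (\<Prod>i<m. b (f (\<rho> (2 * i))) (f (\<rho> (2 * i + 1)))))"

lemma signof_comp:
  assumes "p permutes S" "q permutes S" "finite S"
  shows "signof (p \<circ> q) = (signof p * signof q :: 'a::comm_ring_1)"
  using assms
  by (simp add: sign_compose permutes_imp_permutation[of S p] permutes_imp_permutation[of S q])

lemma signof_square: "signof p * signof p = (1 :: 'a::comm_ring_1)"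
  by (simp flip: of_int_mult)

lemma perm_pf_comp:
  assumes \<tau>: "\<tau> permutes {..<2 * m}"
  shows "perm_pf m b (f \<circ> \<tau>) = signof \<tau> * perm_pf m b f"
proof -
  have "perm_pf m b f = (\<Sum>\<rho> | \<rho> permutes {..<2 * m}.
     signof (\<tau> \<circ> \<rho>) * (\<Prod>i<m. b (f ((\<tau> \<circ> \<rho>) (2 * i))) (f ((\<tau> \<circ> \<rho>) (2 * i + 1)))))"
    unfolding perm_pf_def by (rule setum_permutations_compose_left[OF \<tau>])
  also have "\<dots> = (\<Sum>\<rho> | \<rho> permutes {..<2 * m}.
     signof \<tau> * (signof \<rho> * (\<Prod>i<m. b ((f \<circ> \<tau>) (\<rho> (2 * i))) ((f \<circ> \<tau>) (\<rho> (2 * i + 1))))))"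
    by (intro sum.cong refl) (simp add: signof_comp[OF \<tau>] mult.assoc)
  also have "\<dots> = signof \<tau> * perm_pf m b (f \<circ> \<tau>)"
    by (simp add: perm_pf_def sum_distrib_left)
  finally have "perm_pf m b f = signof \<tau> * perm_pf m b (f \<circ> \<tau>)" .
  thus ?thesis
    by (simp add: signof_square flip: mult.assoc)
qed

lemma perm_pf_cong: "(\<And>k. k < 2 * m \<Longrightarrow> f k = g k) \<Longrightarrow> perm_pf m b f = perm_pf m b g"
  unfolding perm_pf_def
proof (intro sum.cong refl arg_cong2[where f="(*)"] prod.cong, goal_cases)
  case (1 \<rho> i)
  hence "\<rho> (2*i) < 2*m" "\<rho> (2*i+1) < 2*m"
    using permutes_in_image[of \<rho> "{..<2*m}" "2*i"] permutes_in_image[of \<rho> "{..<2*m}" "2*i+1"] by auto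
  thus ?case using 1(1) by simp
qed

text \<open>Swapping two positions with equal values fixes \<open>f\<close> but negates the sum.
  Passing from x = - x to x = 0 uses the class assumptions.\<close>

lemma perm_pf_not_inj:
  fixes b :: "nat \<Rightarrow> nat \<Rightarrow> 'a::{idom,ring_char_0}"
  assumes "\<not> inj_on f {..<2 * m}"
  shows "perm_pf m b f = 0"
proof -
  obtain x y where xy: "x < 2*m" "y < 2*m" "x \<noteq> y" "f x = f y"
    using assms by (auto simp: inj_on_def)
  have "perm_pf m b (f \<circ> Transposition.transpose x y) = - perm_pf m b f"
    using xy by (subst perm_pf_comp) (auto simp: permutes_swap_id sign_swap_id)
  moreover have "f \<circ> Transposition.transpose x y = f"
    using xy by (auto simp: fun_eq_iff Transposition.transpose_def)
  ultimately show ?thesis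
    by simp
qed

lemma sum_PiE_comp:
  assumes \<tau>: "\<tau> permutes S"
  shows "(\<Sum>f\<in>S \<rightarrow>\<^sub>E N. F (f \<circ> \<tau>)) = (\<Sum>f\<in>S \<rightarrow>\<^sub>E N. F f)"
proof (rule sum.reindex_bij_witness[of _ "\<lambda>f. f \<circ> Hilbert_Choice.inv \<tau>" "\<lambda>f. f \<circ> \<tau>"])
  have *: "f \<circ> q \<in> S \<rightarrow>\<^sub>E N" if "f \<in> S \<rightarrow>\<^sub>E N" "q permutes S" for f q
    using that permutes_in_image[OF that(2)] by (auto simp: PiE_iff extensional_def)
  show "f \<circ> \<tau> \<in> S \<rightarrow>\<^sub>E N" "f \<circ> Hilbert_Choice.inv \<tau> \<in> S \<rightarrow>\<^sub>E N" if "f \<in> S \<rightarrow>\<^sub>E N" for f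
    using *[OF that \<tau>] *[OF that permutes_inv[OF \<tau>]] by auto
qed (auto simp: comp_assoc permutes_inv_o[OF \<tau>])

lemma sum_PiE_lessThan_Suc:
  "(\<Sum>f\<in>{..<Suc k} \<rightarrow>\<^sub>E N. F f) = (\<Sum>x\<in>N. \<Sum>g\<in>{..<k} \<rightarrow>\<^sub>E N. F (case_nat x g))"
proof -
  have "(\<Sum>f\<in>{..<Suc k} \<rightarrow>\<^sub>E N. F f) = (\<Sum>(x, g)\<in>N \<times> ({..<k} \<rightarrow>\<^sub>E N). F (case_nat x g))"
  proof (rule sum.reindex_bij_witness[of _ "\<lambda>(x, g). case_nat x g" "\<lambda>f. (f 0, f \<circ> Suc)"], goal_cases)
    case (1 f)
    show ?case by (auto simp: fun_eq_iff split: nat.split)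
  next
    case (2 f)
    thus ?case by (auto simp: PiE_iff extensional_def)
  next
    case (3 p)
    show ?case by (cases p) (auto simp: fun_eq_iff)
  next
    case (4 p)
    thus ?case by (cases p) (auto simp: PiE_iff extensional_def split: nat.split)
  next
    case (5 f)
    have "case_nat (f 0) (f \<circ> Suc) = f" by (auto simp: fun_eq_iff split: nat.split)
    thus ?case by simp
  qed
  thus ?thesis by (simp add: sum.cartesian_product)
qed

text \<open>Permutations fixing 0 are the shifts along \<open>Suc\<close> of permutations of one
  point fewer, with the same sign. The weight \<open>F\<close> is arbitrary, so the lemma can be
  used twice in a row to fix 0 and then 1.\<close>

lemma sum_permutes_fix_0:
  fixes F :: "(nat \<Rightarrow> nat) \<Rightarrow> 'a::comm_ring_1"
  shows "(\<Sum>\<rho> | \<rho> permutes {..<Suc k} \<and> \<rho> 0 = 0. signof \<rho> * F \<rho>) =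
   (\<Sum>\<sigma> | \<sigma> permutes {..<k}. signof \<sigma> * F (case_nat 0 (Suc \<circ> \<sigma>)))"
proof -
  have bij: "bij_betw Suc {..<k} {1..<Suc k}"
    by (rule bij_betwI[of _ _ _ "\<lambda>x. x - 1"]) auto
  have mp: "map_permutation {..<k} Suc \<sigma> = case_nat 0 (Suc \<circ> \<sigma>)" if s: "\<sigma> permutes {..<k}" for \<sigma>
  proof
    fix x
    show "map_permutation {..<k} Suc \<sigma> x = case_nat 0 (Suc \<circ> \<sigma>) x"
    proof (cases "x \<in> {1..<Suc k}")
      case True
      then obtain y where "x = Suc y" "y < k" by (cases x) auto
      thus ?thesis by (simp add: map_permutation_apply)
    next
      case False
      hence "map_permutation {..<k} Suc \<sigma> x = x"
        using map_permutation_permutes[OF bij s] by (auto simp: permutes_def)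
      moreover have "case_nat 0 (Suc \<circ> \<sigma>) x = x"
        using False permutes_not_in[OF s] by (auto split: nat.split)
      ultimately show ?thesis by simp
    qed
  qed
  have per: "case_nat 0 (Suc \<circ> \<sigma>) permutes {1..<Suc k}" if "\<sigma> permutes {..<k}" for \<sigma>
    using map_permutation_permutes[OF bij that] mp[OF that] by simp
  have sgn: "sign (case_nat 0 (Suc \<circ> \<sigma>)) = sign \<sigma>" if "\<sigma> permutes {..<k}" for \<sigma>
    using sign_map_permutation[of Suc "{..<k}" \<sigma>] that mp[OF that] by simp
  have inv: "\<exists>\<sigma>. \<sigma> permutes {..<k} \<and> \<rho> = case_nat 0 (Suc \<circ> \<sigma>)"
    if r: "\<rho> permutes {..<Suc k}" "\<rho> 0 = 0" for \<rho>
  proof (intro exI conjI)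
    let ?s = "map_permutation {1..<Suc k} (\<lambda>x. x - 1) \<rho>"
    have r': "\<rho> permutes {1..<Suc k}"
    proof (rule permutes_superset[OF r(1)])
      show "\<rho> x = x" if "x \<in> {..<Suc k} - {1..<Suc k}" for x
        using that r(2) by (cases x) auto
    qed
    have b': "bij_betw (\<lambda>x. x - 1) {1..<Suc k} {..<k}"
      by (rule bij_betwI[of _ _ _ Suc]) auto
    show s: "?s permutes {..<k}" by (rule map_permutation_permutes[OF b' r'])
    have "map_permutation {..<k} Suc ?s = \<rho>"
      by (rule map_permutation_compose_inv[OF b' r']) auto
    thus "\<rho> = case_nat 0 (Suc \<circ> ?s)" using mp[OF s] by simp
  qed
  have inj: "inj_on (\<lambda>\<sigma>. case_nat 0 (Suc \<circ> \<sigma>)) {\<sigma>. \<sigma> permutes {..<k}}"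
    by (rule inj_on_inverseI[of _ "\<lambda>\<rho> x. \<rho> (Suc x) - 1"]) auto
  have img: "(\<lambda>\<sigma>. case_nat 0 (Suc \<circ> \<sigma>)) ` {\<sigma>. \<sigma> permutes {..<k}} = {\<rho>. \<rho> permutes {..<Suc k} \<and> \<rho> 0 = 0}"
  proof (intro equalityI subsetI)
    fix \<rho> assume "\<rho> \<in> (\<lambda>\<sigma>. case_nat 0 (Suc \<circ> \<sigma>)) ` {\<sigma>. \<sigma> permutes {..<k}}"
    then obtain \<sigma> where "\<sigma> permutes {..<k}" "\<rho> = case_nat 0 (Suc \<circ> \<sigma>)"
      by auto
    moreover from this have "\<rho> permutes {..<Suc k}"
      by (metis permutes_subset[OF per] atLeastLessThan_iff lessThan_iff subsetI)
    ultimately show "\<rho> \<in> {\<rho>. \<rho> permutes {..<Suc k} \<and> \<rho> 0 = 0}"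
      by simp
  next
    fix \<rho> assume "\<rho> \<in> {\<rho>. \<rho> permutes {..<Suc k} \<and> \<rho> 0 = 0}"
    thus "\<rho> \<in> (\<lambda>\<sigma>. case_nat 0 (Suc \<circ> \<sigma>)) ` {\<sigma>. \<sigma> permutes {..<k}}"
      using inv by blast
  qed
  show ?thesis
    unfolding img[symmetric] sum.reindex[OF inj] by (auto intro!: sum.cong simp: sgn)
qed

section \<open>Pairing block kernels with a Pfaffian, and its expansion along position 0\<close>

text \<open>The kernel \<open>A i\<close> depends on the block because the expansion replaces a
  single kernel by a glued one.\<close>

definition pf_pairing :: "nat \<Rightarrow> nat \<Rightarrow> (nat \<Rightarrow> nat \<Rightarrow> nat \<Rightarrow> 'a::comm_ring_1) \<Rightarrow> (nat \<Rightarrow> nat \<Rightarrow> 'a) \<Rightarrow> 'a" where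
  "pf_pairing n m A b = (\<Sum>f\<in>{..<2 * m} \<rightarrow>\<^sub>E {..<n}. (\<Prod>i<m. A i (f (2 * i)) (f (2 * i + 1))) * perm_pf m b f)"

lemma transpose_blocks:
  fixes u v :: nat
  assumes "u \<noteq> v"
  defines "\<tau> \<equiv> Transposition.transpose (2 * u) (2 * v) \<circ> Transposition.transpose (2 * u + 1) (2 * v + 1)"
  shows "\<tau> (2 * i) = 2 * Transposition.transpose u v i"
    and "\<tau> (2 * i + 1) = 2 * Transposition.transpose u v i + 1"
    and "u < m \<Longrightarrow> v < m \<Longrightarrow> \<tau> permutes {..<2 * m}"
    and "sign \<tau> = 1"
proof -
  show "\<tau> (2 * i) = 2 * Transposition.transpose u v i"
    using assms(1) by (auto simp: \<tau>_def Transposition.transpose_def)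
  show "\<tau> (2 * i + 1) = 2 * Transposition.transpose u v i + 1"
    using assms(1) by (auto simp: \<tau>_def Transposition.transpose_def)
  show "\<tau> permutes {..<2 * m}" if "u < m" "v < m"
    unfolding \<tau>_def using that by (intro permutes_compose permutes_swap_id) auto
  show "sign \<tau> = 1"
    unfolding \<tau>_def using assms(1)
    by (simp add: sign_compose permutation_swap_id sign_swap_id)
qed

text \<open>Exchanging two whole blocks is a product of two transpositions, hence even, so the
  Pfaffian factor does not change sign.\<close>

lemma pf_pairing_transpose:
  assumes uv: "u < m" "v < m"
  shows "pf_pairing n m (A \<circ> Transposition.transpose u v) b = pf_pairing n m A b"
proof (cases "u = v")
  case False
  let ?\<theta> = "Transposition.transpose u v"
  let ?\<tau> = "Transposition.transpose (2 * u) (2 * v) \<circ> Transposition.transpose (2 * u + 1) (2 * v + 1)"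
  note \<tau> = transpose_blocks[OF False]
  have "pf_pairing n m A b = (\<Sum>f\<in>{..<2 * m} \<rightarrow>\<^sub>E {..<n}. (\<Prod>i<m. A i ((f \<circ> ?\<tau>) (2 * i)) ((f \<circ> ?\<tau>) (2 * i + 1))) * perm_pf m b (f \<circ> ?\<tau>))"
    unfolding pf_pairing_def by (rule sum_PiE_comp[OF \<tau>(3)[OF uv], symmetric])
  also have "\<dots> = pf_pairing n m (A \<circ> ?\<theta>) b"
    unfolding pf_pairing_def
  proof (intro sum.cong refl arg_cong2[where f="(*)"])
    fix f
    have "(\<Prod>i<m. (A \<circ> ?\<theta>) i (f (2 * i)) (f (2 * i + 1))) =
      (\<Prod>i<m. (A \<circ> ?\<theta>) (?\<theta> i) (f (2 * ?\<theta> i)) (f (2 * ?\<theta> i + 1)))"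
      using uv by (intro prod.reindex_bij_witness[of _ ?\<theta> ?\<theta>]) (auto simp: Transposition.transpose_def)
    also have "\<dots> = (\<Prod>i<m. A i ((f \<circ> ?\<tau>) (2 * i)) ((f \<circ> ?\<tau>) (2 * i + 1)))"
      unfolding comp_apply[of f] \<tau>(1,2) by simp
    finally show "(\<Prod>i<m. A i ((f \<circ> ?\<tau>) (2 * i)) ((f \<circ> ?\<tau>) (2 * i + 1))) =
      (\<Prod>i<m. (A \<circ> ?\<theta>) i (f (2 * i)) (f (2 * i + 1)))" ..
    show "perm_pf m b (f \<circ> ?\<tau>) = perm_pf m b f"
      unfolding perm_pf_comp[OF \<tau>(3)[OF uv]] \<tau>(4) by simp
  qed
  finally show ?thesis ..
qed auto

lemma perm_pf_Suc_fix_0_1: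
  "(\<Sum>\<rho> | \<rho> permutes {..<2 * Suc m} \<and> \<rho> 0 = 0 \<and> \<rho> 1 = 1.
     signof \<rho> * (\<Prod>i<Suc m. b (f (\<rho> (2 * i))) (f (\<rho> (2 * i + 1))))) =
   b (f 0) (f 1) * perm_pf m b (\<lambda>k. f (k + 2))"
proof -
  let ?F = "\<lambda>\<rho>. \<Prod>i<Suc m. b (f (\<rho> (2 * i))) (f (\<rho> (2 * i + 1)))"
  \<comment> \<open>The condition \<open>\<rho> 1 = 1\<close> moves into the summand, so that
    \<open>sum_permutes_fix_0\<close> applies to position 0 and, after the shift, to what was
    position 1.\<close>
  have "(\<Sum>\<rho> | \<rho> permutes {..<2 * Suc m} \<and> \<rho> 0 = 0 \<and> \<rho> 1 = 1. signof \<rho> * ?F \<rho>) =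
    (\<Sum>\<rho> | \<rho> permutes {..<Suc (Suc (2 * m))} \<and> \<rho> 0 = 0. signof \<rho> * (if \<rho> 1 = 1 then ?F \<rho> else 0))"
    by (rule sum.mono_neutral_cong_left) (auto intro: finite_subset[OF _ finite_permutations[of "{..<2 * Suc m}"]])
  also have "\<dots> = (\<Sum>\<sigma> | \<sigma> permutes {..<Suc (2 * m)}.
      signof \<sigma> * (if \<sigma> 0 = 0 then ?F (case_nat 0 (Suc \<circ> \<sigma>)) else 0))"
    unfolding sum_permutes_fix_0 by simp
  also have "\<dots> = (\<Sum>\<sigma> | \<sigma> permutes {..<Suc (2 * m)} \<and> \<sigma> 0 = 0.
      signof \<sigma> * ?F (case_nat 0 (Suc \<circ> \<sigma>)))"
    by (rule sum.mono_neutral_cong_right) (auto intro: finite_permutations)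
  also have "\<dots> = (\<Sum>\<sigma> | \<sigma> permutes {..<2 * m}.
      signof \<sigma> * ?F (case_nat 0 (Suc \<circ> case_nat 0 (Suc \<circ> \<sigma>))))"
    by (rule sum_permutes_fix_0)
  also have "\<dots> = b (f 0) (f 1) * perm_pf m b (\<lambda>k. f (k + 2))"
    unfolding perm_pf_def sum_distrib_left
    by (intro sum.cong refl) (simp add: prod.lessThan_Suc_shift o_def mult_ac del: prod.lessThan_Suc)
  finally show ?thesis .
qed

text \<open>The permutations are grouped by the partner \<open>j\<close> of position 0; composing
  with the transposition of 1 and \<open>j\<close> reduces each group to the case
  \<open>j = 1\<close>.\<close>

lemma perm_pf_Suc_fix_0:
  "(\<Sum>\<rho> | \<rho> permutes {..<2 * Suc m} \<and> \<rho> 0 = 0.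
     signof \<rho> * (\<Prod>i<Suc m. b (f (\<rho> (2 * i))) (f (\<rho> (2 * i + 1))))) =
   (\<Sum>j\<in>{1..<2 * Suc m}. signof (Transposition.transpose 1 j) *
      (b (f 0) (f j) * perm_pf m b (\<lambda>k. f (Transposition.transpose 1 j (k + 2)))))"
proof -
  let ?S = "{..<2 * Suc m}" and ?t = "Transposition.transpose (1::nat)"
  let ?F = "\<lambda>f \<rho>. \<Prod>i<Suc m. b (f (\<rho> (2 * i))) (f (\<rho> (2 * i + 1)))"
  have fin: "finite {\<rho>. \<rho> permutes ?S \<and> \<rho> 0 = 0}"
    by (rule finite_subset[OF _ finite_permutations[of ?S]]) auto
  have "(\<Sum>\<rho> | \<rho> permutes ?S \<and> \<rho> 0 = 0. signof \<rho> * ?F f \<rho>) =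
    (\<Sum>j\<in>{1..<2 * Suc m}. \<Sum>\<rho> | \<rho> \<in> {\<rho>. \<rho> permutes ?S \<and> \<rho> 0 = 0} \<and> \<rho> 1 = j. signof \<rho> * ?F f \<rho>)"
  proof (rule sum.group[OF fin, symmetric])
    show "(\<lambda>\<rho>. \<rho> 1) ` {\<rho>. \<rho> permutes ?S \<and> \<rho> 0 = 0} \<subseteq> {1..<2 * Suc m}"
    proof safe
      fix \<rho> :: "nat \<Rightarrow> nat" assume r: "\<rho> permutes ?S" "\<rho> 0 = 0"
      have "\<rho> 1 \<in> ?S" using permutes_in_image[OF r(1), of 1] by simp
      moreover have "\<rho> 1 \<noteq> 0" using permutes_inj[OF r(1)] r(2) by (metis inj_eq zero_neq_one)
      ultimately show "\<rho> 1 \<in> {1..<2 * Suc m}" by simp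
    qed
  qed auto
  also have "\<dots> = (\<Sum>j\<in>{1..<2 * Suc m}. signof (?t j) *
      (b (f 0) (f j) * perm_pf m b (\<lambda>k. f (?t j (k + 2)))))"
  proof (rule sum.cong[OF refl])
    fix j assume j: "j \<in> {1..<2 * Suc m}"
    have t: "?t j permutes ?S" using j by (intro permutes_swap_id) auto
    have tt: "?t j \<circ> (?t j \<circ> \<rho>) = \<rho>" for \<rho> :: "nat \<Rightarrow> nat"
      by (simp add: fun_eq_iff)
    have "(\<Sum>\<rho> | \<rho> \<in> {\<rho>. \<rho> permutes ?S \<and> \<rho> 0 = 0} \<and> \<rho> 1 = j. signof \<rho> * ?F f \<rho>) =
      (\<Sum>\<rho> | \<rho> permutes ?S \<and> \<rho> 0 = 0 \<and> \<rho> 1 = 1. signof (?t j \<circ> \<rho>) * ?F f (?t j \<circ> \<rho>))"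
    proof (rule sum.reindex_bij_witness[of _ "\<lambda>\<rho>. ?t j \<circ> \<rho>" "\<lambda>\<rho>. ?t j \<circ> \<rho>"], goal_cases)
      case (2 \<rho>)
      thus ?case using permutes_compose[OF _ t, of \<rho>] j by simp
    next
      case (4 \<rho>)
      thus ?case using permutes_compose[OF _ t, of \<rho>] j by simp
    qed (simp_all only: tt)
    also have "\<dots> = signof (?t j) * (\<Sum>\<rho> | \<rho> permutes ?S \<and> \<rho> 0 = 0 \<and> \<rho> 1 = 1. signof \<rho> * ?F (f \<circ> ?t j) \<rho>)"
      unfolding sum_distrib_left
    proof (rule sum.cong[OF refl])
      fix \<rho> assume "\<rho> \<in> {\<rho>. \<rho> permutes ?S \<and> \<rho> 0 = 0 \<and> \<rho> 1 = 1}"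
      hence "\<rho> permutes ?S" by simp
      thus "signof (?t j \<circ> \<rho>) * ?F f (?t j \<circ> \<rho>) = signof (?t j) * (signof \<rho> * ?F (f \<circ> ?t j) \<rho>)"
        by (simp only: signof_comp[OF t _ finite_lessThan] comp_apply mult.assoc)
    qed
    also have "\<dots> = signof (?t j) * (b (f 0) (f j) * perm_pf m b (\<lambda>k. f (?t j (k + 2))))"
      unfolding perm_pf_Suc_fix_0_1 using j by simp
    finally show "(\<Sum>\<rho> | \<rho> \<in> {\<rho>. \<rho> permutes ?S \<and> \<rho> 0 = 0} \<and> \<rho> 1 = j. signof \<rho> * ?F f \<rho>) =
      signof (?t j) * (b (f 0) (f j) * perm_pf m b (\<lambda>k. f (?t j (k + 2))))" .
  qed
  finally show ?thesis .
qed

text \<open>Position 0 can be moved to any slot \<open>q\<close> at no cost: exchange block 0 with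
  the block of \<open>q\<close>, which is even, and for odd \<open>q\<close> also flip the block,
  where the sign of the flip cancels the sign from skewness.\<close>

lemma block_position:
  assumes skew: "\<And>x y. b x y = - b y x" and q: "q < 2 * Suc m"
  obtains \<kappa> where "\<kappa> permutes {..<2 * Suc m}" "\<kappa> 0 = q"
    and "\<And>f. signof \<kappa> * (\<Prod>i<Suc m. b (f (\<kappa> (2 * i))) (f (\<kappa> (2 * i + 1)))) =
      ((\<Prod>i<Suc m. b (f (2 * i)) (f (2 * i + 1))) :: 'a::comm_ring_1)"
proof -
  define i0 where "i0 = q div 2"
  have i0: "i0 < Suc m" using q by (auto simp: i0_def)
  define \<theta> where "\<theta> = Transposition.transpose 0 i0"
  define \<tau> where "\<tau> = (if i0 = 0 then id else
    Transposition.transpose (2 * 0) (2 * i0) \<circ> Transposition.transpose (2 * 0 + 1) (2 * i0 + 1))"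
  have \<tau>: "\<tau> (2 * i) = 2 * \<theta> i" "\<tau> (2 * i + 1) = 2 * \<theta> i + 1" for i
    using transpose_blocks(1,2)[of 0 i0 i] by (auto simp: \<tau>_def \<theta>_def)
  have perm: "\<tau> permutes {..<2 * Suc m}" and sgn: "sign \<tau> = 1"
    using transpose_blocks(3)[of 0 i0 "Suc m"] transpose_blocks(4)[of 0 i0] i0 by (auto simp: \<tau>_def)
  have prd: "(\<Prod>i<Suc m. g (\<theta> i)) = (\<Prod>i<Suc m. g i)" for g :: "nat \<Rightarrow> 'a"
    by (rule prod.reindex_bij_witness[of _ \<theta> \<theta>])
      (use i0 in \<open>auto simp: \<theta>_def Transposition.transpose_def\<close>)
  show thesis
  proof (cases "even q")
    case True
    show ?thesis
    proof (rule that[of \<tau>])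
      show "\<tau> 0 = q" using \<tau>(1)[of 0] True by (simp add: \<theta>_def i0_def)
      show "signof \<tau> * (\<Prod>i<Suc m. b (f (\<tau> (2 * i))) (f (\<tau> (2 * i + 1)))) =
        (\<Prod>i<Suc m. b (f (2 * i)) (f (2 * i + 1)))" for f
        unfolding \<tau> sgn using prd[of "\<lambda>i. b (f (2 * i)) (f (2 * i + 1))"] by simp
    qed (rule perm)
  next
    case False
    let ?s = "Transposition.transpose 0 (1::nat)"
    have ps: "?s permutes {..<2 * Suc m}" by (intro permutes_swap_id) auto
    show ?thesis
    proof (rule that[of "\<tau> \<circ> ?s"])
      show "(\<tau> \<circ> ?s) permutes {..<2 * Suc m}" by (rule permutes_compose[OF ps perm])
      show "(\<tau> \<circ> ?s) 0 = q" using \<tau>(2)[of 0] False by (simp add: \<theta>_def i0_def)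
      show "signof (\<tau> \<circ> ?s) * (\<Prod>i<Suc m. b (f ((\<tau> \<circ> ?s) (2 * i))) (f ((\<tau> \<circ> ?s) (2 * i + 1)))) =
        (\<Prod>i<Suc m. b (f (2 * i)) (f (2 * i + 1)))" for f
      proof -
        have 1: "(\<Prod>i<Suc m. b (f ((\<tau> \<circ> ?s) (2 * i))) (f ((\<tau> \<circ> ?s) (2 * i + 1)))) =
           b (f (\<tau> 1)) (f (\<tau> 0)) * (\<Prod>i<m. b (f (\<tau> (2 * Suc i))) (f (\<tau> (2 * Suc i + 1))))"
          unfolding prod.lessThan_Suc_shift by simp
        have 2: "(\<Prod>i<Suc m. b (f (\<tau> (2 * i))) (f (\<tau> (2 * i + 1)))) =
           b (f (\<tau> 0)) (f (\<tau> 1)) * (\<Prod>i<m. b (f (\<tau> (2 * Suc i))) (f (\<tau> (2 * Suc i + 1))))"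
          unfolding prod.lessThan_Suc_shift by simp
        have "(\<Prod>i<Suc m. b (f ((\<tau> \<circ> ?s) (2 * i))) (f ((\<tau> \<circ> ?s) (2 * i + 1)))) =
           - (\<Prod>i<Suc m. b (f (\<tau> (2 * i))) (f (\<tau> (2 * i + 1))))"
          unfolding 1 2 skew[of "f (\<tau> 1)"] by simp
        also have "\<dots> = - (\<Prod>i<Suc m. b (f (2 * i)) (f (2 * i + 1)))"
          unfolding \<tau> using prd[of "\<lambda>i. b (f (2 * i)) (f (2 * i + 1))"] by simp
        finally show ?thesis
          by (simp only: signof_comp[OF perm ps finite_lessThan] sgn) (simp add: sign_swap_id)
      qed
    qed
  qed
qed

text \<open>Expansion of a Pfaffian along its first row. The factor is the number of slots that
  position 0 can occupy; by \<open>block_position\<close> all of them contribute equally.\<close>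

lemma perm_pf_Suc:
  assumes skew: "\<And>x y. b x y = - b y x"
  shows "perm_pf (Suc m) b f = of_nat (2 * Suc m) *
   (\<Sum>j\<in>{1..<2 * Suc m}. signof (Transposition.transpose 1 j) *
      (b (f 0) (f j) * perm_pf m b (\<lambda>k. f (Transposition.transpose 1 j (k + 2)))))"
    (is "_ = _ * ?R")
proof -
  let ?S = "{..<2 * Suc m}"
  let ?G = "\<lambda>\<rho>. signof \<rho> * (\<Prod>i<Suc m. b (f (\<rho> (2 * i))) (f (\<rho> (2 * i + 1))))"
  have "perm_pf (Suc m) b f = (\<Sum>q\<in>?S. \<Sum>\<rho> | \<rho> \<in> {\<rho>. \<rho> permutes ?S} \<and> Hilbert_Choice.inv \<rho> 0 = q. ?G \<rho>)"
    unfolding perm_pf_def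
  proof (rule sum.group[symmetric])
    show "(\<lambda>\<rho>. Hilbert_Choice.inv \<rho> 0) ` {\<rho>. \<rho> permutes ?S} \<subseteq> ?S"
      using permutes_in_image[OF permutes_inv, of _ ?S 0] by auto
  qed (auto intro: finite_permutations)
  also have "\<dots> = (\<Sum>q\<in>?S. ?R)"
  proof (rule sum.cong[OF refl])
    fix q assume "q \<in> ?S"
    hence "q < 2 * Suc m" by simp
    then obtain \<kappa> where \<kappa>: "\<kappa> permutes ?S" "\<kappa> 0 = q"
      "\<And>f. signof \<kappa> * (\<Prod>i<Suc m. b (f (\<kappa> (2 * i))) (f (\<kappa> (2 * i + 1)))) =
      (\<Prod>i<Suc m. b (f (2 * i)) (f (2 * i + 1)))"
      using block_position[of b, OF skew] by blast
    let ?k = "Hilbert_Choice.inv \<kappa>"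
    have "(\<Sum>\<rho> | \<rho> \<in> {\<rho>. \<rho> permutes ?S} \<and> Hilbert_Choice.inv \<rho> 0 = q. ?G \<rho>) =
      (\<Sum>\<rho> | \<rho> permutes ?S \<and> \<rho> 0 = 0. ?G \<rho>)"
    proof (rule sum.reindex_bij_witness[of _ "\<lambda>\<rho>. \<rho> \<circ> ?k" "\<lambda>\<rho>. \<rho> \<circ> \<kappa>"], goal_cases)
      case (1 \<rho>)
      show ?case by (simp add: comp_assoc permutes_inv_o[OF \<kappa>(1)])
    next
      case (2 \<rho>)
      hence "\<rho> q = 0" using permutes_inverses(1)[of \<rho> ?S 0] by auto
      thus ?case using 2 \<kappa> permutes_compose[of \<kappa> ?S \<rho>] by simp
    next
      case (3 \<rho>)
      show ?case by (simp add: comp_assoc permutes_inv_o[OF \<kappa>(1)])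
    next
      case (4 \<rho>)
      hence p: "(\<rho> \<circ> ?k) permutes ?S" using permutes_compose[OF permutes_inv[OF \<kappa>(1)]] by simp
      have "(\<rho> \<circ> ?k) q = 0" using 4 \<kappa>(2) permutes_inverses(2)[OF \<kappa>(1), of 0] by simp
      hence "Hilbert_Choice.inv (\<rho> \<circ> ?k) 0 = q" using permutes_inverses(2)[OF p, of q] by simp
      thus ?case using p by simp
    next
      case (5 \<rho>)
      thus ?case
        using \<kappa>(3)[of "\<lambda>x. f (\<rho> x)"] signof_comp[of \<rho> ?S \<kappa>, where 'a='a] \<kappa>(1)
        by (simp add: mult.assoc)
    qed
    also have "\<dots> = ?R" by (rule perm_pf_Suc_fix_0)
    finally show "(\<Sum>\<rho> | \<rho> \<in> {\<rho>. \<rho> permutes ?S} \<and> Hilbert_Choice.inv \<rho> 0 = q. ?G \<rho>) = ?R" .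
  qed
  finally show ?thesis by simp
qed

lemma sum_atLeast1_odd: "(\<Sum>j\<in>{1..<2 * Suc m}. X j) = X 1 + (\<Sum>i<m. X (2 * i + 2) + X (2 * i + 3) :: 'a::comm_monoid_add)"
  by (induction m) (simp_all add: atLeastLessThanSuc add_ac numeral_3_eq_3)

lemma pf_pairing_fun_upd:
  assumes "i0 < m"
  shows "pf_pairing n m (A(i0 := C)) b = (\<Sum>h\<in>{..<2 * m} \<rightarrow>\<^sub>E {..<n}.
    C (h (2 * i0)) (h (2 * i0 + 1)) * (\<Prod>i\<in>{..<m} - {i0}. A i (h (2 * i)) (h (2 * i + 1))) * perm_pf m b h)"
  unfolding pf_pairing_def using assms
  by (intro sum.cong refl arg_cong2[where f="(*)"]) (simp add: prod.remove[of _ i0])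

text \<open>Renaming positions by \<open>t\<close> puts the partner \<open>j\<close> of position 0
  at position 1. The values \<open>x\<close>, \<open>y\<close> at positions 0 and 1 can then be
  summed separately, and the remaining function \<open>h\<close> is the argument of the smaller
  Pfaffian.\<close>

lemma pf_pairing_Suc_term:
  fixes m n j :: nat and A :: "nat \<Rightarrow> nat \<Rightarrow> nat \<Rightarrow> 'a::comm_ring_1"
  assumes j: "1 \<le> j" "j < 2 * Suc m"
  defines "t \<equiv> Transposition.transpose 1 j"
  shows "(\<Sum>f\<in>{..<2 * Suc m} \<rightarrow>\<^sub>E {..<n}. (\<Prod>i<Suc m. A i (f (2 * i)) (f (2 * i + 1))) *
     (signof t * (b (f 0) (f j) * perm_pf m b (\<lambda>k. f (t (k + 2)))))) =
   (\<Sum>h\<in>{..<2 * m} \<rightarrow>\<^sub>E {..<n}. (signof t * (\<Sum>x<n. \<Sum>y<n. b x y *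
     (\<Prod>i<Suc m. A i (case_nat x (case_nat y h) (t (2 * i))) (case_nat x (case_nat y h) (t (2 * i + 1)))))) * perm_pf m b h)"
proof -
  have t: "t permutes {..<2 * Suc m}" unfolding t_def using j by (intro permutes_swap_id) auto
  have t0: "t 0 = 0" "t j = 1" using j by (auto simp: t_def)
  have tt: "t (t x) = x" for x by (simp add: t_def)
  let ?F = "\<lambda>f. (\<Prod>i<Suc m. A i (f (2 * i)) (f (2 * i + 1))) *
     (signof t * (b (f 0) (f j) * perm_pf m b (\<lambda>k. f (t (k + 2)))))"
  let ?c = "\<lambda>x y h. case_nat x (case_nat y h)"
  have "(\<Sum>f\<in>{..<2 * Suc m} \<rightarrow>\<^sub>E {..<n}. ?F f) = (\<Sum>f\<in>{..<2 * Suc m} \<rightarrow>\<^sub>E {..<n}. ?F (f \<circ> t))"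
    by (rule sum_PiE_comp[OF t, symmetric])
  also have "\<dots> = (\<Sum>f\<in>{..<Suc (Suc (2 * m))} \<rightarrow>\<^sub>E {..<n}. signof t * (b (f 0) (f 1) *
      (\<Prod>i<Suc m. A i (f (t (2 * i))) (f (t (2 * i + 1)))) * perm_pf m b (\<lambda>k. f (k + 2))))"
    by (intro sum.cong) (simp_all add: t0 tt mult_ac del: prod.lessThan_Suc)
  also have "\<dots> = (\<Sum>x<n. \<Sum>y<n. \<Sum>h\<in>{..<2 * m} \<rightarrow>\<^sub>E {..<n}. signof t * (b x y *
      (\<Prod>i<Suc m. A i (?c x y h (t (2 * i))) (?c x y h (t (2 * i + 1)))) * perm_pf m b h))"
    unfolding sum_PiE_lessThan_Suc by (intro sum.cong refl) simp
  also have "\<dots> = (\<Sum>x<n. \<Sum>h\<in>{..<2 * m} \<rightarrow>\<^sub>E {..<n}. \<Sum>y<n. signof t * (b x y *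
      (\<Prod>i<Suc m. A i (?c x y h (t (2 * i))) (?c x y h (t (2 * i + 1)))) * perm_pf m b h))"
    by (intro sum.cong refl sum.swap)
  also have "\<dots> = (\<Sum>h\<in>{..<2 * m} \<rightarrow>\<^sub>E {..<n}. \<Sum>x<n. \<Sum>y<n. signof t * (b x y *
      (\<Prod>i<Suc m. A i (?c x y h (t (2 * i))) (?c x y h (t (2 * i + 1)))) * perm_pf m b h))"
    by (rule sum.swap)
  finally show ?thesis
    by (simp add: sum_distrib_left sum_distrib_right mult.assoc)
qed

text \<open>The partner of position 0 is either the other end of block 0, which gives a scalar
  contraction of \<open>A 0\<close> with \<open>b\<close>, or the left or right end of a later
  block, where \<open>b\<close> joins \<open>A 0\<close> to that block's kernel. The minus sign is
  that of the transposition moving the partner.\<close>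

lemma pf_pairing_Suc:
  fixes b :: "nat \<Rightarrow> nat \<Rightarrow> 'a::comm_ring_1"
  assumes skew: "\<And>x y. b x y = - b y x"
  shows "pf_pairing n (Suc m) A b = of_nat (2 * Suc m) *
    ((\<Sum>x<n. \<Sum>y<n. b x y * A 0 x y) * pf_pairing n m (A \<circ> Suc) b -
     (\<Sum>i<m. pf_pairing n m ((A \<circ> Suc)(i := \<lambda>p q. \<Sum>x<n. \<Sum>y<n. b x y * (A 0 x p * A (Suc i) y q))) b +
              pf_pairing n m ((A \<circ> Suc)(i := \<lambda>p q. \<Sum>x<n. \<Sum>y<n. b x y * (A 0 x q * A (Suc i) p y))) b))"
proof -
  let ?t = "Transposition.transpose (1::nat)"
  let ?c = "\<lambda>x y h. case_nat x (case_nat y h)"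
  define X where "X = (\<lambda>j. \<Sum>h\<in>{..<2 * m} \<rightarrow>\<^sub>E {..<n}. (signof (?t j) * (\<Sum>x<n. \<Sum>y<n. b x y *
     (\<Prod>i<Suc m. A i (?c x y h (?t j (2 * i))) (?c x y h (?t j (2 * i + 1)))))) * perm_pf m b h)"
  have "pf_pairing n (Suc m) A b = of_nat (2 * Suc m) * (\<Sum>j\<in>{1..<2 * Suc m}.
     (\<Sum>f\<in>{..<2 * Suc m} \<rightarrow>\<^sub>E {..<n}. (\<Prod>i<Suc m. A i (f (2 * i)) (f (2 * i + 1))) *
     (signof (?t j) * (b (f 0) (f j) * perm_pf m b (\<lambda>k. f (?t j (k + 2)))))))"
    unfolding pf_pairing_def perm_pf_Suc[of b, OF skew] sum_distrib_left
    by (subst sum.swap) (simp only: mult_ac)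
  also have "(\<Sum>j\<in>{1..<2 * Suc m}.
     (\<Sum>f\<in>{..<2 * Suc m} \<rightarrow>\<^sub>E {..<n}. (\<Prod>i<Suc m. A i (f (2 * i)) (f (2 * i + 1))) *
     (signof (?t j) * (b (f 0) (f j) * perm_pf m b (\<lambda>k. f (?t j (k + 2))))))) = (\<Sum>j\<in>{1..<2 * Suc m}. X j)"
    unfolding X_def by (rule sum.cong[OF refl], rule pf_pairing_Suc_term) auto
  also have "\<dots> = X 1 + (\<Sum>i<m. X (2 * i + 2) + X (2 * i + 3))"
    by (rule sum_atLeast1_odd)
  \<comment> \<open>Here the transposition is trivial: \<open>b\<close> contracts both ends of block
    0, and the other blocks are untouched.\<close>
  also have "X 1 = (\<Sum>x<n. \<Sum>y<n. b x y * A 0 x y) * pf_pairing n m (A \<circ> Suc) b"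
    unfolding X_def pf_pairing_def sum_distrib_left[of "\<Sum>x<n. \<Sum>y<n. b x y * A 0 x y"]
  proof (rule sum.cong[OF refl])
    fix h
    have "(\<Prod>i<Suc m. A i (?c x y h (?t 1 (2 * i))) (?c x y h (?t 1 (2 * i + 1)))) =
      A 0 x y * (\<Prod>i<m. (A \<circ> Suc) i (h (2 * i)) (h (2 * i + 1)))" for x y
      unfolding prod.lessThan_Suc_shift by simp
    thus "signof (?t 1) * (\<Sum>x<n. \<Sum>y<n. b x y *
     (\<Prod>i<Suc m. A i (?c x y h (?t 1 (2 * i))) (?c x y h (?t 1 (2 * i + 1))))) * perm_pf m b h =
     (\<Sum>x<n. \<Sum>y<n. b x y * A 0 x y) * ((\<Prod>i<m. (A \<circ> Suc) i (h (2 * i)) (h (2 * i + 1))) * perm_pf m b h)"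
      by (simp add: sum_distrib_right mult.assoc del: prod.lessThan_Suc)
  qed
  also have "(\<Sum>i<m. X (2 * i + 2) + X (2 * i + 3)) =
     - (\<Sum>i<m. pf_pairing n m ((A \<circ> Suc)(i := \<lambda>p q. \<Sum>x<n. \<Sum>y<n. b x y * (A 0 x p * A (Suc i) y q))) b +
              pf_pairing n m ((A \<circ> Suc)(i := \<lambda>p q. \<Sum>x<n. \<Sum>y<n. b x y * (A 0 x q * A (Suc i) p y))) b)"
    unfolding sum_negf[symmetric] minus_add_distrib
  proof (intro sum.cong refl arg_cong2[where f="(+)"])
    fix i0 assume "i0 \<in> {..<m}"
    hence i0: "i0 < m" by simp
    let ?P = "\<lambda>h. \<Prod>i\<in>{..<m} - {i0}. (A \<circ> Suc) i (h (2 * i)) (h (2 * i + 1))"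
    \<comment> \<open>The transposition of 1 and \<open>j\<close> meets only block 0 and the block
      containing \<open>j\<close>; every other block just shifts down by two positions.\<close>
    have P: "(\<Prod>i<m. A (Suc i) (?c x y h (?t j (2 * Suc i))) (?c x y h (?t j (2 * Suc i + 1)))) =
      A (Suc i0) (?c x y h (?t j (2 * Suc i0))) (?c x y h (?t j (2 * Suc i0 + 1))) * ?P h"
      if "j = 2 * i0 + 2 \<or> j = 2 * i0 + 3" for j x y h
    proof -
      have "(\<Prod>i\<in>{..<m} - {i0}. A (Suc i) (?c x y h (?t j (2 * Suc i))) (?c x y h (?t j (2 * Suc i + 1)))) = ?P h"
      proof (rule prod.cong[OF refl])
        fix i assume "i \<in> {..<m} - {i0}"
        hence "2 * Suc i \<noteq> j" "2 * Suc i + 1 \<noteq> j" "2 * Suc i \<noteq> 1" using that by auto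
        hence "?t j (2 * Suc i) = Suc (Suc (2 * i))" "?t j (2 * Suc i + 1) = Suc (Suc (2 * i + 1))"
          by (simp_all add: Transposition.transpose_def)
        thus "A (Suc i) (?c x y h (?t j (2 * Suc i))) (?c x y h (?t j (2 * Suc i + 1))) =
          (A \<circ> Suc) i (h (2 * i)) (h (2 * i + 1))" by simp
      qed
      thus ?thesis using i0 by (subst prod.remove[of _ i0]) simp_all
    qed
    \<comment> \<open>Partner at the left end: the free end of block 0 takes the vacated place, so
      \<open>A 0\<close> reads \<open>x\<close> and \<open>h (2 * i0)\<close> while the later kernel
      reads \<open>y\<close> and its own right end. In the other case below the two ends of that
      block exchange roles.\<close>
    show "X (2 * i0 + 2) = - pf_pairing n m ((A \<circ> Suc)(i0 := \<lambda>p q. \<Sum>x<n. \<Sum>y<n. b x y * (A 0 x p * A (Suc i0) y q))) b"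
      unfolding X_def pf_pairing_fun_upd[OF i0] sum_negf[symmetric]
    proof (rule sum.cong[OF refl])
      fix h
      have "(\<Prod>i<Suc m. A i (?c x y h (?t (2 * i0 + 2) (2 * i))) (?c x y h (?t (2 * i0 + 2) (2 * i + 1)))) =
        A 0 x (h (2 * i0)) * A (Suc i0) y (h (2 * i0 + 1)) * ?P h" for x y
        unfolding prod.lessThan_Suc_shift o_def P[OF disjI1[OF refl]]
        by (simp add: Transposition.transpose_def mult_ac)
      thus "signof (?t (2 * i0 + 2)) * (\<Sum>x<n. \<Sum>y<n. b x y *
        (\<Prod>i<Suc m. A i (?c x y h (?t (2 * i0 + 2) (2 * i))) (?c x y h (?t (2 * i0 + 2) (2 * i + 1))))) * perm_pf m b h =
        - ((\<Sum>x<n. \<Sum>y<n. b x y * (A 0 x (h (2 * i0)) * A (Suc i0) y (h (2 * i0 + 1)))) * ?P h * perm_pf m b h)"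
        by (simp add: sum_distrib_right mult.assoc sign_swap_id del: prod.lessThan_Suc)
    qed
    show "X (2 * i0 + 3) = - pf_pairing n m ((A \<circ> Suc)(i0 := \<lambda>p q. \<Sum>x<n. \<Sum>y<n. b x y * (A 0 x q * A (Suc i0) p y))) b"
      unfolding X_def pf_pairing_fun_upd[OF i0] sum_negf[symmetric]
    proof (rule sum.cong[OF refl])
      fix h
      have "(\<Prod>i<Suc m. A i (?c x y h (?t (2 * i0 + 3) (2 * i))) (?c x y h (?t (2 * i0 + 3) (2 * i + 1)))) =
        A 0 x (h (2 * i0 + 1)) * A (Suc i0) (h (2 * i0)) y * ?P h" for x y
        unfolding prod.lessThan_Suc_shift o_def P[OF disjI2[OF refl]]
        by (simp add: Transposition.transpose_def numeral_3_eq_3 mult_ac)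
      thus "signof (?t (2 * i0 + 3)) * (\<Sum>x<n. \<Sum>y<n. b x y *
        (\<Prod>i<Suc m. A i (?c x y h (?t (2 * i0 + 3) (2 * i))) (?c x y h (?t (2 * i0 + 3) (2 * i + 1))))) * perm_pf m b h =
        - ((\<Sum>x<n. \<Sum>y<n. b x y * (A 0 x (h (2 * i0 + 1)) * A (Suc i0) (h (2 * i0)) y)) * ?P h * perm_pf m b h)"
        by (simp add: sum_distrib_right mult.assoc sign_swap_id del: prod.lessThan_Suc)
    qed
  qed
  finally show ?thesis by (simp only: diff_conv_add_uminus)
qed

section \<open>Traces of (A B)^k and the recursion on the Pfaffian side\<close>

definition mtrace :: "'a::comm_ring_1 mat \<Rightarrow> 'a" where
  "mtrace M = (\<Sum>i<dim_row M. M $$ (i, i))"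

lemma index_mult_mat_3:
  assumes "M \<in> carrier_mat n n" "N \<in> carrier_mat n n" "P \<in> carrier_mat n n" "p < n" "q < n"
  shows "(M * N * P) $$ (p, q) = (\<Sum>x<n. \<Sum>y<n. M $$ (p, x) * N $$ (x, y) * (P $$ (y, q) :: 'a::comm_ring_1))"
  using assms by (simp add: scalar_prod_def lessThan_atLeast0 sum_distrib_left mult.assoc)

lemma pow_mat_mult_swap:
  assumes A: "A \<in> carrier_mat n n" and B: "B \<in> carrier_mat n n"
  shows "(A * B) ^\<^sub>m k * A = A * (B * A) ^\<^sub>m k" (is "?l k = ?r k")
proof (induction k)
  case 0
  show ?case using A B by simp
next
  case (Suc k)
  have AB: "A * B \<in> carrier_mat n n" "B * A \<in> carrier_mat n n" using A B by auto
  have c: "(A * B) ^\<^sub>m k \<in> carrier_mat n n" "(B * A) ^\<^sub>m k \<in> carrier_mat n n"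
    using AB by auto
  have "?l (Suc k) = ((A * B) ^\<^sub>m k * A) * (B * A)"
    using A B c AB by (simp add: assoc_mult_mat[of _ n n _ n _ n])
  also have "\<dots> = ?r (Suc k)"
    unfolding Suc.IH using A B c AB by (simp add: assoc_mult_mat[of _ n n _ n _ n])
  finally show ?case .
qed

lemma transpose_pow_mat:
  fixes A :: "'a::comm_ring_1 mat"
  assumes "A \<in> carrier_mat n n"
  shows "transpose_mat (A ^\<^sub>m k) = transpose_mat A ^\<^sub>m k" (is "?l k = ?r k")
proof (induction k)
  case (Suc k)
  have "?l (Suc k) = transpose_mat A * ?l k"
    using assms by (simp add: transpose_mult[OF pow_carrier_mat[OF assms] assms])
  also have "\<dots> = ?r (Suc k)"
    unfolding Suc using pow_mat_mult_swap[of "transpose_mat A" n "1\<^sub>m n" k] assms by simp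
  finally show ?case .
qed (use assms in simp)

lemma pf_pairing_cong:
  assumes "\<And>i p q. i < m \<Longrightarrow> p < n \<Longrightarrow> q < n \<Longrightarrow> A i p q = A' i p q"
  shows "pf_pairing n m A b = pf_pairing n m A' b"
  unfolding pf_pairing_def
  by (intro sum.cong refl arg_cong2[where f="(*)"] prod.cong assms) (auto simp: PiE_iff)

text \<open>Since blocks can be exchanged, the place of the only exceptional kernel does not
  matter.\<close>

lemma pf_pairing_const_fun_upd:
  assumes "i < m"
  shows "pf_pairing n m ((\<lambda>_. a)(i := C)) b = pf_pairing n m ((\<lambda>_. a)(0 := C)) b"
proof -
  have "((\<lambda>_. a)(0 := C)) \<circ> Transposition.transpose 0 i = (\<lambda>_. a)(i := C)"
    by (auto simp: fun_eq_iff Transposition.transpose_def)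
  thus ?thesis using pf_pairing_transpose[of 0 m i n "(\<lambda>_. a)(0 := C)" b] assms by simp
qed

lemma pf_pairing_fun_upd_uminus:
  assumes "i < m"
  shows "pf_pairing n m (A(i := \<lambda>p q. - C p q)) b = - pf_pairing n m (A(i := C)) b"
  unfolding pf_pairing_fun_upd[OF assms] by (simp add: sum_negf)

locale skew_pair =
  fixes n :: nat and a b :: "nat \<Rightarrow> nat \<Rightarrow> 'a::comm_ring_1"
  assumes skew_a: "a x y = - a y x" and skew_b: "b x y = - b y x"
begin

definition "MA = mat n n (\<lambda>(x, y). a x y)"
definition "MB = mat n n (\<lambda>(x, y). b x y)"
text \<open>The kernel produced by k successive gluings, the alternating product A B A ... A with k
  factors B.\<close>

definition "W k = (MA * MB) ^\<^sub>m k * MA"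
definition "T k = mtrace ((MA * MB) ^\<^sub>m k)"
definition "G m = pf_pairing n m (\<lambda>_. a) b"
definition "H k m = pf_pairing n m ((\<lambda>_. a)(0 := \<lambda>p q. W k $$ (p, q))) b"

lemma carrier: "MA \<in> carrier_mat n n" "MB \<in> carrier_mat n n" "W k \<in> carrier_mat n n"
  by (auto simp: MA_def MB_def W_def)

lemma index_M: "x < n \<Longrightarrow> y < n \<Longrightarrow> MA $$ (x, y) = a x y" "x < n \<Longrightarrow> y < n \<Longrightarrow> MB $$ (x, y) = b x y"
  by (auto simp: MA_def MB_def)

lemma transpose_M: "transpose_mat MA = - MA" "transpose_mat MB = - MB"
  by (rule eq_matI; simp add: MA_def MB_def skew_a[symmetric] skew_b[symmetric])+

text \<open>Transposition reverses a palindromic product of 2k + 1 skew factors, which leaves an odd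
  number of signs.\<close>

lemma transpose_W: "transpose_mat (W k) = - W k"
proof -
  have c: "MA * MB \<in> carrier_mat n n" "MB * MA \<in> carrier_mat n n" using carrier by auto
  have "transpose_mat (W k) = (- MA) * transpose_mat (MA * MB) ^\<^sub>m k"
    unfolding W_def using carrier c
    by (simp add: transpose_mult[of _ n n _ n] transpose_pow_mat[of _ n] transpose_M)
  also have "transpose_mat (MA * MB) = MB * MA"
    using carrier by (simp add: transpose_mult[of _ n n _ n] transpose_M)
  also have "(- MA) * (MB * MA) ^\<^sub>m k = - (MA * (MB * MA) ^\<^sub>m k)"
    using carrier c by simp
  also have "\<dots> = - W k"
    unfolding W_def using pow_mat_mult_swap[of MA n MB k] carrier by simp
  finally show ?thesis .
qed

lemma skew_W: "x < n \<Longrightarrow> y < n \<Longrightarrow> W k $$ (x, y) = - W k $$ (y, x)"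
  using arg_cong[OF transpose_W[of k], of "\<lambda>M. M $$ (y, x)"] carrier(3)[of k] by simp

lemma W_Suc: "W (Suc k) = W k * MB * MA" "W (Suc k) = MA * MB * W k"
proof -
  have c: "MA * MB \<in> carrier_mat n n" "MB * MA \<in> carrier_mat n n" using carrier by auto
  have c': "(MA * MB) ^\<^sub>m k \<in> carrier_mat n n" "(MB * MA) ^\<^sub>m k \<in> carrier_mat n n" using c by auto
  show "W (Suc k) = W k * MB * MA"
    unfolding W_def using carrier c c' by (simp add: assoc_mult_mat[of _ n n _ n _ n])
  have "(MA * MB) ^\<^sub>m Suc k = MA * MB * (MA * MB) ^\<^sub>m k"
    using pow_mat_mult_swap[OF c(1) one_carrier_mat, of k] right_mult_one_mat[OF c(1)] left_mult_one_mat[OF c(1)]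
    by simp
  thus "W (Suc k) = MA * MB * W k"
    unfolding W_def by (simp only: assoc_mult_mat[OF c(1) c'(1) carrier(1)])
qed

lemma T_Suc: "T (Suc k) = (\<Sum>x<n. \<Sum>y<n. W k $$ (x, y) * b y x)"
proof -
  have c: "MA * MB \<in> carrier_mat n n" using carrier by auto
  have "(MA * MB) ^\<^sub>m Suc k = W k * MB"
    unfolding W_def using carrier c by (simp add: assoc_mult_mat[of _ n n _ n _ n])
  thus ?thesis
    unfolding T_def mtrace_def using carrier carrier_matD[OF carrier(3)[of k]]
    by (auto simp: scalar_prod_def lessThan_atLeast0 index_M intro!: sum.cong)
qed

lemma H_0: "m > 0 \<Longrightarrow> H 0 m = G m"
  unfolding H_def G_def using carrier by (intro pf_pairing_cong) (auto simp: W_def index_M)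

text \<open>Expanding along the exceptional block closes it, giving a trace, or glues it to one of
  the 2m ends of the other blocks. By skewness each gluing produces \<open>- W (Suc k)\<close>,
  which cancels the minus sign of the expansion.\<close>

lemma H_Suc: "H k (Suc m) = of_nat (2 * Suc m) * (- T (Suc k) * G m + of_nat (2 * m) * H (Suc k) m)"
proof -
  let ?A = "(\<lambda>_. a)(0 := \<lambda>p q. W k $$ (p, q))"
  have s: "?A \<circ> Suc = (\<lambda>_. a)" "?A 0 = (\<lambda>p q. W k $$ (p, q))" "?A (Suc i) = a" for i
    by auto
  \<comment> \<open>The trace needs \<open>b y x\<close>; reading \<open>b x y\<close> instead costs
    the sign.\<close>
  have 1: "(\<Sum>x<n. \<Sum>y<n. b x y * W k $$ (x, y)) = - T (Suc k)"
  proof -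
    have "(\<Sum>x<n. \<Sum>y<n. b x y * W k $$ (x, y)) = (\<Sum>x<n. \<Sum>y<n. - (W k $$ (x, y) * b y x))"
      by (intro sum.cong refl) (subst skew_b, simp)
    thus ?thesis by (simp add: T_Suc sum_negf)
  qed
  have 2: "pf_pairing n m ((\<lambda>_. a)(i := \<lambda>p q. \<Sum>x<n. \<Sum>y<n. b x y * (W k $$ (x, p) * a y q))) b = - H (Suc k) m"
    if i: "i < m" for i
  proof -
    have "pf_pairing n m ((\<lambda>_. a)(i := \<lambda>p q. \<Sum>x<n. \<Sum>y<n. b x y * (W k $$ (x, p) * a y q))) b =
      pf_pairing n m ((\<lambda>_. a)(i := \<lambda>p q. - W (Suc k) $$ (p, q))) b"
    proof (rule pf_pairing_cong)
      fix j p q assume pq: "p < n" "q < n"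
      have "(\<Sum>x<n. \<Sum>y<n. b x y * (W k $$ (x, p) * a y q)) = - W (Suc k) $$ (p, q)"
        unfolding W_Suc(1) index_mult_mat_3[OF carrier(3,2,1) pq] sum_negf[symmetric]
        using pq by (intro sum.cong refl) (simp add: index_M skew_W[of _ p k] mult_ac)
      thus "((\<lambda>_. a)(i := \<lambda>p q. \<Sum>x<n. \<Sum>y<n. b x y * (W k $$ (x, p) * a y q))) j p q =
        ((\<lambda>_. a)(i := \<lambda>p q. - W (Suc k) $$ (p, q))) j p q" by simp
    qed
    thus ?thesis unfolding H_def pf_pairing_fun_upd_uminus[OF i] pf_pairing_const_fun_upd[OF i] .
  qed
  have 3: "pf_pairing n m ((\<lambda>_. a)(i := \<lambda>p q. \<Sum>x<n. \<Sum>y<n. b x y * (W k $$ (x, q) * a p y))) b = - H (Suc k) m"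
    if i: "i < m" for i
  proof -
    have "pf_pairing n m ((\<lambda>_. a)(i := \<lambda>p q. \<Sum>x<n. \<Sum>y<n. b x y * (W k $$ (x, q) * a p y))) b =
      pf_pairing n m ((\<lambda>_. a)(i := \<lambda>p q. - W (Suc k) $$ (p, q))) b"
    proof (rule pf_pairing_cong)
      fix j p q assume pq: "p < n" "q < n"
      have "(\<Sum>x<n. \<Sum>y<n. b x y * (W k $$ (x, q) * a p y)) = (\<Sum>y<n. \<Sum>x<n. - (a p y * b y x * W k $$ (x, q)))"
        by (subst sum.swap) (intro sum.cong refl, subst skew_b, simp add: mult_ac)
      also have "\<dots> = - W (Suc k) $$ (p, q)"
        unfolding W_Suc(2) index_mult_mat_3[OF carrier(1,2,3) pq] sum_negf[symmetric]
        using pq by (intro sum.cong refl) (simp add: index_M)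
      finally show "((\<lambda>_. a)(i := \<lambda>p q. \<Sum>x<n. \<Sum>y<n. b x y * (W k $$ (x, q) * a p y))) j p q =
        ((\<lambda>_. a)(i := \<lambda>p q. - W (Suc k) $$ (p, q))) j p q" by simp
    qed
    thus ?thesis unfolding H_def pf_pairing_fun_upd_uminus[OF i] pf_pairing_const_fun_upd[OF i] .
  qed
  have "H k (Suc m) = of_nat (2 * Suc m) * (- T (Suc k) * G m -
     (\<Sum>i<m. pf_pairing n m ((\<lambda>_. a)(i := \<lambda>p q. \<Sum>x<n. \<Sum>y<n. b x y * (W k $$ (x, p) * a y q))) b +
              pf_pairing n m ((\<lambda>_. a)(i := \<lambda>p q. \<Sum>x<n. \<Sum>y<n. b x y * (W k $$ (x, q) * a p y))) b))"
    unfolding H_def[of k] pf_pairing_Suc[of b, OF skew_b] s 1 G_def ..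
  also have "(\<Sum>i<m. pf_pairing n m ((\<lambda>_. a)(i := \<lambda>p q. \<Sum>x<n. \<Sum>y<n. b x y * (W k $$ (x, p) * a y q))) b +
              pf_pairing n m ((\<lambda>_. a)(i := \<lambda>p q. \<Sum>x<n. \<Sum>y<n. b x y * (W k $$ (x, q) * a p y))) b) =
     (\<Sum>i<m. - H (Suc k) m + - H (Suc k) m)"
    by (intro sum.cong refl arg_cong2[where f="(+)"] 2 3) auto
  also have "\<dots> = - (of_nat (2 * m) * H (Suc k) m)"
    by (simp add: algebra_simps)
  finally show ?thesis by simp
qed

lemma G_0: "G 0 = 1"
  by (simp add: G_def pf_pairing_def perm_pf_def)

text \<open>The two claims are proved together because \<open>H_Suc\<close> trades a smaller
  \<open>m\<close> for a larger \<open>k\<close>. The claim on \<open>H\<close> keeps the factor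
  \<open>2 * m\<close> to avoid division, and the bound \<open>N\<close> allows an \<open>F\<close>
  that satisfies the recursion only up to a truncation degree.\<close>

lemma G_H_closed_form:
  assumes F0: "F 0 = 1"
    and F: "\<And>k. k \<le> N \<Longrightarrow> of_nat (2 * k) * F k = - (\<Sum>j<k. T (Suc j) * F (k - Suc j))"
    and cancel: "\<And>k x y. k > 0 \<Longrightarrow> of_nat k * x = of_nat k * y \<Longrightarrow> x = (y :: 'a)"
    and "m \<le> N"
  shows "G m = of_nat ((2 ^ m * fact m) ^ 2) * F m"
    and "of_nat (2 * m) * H k m = - (of_nat ((2 ^ m * fact m) ^ 2) * (\<Sum>j<m. T (k + Suc j) * F (m - Suc j)))"
  using \<open>m \<le> N\<close>
proof (induction m arbitrary: k)
  case 0
  {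
    case 1
    show ?case by (simp add: G_0 F0)
  next
    case 2
    show ?case by simp
  }
next
  case (Suc m)
  let ?c = "\<lambda>m. of_nat ((2 ^ m * fact m) ^ 2) :: 'a"
  have c: "?c (Suc m) = of_nat ((2 * Suc m) ^ 2) * ?c m"
    by (simp only: of_nat_mult[symmetric]) (simp add: power_mult_distrib power2_eq_square algebra_simps)
  have *: "of_nat (2 * Suc m) * H k (Suc m) = - (?c (Suc m) * (\<Sum>j<Suc m. T (k + Suc j) * F (Suc m - Suc j)))"
    if "m \<le> N" for k
  proof -
    have "of_nat (2 * Suc m) * H k (Suc m) =
      of_nat ((2 * Suc m) ^ 2) * (- T (Suc k) * G m + of_nat (2 * m) * H (Suc k) m)"
      unfolding H_Suc by (simp only: power2_eq_square mult.assoc of_nat_mult)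
    also have "\<dots> = - (of_nat ((2 * Suc m) ^ 2) * ?c m *
       (T (Suc k) * F m + (\<Sum>j<m. T (Suc k + Suc j) * F (m - Suc j))))"
      unfolding Suc.IH(1)[OF that] Suc.IH(2)[OF that] by (simp add: algebra_simps del: of_nat_mult of_nat_power)
    also have "\<dots> = - (?c (Suc m) * (\<Sum>j<Suc m. T (k + Suc j) * F (Suc m - Suc j)))"
      unfolding c sum.lessThan_Suc_shift by simp
    finally show ?thesis .
  qed
  {
    case 1
    \<comment> \<open>With \<open>k = 0\<close> the exceptional kernel is A itself, so the formula
      for \<open>H\<close> becomes one for \<open>G\<close>, and its sum is the right-hand side of
      the recursion for \<open>F\<close>.\<close>
    have "of_nat (2 * Suc m) * G (Suc m) = - (?c (Suc m) * (\<Sum>j<Suc m. T (Suc j) * F (Suc m - Suc j)))"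
      using *[of 0] 1 H_0[of "Suc m"] by simp
    also have "\<dots> = ?c (Suc m) * (of_nat (2 * Suc m) * F (Suc m))"
      unfolding F[OF 1] by (simp only: mult_minus_right)
    also have "\<dots> = of_nat (2 * Suc m) * (?c (Suc m) * F (Suc m))"
      by (simp only: mult_ac)
    finally show ?case by (rule cancel[rotated]) simp
  next
    case 2
    thus ?case using * by simp
  }
qed

end

section \<open>Comparison with the normalized Pfaffian sum\<close>

text \<open>With as many indices as positions, the injective functions are exactly the permutations;
  the sign from \<open>perm_pf_comp\<close> completes the first factor to a full sum over
  permutations.\<close>

lemma pf_pairing_square:
  fixes b :: "nat \<Rightarrow> nat \<Rightarrow> 'a::{idom,ring_char_0}"
  shows "pf_pairing (2 * m) m (\<lambda>_. a) b = perm_pf m a id * perm_pf m b id"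
proof -
  let ?S = "{..<2 * m}"
  let ?F = "\<lambda>f. (\<Prod>i<m. a (f (2 * i)) (f (2 * i + 1))) * perm_pf m b f"
  have "pf_pairing (2 * m) m (\<lambda>_. a) b = (\<Sum>f\<in>{f \<in> ?S \<rightarrow>\<^sub>E ?S. inj_on f ?S}. ?F f)"
    unfolding pf_pairing_def by (intro sum.mono_neutral_right) (auto intro: finite_PiE simp: perm_pf_not_inj)
  also have "\<dots> = (\<Sum>\<rho> | \<rho> permutes ?S. ?F \<rho>)"
  proof (rule sum.reindex_bij_witness[of _ "\<lambda>\<rho>. restrict \<rho> ?S" "\<lambda>f x. if x \<in> ?S then f x else x"], goal_cases)
    case (1 f)
    thus ?case by (auto simp: fun_eq_iff PiE_iff extensional_def)
  next
    case (2 f)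
    hence "bij_betw f ?S ?S"
      by (intro bij_betw_imageI endo_inj_surj) (auto simp: PiE_iff)
    hence "bij_betw (\<lambda>x. if x \<in> ?S then f x else x) ?S ?S"
      by (subst bij_betw_cong[of _ _ f]) auto
    hence "(\<lambda>x. if x \<in> ?S then f x else x) permutes ?S"
      by (rule bij_imp_permutes) simp
    thus ?case by simp
  next
    case (3 \<rho>)
    thus ?case by (auto simp: fun_eq_iff permutes_def)
  next
    case (4 \<rho>)
    hence p: "\<rho> permutes ?S" by simp
    have "inj_on (restrict \<rho> ?S) ?S" using permutes_inj_on[OF p] by (simp add: inj_on_def)
    thus ?case using permutes_in_image[OF p] by auto
  next
    case (5 f)
    show ?case
      by (intro arg_cong2[where f="(*)"] prod.cong perm_pf_cong refl) auto
  qed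
  also have "\<dots> = (\<Sum>\<rho> | \<rho> permutes ?S. signof \<rho> * (\<Prod>i<m. a (\<rho> (2 * i)) (\<rho> (2 * i + 1))) * perm_pf m b id)"
  proof (rule sum.cong[OF refl])
    fix \<rho> assume "\<rho> \<in> {\<rho>. \<rho> permutes ?S}"
    thus "?F \<rho> = signof \<rho> * (\<Prod>i<m. a (\<rho> (2 * i)) (\<rho> (2 * i + 1))) * perm_pf m b id"
      using perm_pf_comp[of \<rho> m b id] by simp
  qed
  also have "\<dots> = perm_pf m a id * perm_pf m b id"
    unfolding perm_pf_def[of m a] sum_distrib_right by simp
  finally show ?thesis .
qed

text \<open>Moves the blocks \<open>{2i, 2i + 1}\<close> by \<open>\<theta>\<close> and swaps the two elements of the blocks in \<open>\<epsilon>\<close>.\<close>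

definition block_perm :: "nat \<Rightarrow> (nat \<Rightarrow> nat) \<Rightarrow> nat set \<Rightarrow> nat \<Rightarrow> nat" where
  "block_perm m \<theta> \<epsilon> k = (if k < 2 * m
     then 2 * \<theta> (k div 2) + (if k div 2 \<in> \<epsilon> then 1 - k mod 2 else k mod 2) else k)"

lemma block_perm_simps:
  assumes "i < m"
  shows "block_perm m \<theta> \<epsilon> (2 * i) = (if i \<in> \<epsilon> then 2 * \<theta> i + 1 else 2 * \<theta> i)"
    and "block_perm m \<theta> \<epsilon> (2 * i + 1) = (if i \<in> \<epsilon> then 2 * \<theta> i else 2 * \<theta> i + 1)"
  using assms by (auto simp: block_perm_def)

lemma nat_block_cases:
  fixes k m :: nat
  assumes "k < 2 * m"
  obtains i where "i < m" "k = 2 * i" | i where "i < m" "k = 2 * i + 1"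
proof (cases "even k")
  case True
  thus ?thesis using that(1)[of "k div 2"] assms by auto
next
  case False
  thus ?thesis using that(2)[of "k div 2"] assms by auto
qed

lemma block_perm_id: "block_perm m id {} = id"
  by (auto simp: block_perm_def fun_eq_iff)

lemma block_perm_insert:
  assumes "i < m" "i \<notin> \<epsilon>"
  shows "block_perm m \<theta> (insert i \<epsilon>) = block_perm m \<theta> \<epsilon> \<circ> Transposition.transpose (2 * i) (2 * i + 1)"
proof
  fix k
  show "block_perm m \<theta> (insert i \<epsilon>) k = (block_perm m \<theta> \<epsilon> \<circ> Transposition.transpose (2 * i) (2 * i + 1)) k"
  proof (cases "k < 2 * m")
    case True
    thus ?thesis
    proof (cases k rule: nat_block_cases)
      case (1 j)
      show ?thesis
      proof (cases "j = i")
        case False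
        hence "2 * j \<noteq> 2 * i" "2 * j \<noteq> 2 * i + 1" by presburger+
        hence "Transposition.transpose (2 * i) (2 * i + 1) (2 * j) = 2 * j"
          by (simp add: Transposition.transpose_def)
        thus ?thesis unfolding 1(2) comp_apply using False
          by (simp only: block_perm_simps[OF 1(1)]) simp
      next
        case True
        show ?thesis unfolding 1(2) comp_apply True transpose_apply_first
          using assms by (simp only: block_perm_simps) simp
      qed
    next
      case (2 j)
      show ?thesis
      proof (cases "j = i")
        case False
        hence "2 * j + 1 \<noteq> 2 * i" "2 * j + 1 \<noteq> 2 * i + 1" by presburger+
        hence "Transposition.transpose (2 * i) (2 * i + 1) (2 * j + 1) = 2 * j + 1"
          by (simp add: Transposition.transpose_def)
        thus ?thesis unfolding 2(2) comp_apply using False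
          by (simp only: block_perm_simps[OF 2(1)]) simp
      next
        case True
        show ?thesis unfolding 2(2) comp_apply True transpose_apply_second
          using assms by (simp only: block_perm_simps) simp
      qed
    qed
  next
    case False
    hence "Transposition.transpose (2 * i) (2 * i + 1) k = k"
      using assms by (intro transpose_apply_other) auto
    thus ?thesis using False by (simp add: block_perm_def)
  qed
qed

lemma block_perm_transpose_comp:
  assumes "u < m" "v < m" "u \<noteq> v" and \<theta>: "\<theta> permutes {..<m}"
  shows "block_perm m (Transposition.transpose u v \<circ> \<theta>) {} =
    (Transposition.transpose (2 * u) (2 * v) \<circ> Transposition.transpose (2 * u + 1) (2 * v + 1)) \<circ> block_perm m \<theta> {}"
    (is "?l = ?t \<circ> ?r")
proof
  fix k
  show "?l k = (?t \<circ> ?r) k"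
  proof (cases "k < 2 * m")
    case True
    thus ?thesis
    proof (cases k rule: nat_block_cases)
      case (1 j)
      show ?thesis
        unfolding 1(2) comp_apply[of ?t] block_perm_simps[OF 1(1)] if_not_P[OF empty_iff[THEN iffD1, THEN notI]]
        using transpose_blocks(1)[OF assms(3), of "\<theta> j"] by simp
    next
      case (2 j)
      show ?thesis
        unfolding 2(2) comp_apply[of ?t] block_perm_simps[OF 2(1)] if_not_P[OF empty_iff[THEN iffD1, THEN notI]]
        using transpose_blocks(2)[OF assms(3), of "\<theta> j"] by simp
    qed
  next
    case False
    hence "?t k = k" using permutes_not_in[OF transpose_blocks(3)[OF assms(3,1,2)], of k] by simp
    thus ?thesis using False by (simp add: block_perm_def)
  qed
qed

text \<open>A transposition of blocks is a pair of transpositions of positions, so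
  \<open>\<theta>\<close> contributes no sign; each swap inside a block contributes -1.\<close>

lemma block_perm_permutes_sign:
  assumes \<theta>: "\<theta> permutes {..<m}" and \<epsilon>: "\<epsilon> \<subseteq> {..<m}"
  shows "block_perm m \<theta> \<epsilon> permutes {..<2 * m} \<and> sign (block_perm m \<theta> \<epsilon>) = (-1) ^ card \<epsilon>"
proof -
  have 1: "block_perm m \<theta> {} permutes {..<2 * m} \<and> sign (block_perm m \<theta> {}) = 1"
  proof (rule permutes_induct[OF \<theta> finite_lessThan])
    show "block_perm m id {} permutes {..<2 * m} \<and> sign (block_perm m id {}) = 1"
      by (simp add: block_perm_id permutes_id)
  next
    fix u v p
    assume uv: "u \<in> {..<m}" "v \<in> {..<m}" "u \<noteq> v" and p: "p permutes {..<m}"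
      and IH: "block_perm m p {} permutes {..<2 * m} \<and> sign (block_perm m p {}) = 1"
    show "block_perm m (Transposition.transpose u v \<circ> p) {} permutes {..<2 * m} \<and>
      sign (block_perm m (Transposition.transpose u v \<circ> p) {}) = 1"
    proof -
      note t = transpose_blocks(3,4)[OF uv(3)]
      have t3: "Transposition.transpose (2 * u) (2 * v) \<circ> Transposition.transpose (2 * u + 1) (2 * v + 1) permutes {..<2 * m}"
        using t(1) uv by simp
      have eq: "block_perm m (Transposition.transpose u v \<circ> p) {} =
        (Transposition.transpose (2 * u) (2 * v) \<circ> Transposition.transpose (2 * u + 1) (2 * v + 1)) \<circ> block_perm m p {}"
        using uv p by (intro block_perm_transpose_comp) auto
      show ?thesis
        unfolding eq
        using permutes_compose[OF conjunct1[OF IH] t3]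
          sign_compose[OF permutes_imp_permutation[OF finite_lessThan t3]
            permutes_imp_permutation[OF finite_lessThan conjunct1[OF IH]]] t(2) IH
        by simp
    qed
  qed
  have "finite \<epsilon>" using \<epsilon> finite_subset by blast
  from this \<epsilon> show ?thesis
  proof (induction \<epsilon>)
    case empty
    show ?case using 1 by simp
  next
    case (insert i \<epsilon>)
    let ?s = "Transposition.transpose (2 * i) (2 * i + 1)"
    have s: "?s permutes {..<2 * m}" using insert.prems by (intro permutes_swap_id) auto
    have IH: "block_perm m \<theta> \<epsilon> permutes {..<2 * m}" "sign (block_perm m \<theta> \<epsilon>) = (-1) ^ card \<epsilon>"
      using insert by auto
    have eq: "block_perm m \<theta> (insert i \<epsilon>) = block_perm m \<theta> \<epsilon> \<circ> ?s"
      using insert by (intro block_perm_insert) auto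
    show ?case
      unfolding eq
      using permutes_compose[OF s IH(1)] sign_compose[OF permutes_imp_permutation[OF finite_lessThan IH(1)]
        permutes_imp_permutation[OF finite_lessThan s]] IH(2) insert.hyps
      by (simp add: sign_swap_id o_def)
  qed
qed

lemma strict_mono_on_image_unique:
  fixes f g :: "nat \<Rightarrow> nat"
  assumes "strict_mono_on {..<m} f" "strict_mono_on {..<m} g" "f ` {..<m} = g ` {..<m}" "i < m"
  shows "f i = g i"
proof -
  have "sorted (map f [0..<m]) \<and> distinct (map f [0..<m])" if "strict_mono_on {..<m} f" for f :: "nat \<Rightarrow> nat"
    using strict_mono_on_imp_inj_on[OF that] strict_mono_on_leD[OF that]
    by (auto simp: sorted_iff_nth_mono distinct_map lessThan_atLeast0)
  hence "map f [0..<m] = map g [0..<m]"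
    using assms by (intro sorted_distinct_set_unique) (auto simp: lessThan_atLeast0)
  thus ?thesis using assms(4) by simp
qed

text \<open>The index set of \<open>pf\<close> in size 2m: pairs written increasingly and ordered by
  their smaller elements.\<close>

definition pf_perms :: "nat \<Rightarrow> (nat \<Rightarrow> nat) set" where
  "pf_perms m = {p. p permutes {..<2 * m} \<and> strict_mono_on {..<m} (\<lambda>i. p (2 * i)) \<and>
     (\<forall>i<m. p (2 * i) < p (2 * i + 1))}"

text \<open>Used for uniqueness of the decomposition: the flipped blocks and the block minima can be
  read off from the composed permutation.\<close>

lemma pf_perms_block_min:
  fixes \<epsilon> :: "nat set"
  assumes p: "p \<in> pf_perms m" and \<theta>: "\<theta> permutes {..<m}" and i: "i < m"
  defines "\<rho> \<equiv> p \<circ> block_perm m \<theta> \<epsilon>"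
  shows "i \<in> \<epsilon> \<longleftrightarrow> \<rho> (2 * i + 1) < \<rho> (2 * i)" and "min (\<rho> (2 * i)) (\<rho> (2 * i + 1)) = p (2 * \<theta> i)"
proof -
  have "\<theta> i < m" using permutes_in_image[OF \<theta>, of i] i by simp
  hence "p (2 * \<theta> i) < p (2 * \<theta> i + 1)" using p by (auto simp: pf_perms_def)
  moreover have "\<rho> (2 * i) = (if i \<in> \<epsilon> then p (2 * \<theta> i + 1) else p (2 * \<theta> i))"
    "\<rho> (2 * i + 1) = (if i \<in> \<epsilon> then p (2 * \<theta> i) else p (2 * \<theta> i + 1))"
    unfolding \<rho>_def comp_apply block_perm_simps[OF i] by auto
  ultimately show "i \<in> \<epsilon> \<longleftrightarrow> \<rho> (2 * i + 1) < \<rho> (2 * i)" "min (\<rho> (2 * i)) (\<rho> (2 * i + 1)) = p (2 * \<theta> i)"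
    by auto
qed

text \<open>A permutation is normalized in a unique way by sorting each of its blocks and then
  sorting the blocks by their minima.\<close>

lemma bij_betw_block_perm:
  "bij_betw (\<lambda>(p, \<theta>, \<epsilon>). p \<circ> block_perm m \<theta> \<epsilon>)
     (pf_perms m \<times> {\<theta>. \<theta> permutes {..<m}} \<times> Pow {..<m}) {\<rho>. \<rho> permutes {..<2 * m}}"
  unfolding bij_betw_def
proof
  show "inj_on (\<lambda>(p, \<theta>, \<epsilon>). p \<circ> block_perm m \<theta> \<epsilon>) (pf_perms m \<times> {\<theta>. \<theta> permutes {..<m}} \<times> Pow {..<m})"
  proof (rule inj_onI)
    fix z z'
    assume z: "z \<in> pf_perms m \<times> {\<theta>. \<theta> permutes {..<m}} \<times> Pow {..<m}"
      and z': "z' \<in> pf_perms m \<times> {\<theta>. \<theta> permutes {..<m}} \<times> Pow {..<m}"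
      and zz': "(case z of (p, \<theta>, \<epsilon>) \<Rightarrow> p \<circ> block_perm m \<theta> \<epsilon>) = (case z' of (p, \<theta>, \<epsilon>) \<Rightarrow> p \<circ> block_perm m \<theta> \<epsilon>)"
    obtain p \<theta> \<epsilon> p' \<theta>' \<epsilon>' where zeq: "z = (p, \<theta>, \<epsilon>)" "z' = (p', \<theta>', \<epsilon>')"
      using prod_cases3 by metis
    have p: "p \<in> pf_perms m" "p' \<in> pf_perms m" and \<theta>: "\<theta> permutes {..<m}" "\<theta>' permutes {..<m}"
      and \<epsilon>: "\<epsilon> \<subseteq> {..<m}" "\<epsilon>' \<subseteq> {..<m}"
      and eq: "p \<circ> block_perm m \<theta> \<epsilon> = p' \<circ> block_perm m \<theta>' \<epsilon>'"
      using z z' zz' zeq by auto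
    have "\<epsilon> = \<epsilon>'"
      using pf_perms_block_min(1)[OF p(1) \<theta>(1), of _ \<epsilon>] pf_perms_block_min(1)[OF p(2) \<theta>(2), of _ \<epsilon>'] \<epsilon> eq
      by auto
    have q: "p (2 * \<theta> i) = p' (2 * \<theta>' i)" if "i < m" for i
      using pf_perms_block_min(2)[OF p(1) \<theta>(1) that, of \<epsilon>] pf_perms_block_min(2)[OF p(2) \<theta>(2) that, of \<epsilon>'] eq
      by simp
    have "(\<lambda>i. p (2 * i)) ` {..<m} = (\<lambda>i. p (2 * i)) ` \<theta> ` {..<m}"
      using permutes_image[OF \<theta>(1)] by simp
    also have "\<dots> = (\<lambda>i. p' (2 * i)) ` \<theta>' ` {..<m}"
      unfolding image_image using q by (intro image_cong) auto
    also have "\<dots> = (\<lambda>i. p' (2 * i)) ` {..<m}"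
      using permutes_image[OF \<theta>(2)] by simp
    finally have pp: "p (2 * i) = p' (2 * i)" if "i < m" for i
      using p that strict_mono_on_image_unique[of m "\<lambda>i. p (2 * i)" "\<lambda>i. p' (2 * i)" i]
      by (auto simp: pf_perms_def)
    have "\<theta> = \<theta>'"
    proof
      fix i
      show "\<theta> i = \<theta>' i"
      proof (cases "i < m")
        case True
        hence "\<theta> i < m" using permutes_in_image[OF \<theta>(1), of i] by simp
        hence "p' (2 * \<theta> i) = p' (2 * \<theta>' i)" using q[OF True] pp by simp
        moreover have "inj p'" using p(2) by (auto simp: pf_perms_def intro: permutes_inj)
        ultimately show ?thesis by (simp add: inj_eq)
      next
        case False
        thus ?thesis using permutes_not_in[OF \<theta>(1), of i] permutes_not_in[OF \<theta>(2), of i] by simp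
      qed
    qed
    moreover have "p = p'"
    proof -
      have "surj (block_perm m \<theta> \<epsilon>)"
        using block_perm_permutes_sign[OF \<theta>(1) \<epsilon>(1)] permutes_surj by blast
      moreover have "p (block_perm m \<theta> \<epsilon> x) = p' (block_perm m \<theta> \<epsilon> x)" for x
        using fun_cong[OF eq, of x] \<open>\<theta> = \<theta>'\<close> \<open>\<epsilon> = \<epsilon>'\<close> by simp
      ultimately show ?thesis by (metis ext surjD)
    qed
    ultimately show "z = z'" unfolding zeq using \<open>\<epsilon> = \<epsilon>'\<close> by simp
  qed
  show "(\<lambda>(p, \<theta>, \<epsilon>). p \<circ> block_perm m \<theta> \<epsilon>) ` (pf_perms m \<times> {\<theta>. \<theta> permutes {..<m}} \<times> Pow {..<m}) =
    {\<rho>. \<rho> permutes {..<2 * m}}" (is "?f ` ?X = ?Y")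
  proof (intro equalityI subsetI)
    fix \<rho> assume "\<rho> \<in> ?f ` ?X"
    then obtain p \<theta> \<epsilon> where "p \<in> pf_perms m" "\<theta> permutes {..<m}" "\<epsilon> \<subseteq> {..<m}" "\<rho> = p \<circ> block_perm m \<theta> \<epsilon>"
      by auto
    thus "\<rho> \<in> ?Y"
      using block_perm_permutes_sign[of \<theta> m \<epsilon>] permutes_compose[of "block_perm m \<theta> \<epsilon>" "{..<2 * m}" p]
      by (auto simp: pf_perms_def)
  next
    fix \<rho> assume "\<rho> \<in> ?Y"
    hence \<rho>: "\<rho> permutes {..<2 * m}" by simp
    have inj: "\<rho> x = \<rho> y \<longleftrightarrow> x = y" for x y using permutes_inj[OF \<rho>] by (simp add: inj_eq)
    define lo where "lo = (\<lambda>i. min (\<rho> (2 * i)) (\<rho> (2 * i + 1)))"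
    define \<epsilon> where "\<epsilon> = {i. i < m \<and> \<rho> (2 * i + 1) < \<rho> (2 * i)}"
    have inj_lo: "inj_on lo {..<m}"
      by (rule inj_onI) (auto simp: lo_def min_def inj split: if_splits; presburger)
    \<comment> \<open>\<open>h\<close> enumerates the block minima increasingly, so that
      \<open>\<theta> i\<close> below is the rank of block \<open>i\<close>.\<close>
    obtain h where h: "bij_betw h {..<card (lo ` {..<m})} (lo ` {..<m})"
      "strict_mono_on {..<card (lo ` {..<m})} h"
      using ex_bij_betw_strict_mono_card[of "lo ` {..<m}"] by auto
    have card: "card (lo ` {..<m}) = m" using card_image[OF inj_lo] by simp
    define \<theta> where "\<theta> = (\<lambda>i. if i < m then inv_into {..<m} h (lo i) else i)"
    have "bij_betw (inv_into {..<m} h \<circ> lo) {..<m} {..<m}"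
      using bij_betw_trans[OF inj_on_imp_bij_betw[OF inj_lo] bij_betw_inv_into[OF h(1)[unfolded card]]] .
    hence "bij_betw \<theta> {..<m} {..<m}"
      by (subst bij_betw_cong[of _ _ "inv_into {..<m} h \<circ> lo"]) (auto simp: \<theta>_def)
    hence \<theta>: "\<theta> permutes {..<m}"
      by (rule bij_imp_permutes) (simp add: \<theta>_def)
    have h\<theta>: "h (\<theta> i) = lo i" if "i < m" for i
    proof -
      have "lo i \<in> h ` {..<m}" using bij_betw_imp_surj_on[OF h(1)[unfolded card]] that by auto
      thus ?thesis using that by (simp add: \<theta>_def f_inv_into_f)
    qed
    let ?K = "block_perm m \<theta> \<epsilon>"
    have \<epsilon>: "\<epsilon> \<subseteq> {..<m}" by (auto simp: \<epsilon>_def)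
    have K: "?K permutes {..<2 * m}" using block_perm_permutes_sign[OF \<theta> \<epsilon>] by simp
    define p where "p = \<rho> \<circ> Hilbert_Choice.inv ?K"
    have pK: "p (?K x) = \<rho> x" for x
      unfolding p_def using permutes_inverses(2)[OF K] by simp
    have p: "p (2 * \<theta> i) = lo i" "p (2 * \<theta> i) < p (2 * \<theta> i + 1)" if i: "i < m" for i
    proof -
      have "p (2 * \<theta> i) = (if i \<in> \<epsilon> then \<rho> (2 * i + 1) else \<rho> (2 * i))"
        "p (2 * \<theta> i + 1) = (if i \<in> \<epsilon> then \<rho> (2 * i) else \<rho> (2 * i + 1))"
        using pK[of "2 * i"] pK[of "2 * i + 1"] by (auto simp only: block_perm_simps[OF i] split: if_splits)
      moreover have "\<rho> (2 * i) \<noteq> \<rho> (2 * i + 1)" by (simp add: inj)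
      ultimately show "p (2 * \<theta> i) = lo i" "p (2 * \<theta> i) < p (2 * \<theta> i + 1)"
        using i by (auto simp: lo_def \<epsilon>_def)
    qed
    have surj: "\<exists>i<m. j = \<theta> i" if "j < m" for j
      using permutes_image[OF \<theta>] that by (metis imageE lessThan_iff)
    have "p \<in> pf_perms m"
      unfolding pf_perms_def
    proof (intro CollectI conjI allI impI)
      show "p permutes {..<2 * m}"
        unfolding p_def by (rule permutes_compose[OF permutes_inv[OF K] \<rho>])
      have ph: "p (2 * j) = h j" if "j < m" for j
        using surj[OF that] p(1) h\<theta> by auto
      show "strict_mono_on {..<m} (\<lambda>i. p (2 * i))"
        using h(2) unfolding card by (auto simp: strict_mono_on_def ph)
      show "p (2 * j) < p (2 * j + 1)" if "j < m" for j
        using surj[OF that] p(2) by auto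
    qed
    moreover have "\<rho> = p \<circ> ?K" using pK by (auto simp: fun_eq_iff)
    ultimately show "\<rho> \<in> ?f ` ?X" using \<theta> \<epsilon> by (intro image_eqI[of _ _ "(p, \<theta>, \<epsilon>)"]) auto
  qed
qed

text \<open>By skewness a permutation and its normal form have the same signed product. There are
  \<open>fact m\<close> choices of \<open>\<theta>\<close> and \<open>2 ^ m\<close> choices of
  \<open>\<epsilon>\<close> for each normal form.\<close>

lemma perm_pf_id_eq_pf:
  fixes b :: "nat \<Rightarrow> nat \<Rightarrow> 'a::comm_ring_1"
  assumes skew: "\<And>x y. b x y = - b y x"
  shows "perm_pf m b id = of_nat (2 ^ m * fact m) * pf (mat (2 * m) (2 * m) (\<lambda>(x, y). b x y))"
proof -
  let ?w = "\<lambda>\<rho>. signof \<rho> * (\<Prod>i<m. b (\<rho> (2 * i)) (\<rho> (2 * i + 1)))"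
  have w: "?w (p \<circ> block_perm m \<theta> \<epsilon>) = ?w p"
    if p: "p \<in> pf_perms m" and \<theta>: "\<theta> permutes {..<m}" and \<epsilon>: "\<epsilon> \<subseteq> {..<m}" for p \<theta> \<epsilon>
  proof -
    let ?K = "block_perm m \<theta> \<epsilon>"
    have pp: "p permutes {..<2 * m}" using p by (simp add: pf_perms_def)
    note K = block_perm_permutes_sign[OF \<theta> \<epsilon>]
    have s: "signof (p \<circ> ?K) = (signof p * (-1) ^ card \<epsilon> :: 'a)"
      using K signof_comp[OF pp conjunct1[OF K] finite_lessThan, where 'a='a] by simp
    have "(\<Prod>i<m. b ((p \<circ> ?K) (2 * i)) ((p \<circ> ?K) (2 * i + 1))) =
      (\<Prod>i<m. (if i \<in> \<epsilon> then -1 else 1) * b (p (2 * \<theta> i)) (p (2 * \<theta> i + 1)))"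
    proof (rule prod.cong[OF refl])
      fix i assume "i \<in> {..<m}"
      thus "b ((p \<circ> ?K) (2 * i)) ((p \<circ> ?K) (2 * i + 1)) =
        (if i \<in> \<epsilon> then -1 else 1) * b (p (2 * \<theta> i)) (p (2 * \<theta> i + 1))"
        unfolding comp_apply using skew[of "p (2 * \<theta> i + 1)"] by (simp only: block_perm_simps lessThan_iff) simp
    qed
    also have "\<dots> = (\<Prod>i<m. (if i \<in> \<epsilon> then -1 else 1)) * (\<Prod>i<m. b (p (2 * \<theta> i)) (p (2 * \<theta> i + 1)))"
      by (rule prod.distrib)
    also have "(\<Prod>i<m. (if i \<in> \<epsilon> then -1 else 1)) = (-1 :: 'a) ^ card \<epsilon>"
      using \<epsilon> by (simp add: prod.If_cases Int_absorb1)
    also have "(\<Prod>i<m. b (p (2 * \<theta> i)) (p (2 * \<theta> i + 1))) = (\<Prod>i<m. b (p (2 * i)) (p (2 * i + 1)))"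
      by (rule prod.reindex_bij_betw[OF permutes_imp_bij[OF \<theta>]])
    finally show ?thesis
      unfolding s by (simp add: mult_ac flip: power_mult_distrib)
  qed
  have fin: "finite (pf_perms m)"
    by (rule finite_subset[OF _ finite_permutations[of "{..<2 * m}"]]) (auto simp: pf_perms_def)
  have "perm_pf m b id = (\<Sum>(p, \<theta>, \<epsilon>)\<in>pf_perms m \<times> {\<theta>. \<theta> permutes {..<m}} \<times> Pow {..<m}. ?w (p \<circ> block_perm m \<theta> \<epsilon>))"
    unfolding perm_pf_def id_apply
    using sum.reindex_bij_betw[OF bij_betw_block_perm[of m], of ?w, symmetric] by (simp add: case_prod_unfold)
  also have "\<dots> = (\<Sum>(p, \<theta>, \<epsilon>)\<in>pf_perms m \<times> {\<theta>. \<theta> permutes {..<m}} \<times> Pow {..<m}. ?w p)"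
    by (rule sum.cong[OF refl]) (use w in auto)
  also have "\<dots> = (\<Sum>p\<in>pf_perms m. \<Sum>q\<in>{\<theta>. \<theta> permutes {..<m}} \<times> Pow {..<m}. ?w p)"
    unfolding sum.cartesian_product by (simp add: case_prod_unfold)
  also have "\<dots> = of_nat (2 ^ m * fact m) * (\<Sum>p\<in>pf_perms m. ?w p)"
    by (simp add: card_cartesian_product card_Pow card_permutations[OF refl] sum_distrib_left mult_ac)
  also have "(\<Sum>p\<in>pf_perms m. ?w p) = pf (mat (2 * m) (2 * m) (\<lambda>(x, y). b x y))"
    unfolding pf_def Let_def
  proof (rule sum.cong)
    show "pf_perms m = {p. p permutes {0..<dim_row (mat (2 * m) (2 * m) (\<lambda>(x, y). b x y))} \<and>
      strict_mono_on {..<dim_row (mat (2 * m) (2 * m) (\<lambda>(x, y). b x y)) div 2} (\<lambda>i. p (2 * i)) \<and>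
      (\<forall>i<dim_row (mat (2 * m) (2 * m) (\<lambda>(x, y). b x y)) div 2. p (2 * i) < p (2 * i + 1))}"
      by (simp add: pf_perms_def lessThan_atLeast0)
    fix p assume "p \<in> {p. p permutes {0..<dim_row (mat (2 * m) (2 * m) (\<lambda>(x, y). b x y))} \<and>
      strict_mono_on {..<dim_row (mat (2 * m) (2 * m) (\<lambda>(x, y). b x y)) div 2} (\<lambda>i. p (2 * i)) \<and>
      (\<forall>i<dim_row (mat (2 * m) (2 * m) (\<lambda>(x, y). b x y)) div 2. p (2 * i) < p (2 * i + 1))}"
    hence p: "p permutes {0..<2 * m}" by simp
    have "p (2 * i) < 2 * m" "p (2 * i + 1) < 2 * m" if "i < m" for i
      using permutes_in_image[OF p, of "2 * i"] permutes_in_image[OF p, of "2 * i + 1"] that by auto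
    thus "?w p = signof p * (\<Prod>i<dim_row (mat (2 * m) (2 * m) (\<lambda>(x, y). b x y)) div 2.
      mat (2 * m) (2 * m) (\<lambda>(x, y). b x y) $$ (p (2 * i), p (2 * i + 1)))"
      by (simp add: lessThan_atLeast0)
  qed
  finally show ?thesis .
qed

subsection \<open>Newton's identities for the characteristic polynomial\<close>

lemma mtrace_add:
  assumes "M \<in> carrier_mat n n" "N \<in> carrier_mat n n"
  shows "mtrace (M + N) = mtrace M + mtrace N"
  using assms by (simp add: mtrace_def sum.distrib)

lemma mtrace_smult: "M \<in> carrier_mat n n \<Longrightarrow> mtrace (c \<cdot>\<^sub>m M) = c * mtrace M"
  by (simp add: mtrace_def sum_distrib_left)

lemma mtrace_one: "mtrace (1\<^sub>m n) = of_nat n"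
  by (simp add: mtrace_def)

lemma mtrace_mult_comm:
  assumes "M \<in> carrier_mat n n" "N \<in> carrier_mat n n"
  shows "mtrace (M * N) = mtrace (N * M)"
proof -
  have "mtrace (M * N) = (\<Sum>i<n. \<Sum>j<n. M $$ (i, j) * N $$ (j, i))"
    using assms by (simp add: mtrace_def scalar_prod_def lessThan_atLeast0)
  also have "\<dots> = (\<Sum>i<n. \<Sum>j<n. N $$ (i, j) * M $$ (j, i))"
    by (subst sum.swap) (simp add: mult.commute)
  also have "\<dots> = mtrace (N * M)"
    using assms by (simp add: mtrace_def scalar_prod_def lessThan_atLeast0)
  finally show ?thesis .
qed

lemma mtrace_transpose: "M \<in> carrier_mat n n \<Longrightarrow> mtrace (transpose_mat M) = mtrace M"
  by (simp add: mtrace_def)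

text \<open>The coefficient of t^k in det (1 - t A), and 0 when k exceeds the size.\<close>

definition signed_sigma :: "'a::comm_ring_1 mat \<Rightarrow> nat \<Rightarrow> 'a" where
  "signed_sigma A k = (-1) ^ k * sigma k A"

lemma signed_sigma_eq:
  assumes "A \<in> carrier_mat n n"
  shows "signed_sigma A k = (if k \<le> n then coeff (char_poly A) (n - k) else 0)"
  using assms by (auto simp: signed_sigma_def sigma_def mult.assoc[symmetric] simp flip: power_add mult_2)

lemma signed_sigma_0: "A \<in> carrier_mat n n \<Longrightarrow> signed_sigma A 0 = 1"
  using degree_monic_char_poly[of A n] by (simp add: signed_sigma_eq)

lemma smult_mat_zero_one:
  "A \<in> carrier_mat n m \<Longrightarrow> 0 \<cdot>\<^sub>m A = (0\<^sub>m n m :: 'a::comm_ring_1 mat)"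
  "(1 :: 'a::comm_ring_1) \<cdot>\<^sub>m A = A"
  by auto

text \<open>The matrices \<open>C i\<close> are the coefficients of the adjugate of x - A. Comparing
  coefficients in (x - A) adj(x - A) = char_poly A gives the two recursions; the trace formula says
  that the trace of the adjugate is the derivative of the characteristic polynomial.\<close>

lemma adj_char_poly_coeff:
  fixes A :: "'a::idom mat"
  assumes A: "A \<in> carrier_mat n n"
  obtains C where "\<And>i. C i \<in> carrier_mat n n"
    and "A * C 0 + coeff (char_poly A) 0 \<cdot>\<^sub>m 1\<^sub>m n = 0\<^sub>m n n"
    and "\<And>i. C i = A * C (Suc i) + coeff (char_poly A) (Suc i) \<cdot>\<^sub>m 1\<^sub>m n"
    and "\<And>i. mtrace (C i) = of_nat (Suc i) * coeff (char_poly A) (Suc i)"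
    and "\<And>i. n \<le> i \<Longrightarrow> C i = 0\<^sub>m n n"
proof -
  let ?P = "char_poly_matrix A" and ?B = "adj_mat (char_poly_matrix A)" and ?x = "char_poly A"
  have P: "?P \<in> carrier_mat n n" using A by simp
  have B: "?B \<in> carrier_mat n n" by (rule adj_mat(1)[OF P])
  define C where "C = (\<lambda>i. mat n n (\<lambda>(r, s). coeff (?B $$ (r, s)) i))"
  have entry: "[:0, 1:] * ?B $$ (r, s) - (\<Sum>t<n. [:A $$ (r, t):] * ?B $$ (t, s)) = (if r = s then ?x else 0)"
    if "r < n" "s < n" for r s
  proof -
    have "(?P * ?B) $$ (r, s) = (\<Sum>t<n. ?P $$ (r, t) * ?B $$ (t, s))"
      using that P B by (simp add: scalar_prod_def lessThan_atLeast0)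
    also have "\<dots> = (\<Sum>t<n. (if r = t then [:0, 1:] * ?B $$ (t, s) else 0) - [:A $$ (r, t):] * ?B $$ (t, s))"
      using that A by (intro sum.cong refl) (auto simp: char_poly_matrix_def algebra_simps)
    also have "\<dots> = [:0, 1:] * ?B $$ (r, s) - (\<Sum>t<n. [:A $$ (r, t):] * ?B $$ (t, s))"
      using that by (simp add: sum_subtractf)
    finally show ?thesis
      using adj_mat(2)[OF P] that by (cases "r = s") (simp_all add: char_poly_def)
  qed
  have C: "C i \<in> carrier_mat n n" for i by (simp add: C_def)
  have AC: "(A * C i) $$ (r, s) = coeff (\<Sum>t<n. [:A $$ (r, t):] * ?B $$ (t, s)) i"
    if "r < n" "s < n" for r s i
    using that A by (simp add: C_def scalar_prod_def lessThan_atLeast0 coeff_sum)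
  have C0: "A * C 0 + coeff ?x 0 \<cdot>\<^sub>m 1\<^sub>m n = 0\<^sub>m n n"
  proof (rule eq_matI)
    fix r s assume "r < dim_row (0\<^sub>m n n :: 'a mat)" "s < dim_col (0\<^sub>m n n :: 'a mat)"
    hence rs: "r < n" "s < n" by auto
    have "- coeff (\<Sum>t<n. [:A $$ (r, t):] * ?B $$ (t, s)) 0 = (if r = s then coeff ?x 0 else 0)"
      using arg_cong[OF entry[OF rs], of "\<lambda>p. coeff p 0"] by (auto split: if_splits)
    thus "(A * C 0 + coeff ?x 0 \<cdot>\<^sub>m 1\<^sub>m n) $$ (r, s) = 0\<^sub>m n n $$ (r, s)"
      using rs A C[of 0] AC[OF rs, of 0] by (auto simp del: index_mult_mat(1) split: if_splits simp: add_eq_0_iff)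
  qed (use A C in auto)
  have rec: "C i = A * C (Suc i) + coeff ?x (Suc i) \<cdot>\<^sub>m 1\<^sub>m n" for i
  proof (rule eq_matI)
    fix r s assume "r < dim_row (A * C (Suc i) + coeff ?x (Suc i) \<cdot>\<^sub>m 1\<^sub>m n)"
      "s < dim_col (A * C (Suc i) + coeff ?x (Suc i) \<cdot>\<^sub>m 1\<^sub>m n)"
    hence rs: "r < n" "s < n" using A C[of "Suc i"] by auto
    have "coeff (?B $$ (r, s)) i - coeff (\<Sum>t<n. [:A $$ (r, t):] * ?B $$ (t, s)) (Suc i) = (if r = s then coeff ?x (Suc i) else 0)"
      using arg_cong[OF entry[OF rs], of "\<lambda>p. coeff p (Suc i)"] by (auto split: if_splits)
    moreover have "C i $$ (r, s) = coeff (?B $$ (r, s)) i" using rs by (simp add: C_def)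
    ultimately show "C i $$ (r, s) = (A * C (Suc i) + coeff ?x (Suc i) \<cdot>\<^sub>m 1\<^sub>m n) $$ (r, s)"
      using rs A C[of "Suc i"] AC[OF rs, of "Suc i"]
      by (auto simp del: index_mult_mat(1) split: if_splits simp: algebra_simps)
  qed (use A C[of "Suc i"] C[of i] in auto)
  \<comment> \<open>The diagonal cofactors are the characteristic polynomials of the principal
    submatrices of size n - 1.\<close>
  have trB: "(\<Sum>i<n. ?B $$ (i, i)) = pderiv ?x"
    unfolding pderiv_char_poly[OF A]
  proof (rule sum.cong[OF refl])
    fix i assume "i \<in> {..<n}"
    hence i: "i < n" by simp
    have "?B $$ (i, i) = det (mat_delete ?P i i)"
      using i P by (simp add: adj_mat_def cofactor_def)
    also have "\<dots> = char_poly (mat_delete A i i)"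
      unfolding char_poly_def char_poly_matrix_def
    proof (rule arg_cong[of _ _ det])
      show "mat_delete ([:0, 1:] \<cdot>\<^sub>m 1\<^sub>m (dim_row A) + map_mat (\<lambda>a. [:- a:]) A) i i =
        [:0, 1:] \<cdot>\<^sub>m 1\<^sub>m (dim_row (mat_delete A i i)) + map_mat (\<lambda>a. [:- a:]) (mat_delete A i i)"
        using i A by (auto simp: mat_delete_def)
    qed
    finally show "?B $$ (i, i) = char_poly (mat_delete A i i)" .
  qed
  have tr: "mtrace (C i) = of_nat (Suc i) * coeff ?x (Suc i)" for i
  proof -
    have "mtrace (C i) = coeff (\<Sum>i<n. ?B $$ (i, i)) i"
      by (simp add: mtrace_def C_def coeff_sum)
    thus ?thesis by (simp only: trB coeff_pderiv)
  qed
  have big: "C i = 0\<^sub>m n n" if "n \<le> i" for i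
  proof -
    \<comment> \<open>Any bound on the degrees of all entries will do; from there the recursion
      propagates vanishing down to index n.\<close>
    define D where "D = (\<Sum>r<n. \<Sum>s<n. Suc (degree (?B $$ (r, s))))"
    have D: "C j = 0\<^sub>m n n" if "D \<le> j" for j
    proof (rule eq_matI)
      fix r s assume "r < dim_row (0\<^sub>m n n :: 'a mat)" "s < dim_col (0\<^sub>m n n :: 'a mat)"
      hence rs: "r < n" "s < n" by auto
      have "Suc (degree (?B $$ (r, s))) \<le> (\<Sum>s<n. Suc (degree (?B $$ (r, s))))"
        by (rule member_le_sum[of s "{..<n}" "\<lambda>s. Suc (degree (?B $$ (r, s)))"]) (use rs in auto)
      also have "\<dots> \<le> D"
        unfolding D_def by (rule member_le_sum[of r "{..<n}"]) (use rs in auto)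
      finally have "degree (?B $$ (r, s)) < j" using that by simp
      thus "C j $$ (r, s) = 0\<^sub>m n n $$ (r, s)" using rs by (simp add: C_def coeff_eq_0)
    qed (auto simp: C_def)
    have step: "C j = 0\<^sub>m n n" if "n \<le> j" "C (Suc j) = 0\<^sub>m n n" for j
    proof -
      have "coeff ?x (Suc j) = 0"
        using degree_monic_char_poly[OF A] that(1) by (intro coeff_eq_0) auto
      thus ?thesis using rec[of j] that(2) A by (simp add: smult_mat_zero_one)
    qed
    show ?thesis
    proof (cases "i \<le> D")
      case True
      thus ?thesis using \<open>n \<le> i\<close>
        by (induction i rule: inc_induct) (auto intro: D step)
    qed (auto intro: D)
  qed
  show thesis by (rule that[OF C C0 rec tr big])
qed

text \<open>The trace of one matrix is computed twice: from the derivative of the characteristic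
  polynomial, and by unrolling a Horner scheme in A. The identity also covers k > n, where the
  coefficients vanish.\<close>

lemma newton_identity:
  fixes A :: "'a::idom mat"
  assumes A: "A \<in> carrier_mat n n"
  shows "of_nat k * signed_sigma A k = - (\<Sum>l<k. mtrace (A ^\<^sub>m Suc l) * signed_sigma A (k - Suc l))"
proof -
  obtain C where Cc: "\<And>i. C i \<in> carrier_mat n n"
    and C_facts: "A * C 0 + coeff (char_poly A) 0 \<cdot>\<^sub>m 1\<^sub>m n = 0\<^sub>m n n"
      "\<And>i. C i = A * C (Suc i) + coeff (char_poly A) (Suc i) \<cdot>\<^sub>m 1\<^sub>m n"
      "\<And>i. mtrace (C i) = of_nat (Suc i) * coeff (char_poly A) (Suc i)"
      "\<And>i. n \<le> i \<Longrightarrow> C i = 0\<^sub>m n n"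
    using adj_char_poly_coeff[OF A] by blast
  \<comment> \<open>Reversed order turns the recursion into the Horner scheme: b k = A^k + a_1
    A^(k-1) + ... + a_k, where a_i is \<open>signed_sigma A i\<close>.\<close>
  define b where "b = (\<lambda>k. if k < n then C (n - 1 - k) else 0\<^sub>m n n)"
  let ?a = "signed_sigma A"
  have b: "b k \<in> carrier_mat n n" for k by (simp add: b_def Cc)
  have Ap: "A ^\<^sub>m k \<in> carrier_mat n n" for k using A by simp
  have b0: "b 0 = 1\<^sub>m n"
  proof (cases n)
    case 0
    thus ?thesis by (auto simp: b_def)
  next
    case (Suc n')
    have "C n' = A * C n + coeff (char_poly A) n \<cdot>\<^sub>m 1\<^sub>m n" using C_facts(2)[of n'] Suc by simp
    thus ?thesis using C_facts(4)[of n] degree_monic_char_poly[OF A] A Suc by (simp add: b_def smult_mat_zero_one)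
  qed
  \<comment> \<open>At \<open>Suc k = n\<close> the left side is 0, which is the Cayley-Hamilton
    theorem.\<close>
  have bS: "b (Suc k) = A * b k + ?a (Suc k) \<cdot>\<^sub>m 1\<^sub>m n" for k
  proof -
    consider "Suc k < n" | "Suc k = n" | "n < Suc k" by linarith
    thus ?thesis
    proof cases
      case 1
      hence "Suc (n - 1 - Suc k) = n - 1 - k" "n - 1 - k = n - Suc k" by auto
      thus ?thesis using C_facts(2)[of "n - 1 - Suc k"] 1 by (simp add: b_def signed_sigma_eq[OF A])
    next
      case 2
      thus ?thesis using C_facts(1) by (simp add: b_def signed_sigma_eq[OF A])
    next
      case 3
      thus ?thesis using A by (simp add: b_def signed_sigma_eq[OF A] smult_mat_zero_one(1)[OF one_carrier_mat])
    qed
  qed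
  have trb: "mtrace (A ^\<^sub>m j * b k) = (\<Sum>l\<le>k. ?a (k - l) * mtrace (A ^\<^sub>m (j + l)))" for j k
  proof (induction k arbitrary: j)
    case 0
    show ?case using Ap[of j] by (simp add: b0 signed_sigma_0[OF A] right_mult_one_mat[of _ n n])
  next
    case (Suc k)
    have "A ^\<^sub>m j * b (Suc k) = A ^\<^sub>m Suc j * b k + ?a (Suc k) \<cdot>\<^sub>m A ^\<^sub>m j"
      unfolding bS using A Ap[of j] b[of k]
      by (simp add: mult_add_distrib_mat[of _ n n _ n] mult_smult_distrib[of _ n n _ n] assoc_mult_mat[of _ n n _ n _ n])
    hence "mtrace (A ^\<^sub>m j * b (Suc k)) = mtrace (A ^\<^sub>m Suc j * b k) + ?a (Suc k) * mtrace (A ^\<^sub>m j)"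
      using Ap[of j] Ap[of "Suc j"] b[of k] by (simp add: mtrace_add[of _ n] mtrace_smult[of _ n])
    thus ?case
      unfolding Suc.IH sum.atMost_Suc_shift by simp
  qed
  have 1: "mtrace (b k) = (of_nat n - of_nat k) * ?a k"
  proof (cases "k < n")
    case True
    hence "Suc (n - 1 - k) = n - k" by simp
    thus ?thesis using C_facts(3)[of "n - 1 - k"] True
      by (simp add: b_def signed_sigma_eq[OF A] of_nat_diff del: of_nat_Suc)
  next
    case False
    thus ?thesis by (cases "k = n") (simp_all add: b_def mtrace_def signed_sigma_eq[OF A])
  qed
  have 2: "mtrace (b k) = (\<Sum>l\<le>k. ?a (k - l) * mtrace (A ^\<^sub>m l))"
    using trb[of 0 k] b[of k] A by simp
  \<comment> \<open>The term l = 0 is the trace of the identity times a_k; it cancels against the n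
    in fact 1.\<close>
  have 3: "(\<Sum>l\<le>k. ?a (k - l) * mtrace (A ^\<^sub>m l)) = of_nat n * ?a k + (\<Sum>l<k. ?a (k - Suc l) * mtrace (A ^\<^sub>m Suc l))"
  proof -
    have "{..k} = {..<Suc k}" by auto
    thus ?thesis using A by (simp only: sum.lessThan_Suc_shift) (simp add: mtrace_one)
  qed
  have "(of_nat n - of_nat k) * ?a k = of_nat n * ?a k + (\<Sum>l<k. ?a (k - Suc l) * mtrace (A ^\<^sub>m Suc l))"
    using 1 2 3 by (simp only:)
  hence *: "- (of_nat k * ?a k) = (\<Sum>l<k. ?a (k - Suc l) * mtrace (A ^\<^sub>m Suc l))"
    by (simp add: left_diff_distrib)
  show ?thesis
    using arg_cong[OF *, of uminus] by (simp only: minus_minus mult.commute)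
qed

subsection \<open>Primitive words and cyclic equivalence\<close>

abbreviation wpow :: "'a list \<Rightarrow> nat \<Rightarrow> 'a list" where
  "wpow u k \<equiv> concat (replicate k u)"

lemma length_wpow: "length (wpow u k) = k * length u"
  by (induction k) auto

lemma wpow_add: "wpow u (k + l) = wpow u k @ wpow u l"
  by (simp add: replicate_add)

lemma wpow_mult: "wpow (wpow u k) l = wpow u (l * k)"
  by (induction l) (simp_all add: replicate_add)

lemma nth_wpow: "i < k * length u \<Longrightarrow> wpow u k ! i = u ! (i mod length u)"
proof (induction k arbitrary: i)
  case (Suc k)
  show ?case
  proof (cases "i < length u")
    case False
    thus ?thesis using Suc by (simp add: nth_append le_mod_geq)
  qed (simp add: nth_append)
qed simp

lemma rotate_wpow: "rotate r (wpow u k) = wpow (rotate r u) k"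
proof (induction r)
  case (Suc r)
  have "rotate1 (wpow v k) = wpow (rotate1 v) k" for v :: "'a list"
  proof (cases v)
    case (Cons a t)
    have "wpow (a # t) k @ [a] = a # wpow (t @ [a]) k"
      by (induction k) auto
    thus ?thesis using Cons by (cases k) auto
  qed auto
  thus ?case using Suc by simp
qed simp

lemma wpow_eq_wpow:
  assumes "length u = length v" "wpow u k = wpow v k" "k > 0"
  shows "u = v"
  using assms by (cases k) auto

lemma rotate_mult_id: "rotate r c = c \<Longrightarrow> rotate (r * x) c = c"
  by (induction x) (simp_all add: rotate_rotate[symmetric])

lemma rotate_gcd:
  assumes "rotate r c = c" "rotate s c = c"
  shows "rotate (gcd r s) c = c"
proof (cases "r = 0")
  case False
  then obtain x y where "r * x = s * y + gcd r s" using bezout_nat by blast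
  hence "rotate (gcd r s) (rotate (s * y) c) = rotate (r * x) c"
    by (simp add: rotate_rotate add.commute)
  thus ?thesis using assms by (simp add: rotate_mult_id)
qed (use assms in simp)

lemma rotate_id_imp_wpow:
  assumes "rotate d c = c" "d dvd length c" "d > 0"
  shows "c = wpow (take d c) (length c div d)"
proof (cases "c = []")
  case False
  hence d: "d \<le> length c" using assms(2) by (simp add: dvd_imp_le)
  have l: "length (take d c) = d" using d by simp
  have *: "c ! i = c ! (i mod d)" if "i < length c" for i
    using that
  proof (induction i rule: less_induct)
    case (less i)
    show ?case
    proof (cases "i < d")
      case False
      hence "c ! (i - d) = rotate d c ! (i - d)" using assms by simp
      also have "\<dots> = c ! i" using False less.prems by (simp add: nth_rotate)
      finally show ?thesis using less.IH[of "i - d"] False assms(3) less.prems by (simp add: le_mod_geq)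
    qed simp
  qed
  show ?thesis
  proof (rule nth_equalityI)
    show "length c = length (wpow (take d c) (length c div d))"
      using l assms(2) by (simp add: length_wpow)
    fix i assume i: "i < length c"
    show "c ! i = wpow (take d c) (length c div d) ! i"
      using i l assms(2,3) *[OF i] by (subst nth_wpow) auto
  qed
qed simp

lemma primitive_word_not_Nil: "primitive_word c \<Longrightarrow> c \<noteq> []"
  unfolding primitive_word_def by (auto intro!: exI[of _ 2] exI[of _ "[]"])

lemma div_gt_1:
  fixes d L :: nat
  assumes "d dvd L" "L > 0" "d \<noteq> L"
  shows "L div d > 1"
proof -
  obtain q where q: "L = d * q" using assms(1) by blast
  hence "q \<noteq> 0" "q \<noteq> 1" "d > 0" using assms by auto
  thus ?thesis using q by simp
qed

text \<open>Otherwise the gcd of \<open>r\<close> and the length would be a proper divisor of the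
  length and a period, making \<open>c\<close> a proper power.\<close>

lemma primitive_word_rotate_id:
  assumes c: "primitive_word c" and r: "rotate r c = c"
  shows "length c dvd r"
proof (rule ccontr)
  assume "\<not> length c dvd r"
  let ?d = "gcd r (length c)"
  have L: "length c > 0" using primitive_word_not_Nil[OF c] by simp
  have "rotate ?d c = c" using r by (intro rotate_gcd) auto
  moreover have d: "?d dvd length c" "?d > 0" using L by auto
  ultimately have c_eq: "c = wpow (take ?d c) (length c div ?d)" by (rule rotate_id_imp_wpow)
  have "?d \<noteq> length c" using \<open>\<not> length c dvd r\<close> by (metis gcd_dvd1)
  hence "length c div ?d > 1" using div_gt_1[OF d(1)] L by blast
  with c_eq show False using c unfolding primitive_word_def by blast
qed

lemma primitive_word_rotate: "primitive_word (rotate r c) \<longleftrightarrow> primitive_word c"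
proof -
  have *: "primitive_word (rotate r c)" if "primitive_word c" for r c
    unfolding primitive_word_def
  proof clarify
    fix u k assume k: "(1::nat) < k" "rotate r c = wpow u k"
    let ?s = "length c - r mod length c"
    have "rotate ?s (rotate r c) = c"
      using primitive_word_not_Nil[OF that]
      by (subst rotate_conv_mod[of r]) (simp add: rotate_rotate mod_less_divisor less_imp_le)
    hence "c = wpow (rotate ?s u) k" using k(2) by (simp add: rotate_wpow)
    thus False using that k(1) unfolding primitive_word_def by blast
  qed
  show ?thesis
  proof
    assume p: "primitive_word (rotate r c)"
    let ?s = "length c - r mod length c"
    have "c \<noteq> []" using primitive_word_not_Nil[OF p] by simp
    hence "rotate ?s (rotate r c) = c"
      by (subst rotate_conv_mod[of r]) (simp add: rotate_rotate mod_less_divisor less_imp_le)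
    thus "primitive_word c" using *[OF p, of ?s] by simp
  qed (rule *)
qed

lemma primitive_word_rotate_inj:
  assumes c: "primitive_word c" and rs: "r < length c" "s < length c" "rotate r c = rotate s c"
  shows "r = s"
proof -
  have *: "r = s" if "r \<le> s" "s < length c" "rotate r c = rotate s c" for r s
  proof -
    have "rotate (s - r) (rotate r c) = rotate r c"
      unfolding rotate_rotate using that by simp
    hence "length (rotate r c) dvd s - r"
      using c by (intro primitive_word_rotate_id) (simp_all add: primitive_word_rotate)
    thus ?thesis using that by (auto dest: dvd_imp_le)
  qed
  show ?thesis using *[of r s] *[of s r] rs by (cases "r \<le> s") auto
qed

lemma letter_tr_letter_tr [simp]: "letter_tr (letter_tr a) = a" and letter_tr_neq [simp]: "letter_tr a \<noteq> a"
  by (cases a; simp)+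

lemma word_tr_word_tr [simp]: "word_tr (word_tr w) = w"
  by (simp add: word_tr_def rev_map[symmetric] o_def)

lemma length_word_tr [simp]: "length (word_tr w) = length w"
  by (simp add: word_tr_def)

lemma word_tr_append: "word_tr (u @ v) = word_tr v @ word_tr u"
  by (simp add: word_tr_def)

lemma word_tr_wpow: "word_tr (wpow u k) = wpow (word_tr u) k"
proof (induction k)
  case (Suc k)
  have "wpow (word_tr u) k @ word_tr u = word_tr u @ wpow (word_tr u) k"
    using wpow_add[of k 1 "word_tr u"] wpow_add[of 1 k "word_tr u"] by (simp add: add.commute)
  thus ?case using Suc by (simp add: word_tr_append)
qed (simp add: word_tr_def)

lemma primitive_word_tr: "primitive_word (word_tr c) \<longleftrightarrow> primitive_word c"
  unfolding primitive_word_def by (metis word_tr_word_tr word_tr_wpow)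

lemma primitive_root_exists: "w \<noteq> [] \<Longrightarrow> \<exists>c k. k > 0 \<and> primitive_word c \<and> w = wpow c k"
proof (induction "length w" arbitrary: w rule: less_induct)
  case less
  show ?case
  proof (cases "primitive_word w")
    case True
    thus ?thesis by (intro exI[of _ w] exI[of _ 1]) auto
  next
    case False
    then obtain u k where k: "k > 1" "w = wpow u k" unfolding primitive_word_def by blast
    have u: "u \<noteq> []" using less.prems k by auto
    moreover have "length u < length w" using k u by (simp add: length_wpow)
    ultimately obtain c l where "l > 0" "primitive_word c" "u = wpow c l" using less.hyps by blast
    thus ?thesis using k by (intro exI[of _ c] exI[of _ "k * l"]) (simp add: wpow_mult)
  qed
qed

text \<open>The common power is invariant under rotation by both lengths, hence by their gcd. Both
  roots inherit this invariance, so primitivity makes each length divide the gcd.\<close>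

lemma primitive_root_unique:
  assumes c: "primitive_word c" and d: "primitive_word d" and eq: "wpow c k = wpow d l" and kl: "k > 0" "l > 0"
  shows "c = d" "k = l"
proof -
  let ?g = "gcd (length c) (length d)"
  have "rotate (length c) (wpow c k) = wpow c k"
    by (simp add: rotate_wpow)
  moreover have "rotate (length d) (wpow c k) = wpow c k"
    unfolding eq by (simp add: rotate_wpow)
  ultimately have g: "rotate ?g (wpow c k) = wpow c k" by (rule rotate_gcd)
  hence "rotate ?g c = c" using wpow_eq_wpow[of "rotate ?g c" c k] kl by (simp add: rotate_wpow)
  hence "length c dvd ?g" by (rule primitive_word_rotate_id[OF c])
  hence cd: "length c dvd length d" using dvd_trans gcd_dvd2 by blast
  have "rotate ?g d = d"
    using g wpow_eq_wpow[of "rotate ?g d" d l] kl unfolding eq by (simp add: rotate_wpow)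
  hence "length d dvd ?g" by (rule primitive_word_rotate_id[OF d])
  hence "length d dvd length c" using dvd_trans gcd_dvd1 by blast
  with cd have "length c = length d" by (rule dvd_antisym)
  moreover have "k * length c = l * length d" using arg_cong[OF eq, of length] by (simp add: length_wpow)
  ultimately show "k = l" using primitive_word_not_Nil[OF d] by simp
  thus "c = d" using wpow_eq_wpow[OF \<open>length c = length d\<close>] eq kl by simp
qed

text \<open>The purely cyclic half of \<open>ct_eq\<close>. It is an equivalence relation compatible
  with \<open>word_tr\<close>, from which the same follows for \<open>ct_eq\<close>.\<close>

definition rot :: "'a list \<Rightarrow> 'a list \<Rightarrow> bool" where
  "rot a b \<longleftrightarrow> (\<exists>k. rotate k a = b)"

lemma rot_refl: "rot a a"
  unfolding rot_def by (rule exI[of _ 0]) simp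

lemma rot_trans: "rot a b \<Longrightarrow> rot b c \<Longrightarrow> rot a c"
  unfolding rot_def by (auto simp: rotate_rotate)

lemma rot_sym: "rot a b \<Longrightarrow> rot b a"
proof (cases "a = []")
  case False
  assume "rot a b"
  then obtain k where "rotate k a = b" by (auto simp: rot_def)
  hence "rotate (length a - k mod length a) b = a"
    using False by (subst (asm) rotate_conv_mod) (auto simp: rotate_rotate mod_less_divisor less_imp_le)
  thus "rot b a" unfolding rot_def by blast
qed (auto simp: rot_def)

lemma rot_rev: "rot a b \<Longrightarrow> rot (rev a) (rev b)"
proof -
  have 1: "rot (rev a) (rev (rotate1 a))" for a :: "'a list"
  proof -
    have "rotate1 (rev (rotate1 a)) = rev a" by (cases a) auto
    hence "rot (rev (rotate1 a)) (rev a)" unfolding rot_def by (metis rotate1_rotate_swap rotate_Suc rotate0 id_apply)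
    thus ?thesis by (rule rot_sym)
  qed
  have "rot (rev a) (rev (rotate k a))" for k
  proof (induction k)
    case 0
    show ?case by (simp add: rot_refl)
  next
    case (Suc k)
    show ?case using rot_trans[OF Suc 1[of "rotate k a"]] by simp
  qed
  thus "rot a b \<Longrightarrow> rot (rev a) (rev b)" by (auto simp: rot_def)
qed

lemma rot_word_tr: "rot a b \<Longrightarrow> rot (word_tr a) (word_tr b)"
  unfolding word_tr_def by (intro rot_rev) (auto simp: rot_def rotate_map)

lemma rot_length: "rot a b \<Longrightarrow> length a = length b"
  by (auto simp: rot_def)

lemma ct_eq_rot: "ct_eq a b \<longleftrightarrow> rot a b \<or> rot a (word_tr b)"
  by (auto simp: ct_eq_def rot_def)

lemma ct_eq_refl: "ct_eq a a"
  by (simp add: ct_eq_rot rot_refl)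

lemma ct_eq_sym: "ct_eq a b \<Longrightarrow> ct_eq b a"
  unfolding ct_eq_rot using rot_sym rot_word_tr[of "word_tr b" a] by auto

lemma ct_eq_trans: "ct_eq a b \<Longrightarrow> ct_eq b c \<Longrightarrow> ct_eq a c"
  unfolding ct_eq_rot using rot_trans rot_word_tr by (metis word_tr_word_tr)

lemma ct_eq_length: "ct_eq a b \<Longrightarrow> length a = length b"
  unfolding ct_eq_rot by (auto dest: rot_length)

section \<open>Words alternating between Y-letters and Z-letters\<close>

definition is_Y :: "letter \<Rightarrow> bool" where
  "is_Y a \<longleftrightarrow> a = LY \<or> a = LYt"

lemma is_Y_letter_tr [simp]: "is_Y (letter_tr a) = is_Y a"
  by (cases a) (auto simp: is_Y_def)

lemma product_of_AB_Nil: "product_of_AB []"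
  unfolding product_of_AB_def by (auto intro: exI[of _ "[]"])

lemma product_of_AB_Cons_Cons: "product_of_AB (a # b # w) \<longleftrightarrow> is_Y a \<and> \<not> is_Y b \<and> product_of_AB w"
proof
  assume "product_of_AB (a # b # w)"
  then obtain ws where ws: "a # b # w = concat ws"
    "\<forall>v\<in>set ws. \<exists>A\<in>{LY, LYt}. \<exists>B\<in>{LZ, LZt}. v = [A, B]" unfolding product_of_AB_def by blast
  then obtain v vs where v: "ws = v # vs" by (cases ws) auto
  hence "\<exists>A\<in>{LY, LYt}. \<exists>B\<in>{LZ, LZt}. v = [A, B]" using ws(2) by auto
  hence "v = [a, b]" "is_Y a" "\<not> is_Y b" using ws(1) v by (auto simp: is_Y_def)
  moreover from this have "w = concat vs" using ws(1) v by simp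
  ultimately show "is_Y a \<and> \<not> is_Y b \<and> product_of_AB w"
    using ws(2) v unfolding product_of_AB_def by auto
next
  assume a: "is_Y a \<and> \<not> is_Y b \<and> product_of_AB w"
  then obtain ws where "w = concat ws"
    "\<forall>v\<in>set ws. \<exists>A\<in>{LY, LYt}. \<exists>B\<in>{LZ, LZt}. v = [A, B]" unfolding product_of_AB_def by blast
  thus "product_of_AB (a # b # w)"
    unfolding product_of_AB_def using a
    by (intro exI[of _ "[a, b] # ws"]) (cases b; auto simp: is_Y_def)
qed

lemma product_of_AB_singleton: "\<not> product_of_AB [a]"
proof
  assume "product_of_AB [a]"
  then obtain ws where ws: "[a] = concat ws"
    "\<forall>v\<in>set ws. \<exists>A\<in>{LY, LYt}. \<exists>B\<in>{LZ, LZt}. v = [A, B]" unfolding product_of_AB_def by blast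
  thus False by (cases ws) auto
qed

text \<open>Restates the factorization as a condition on positions, so that rotation and
  transposition become questions of index parity.\<close>

lemma product_of_AB_nth:
  "product_of_AB w \<longleftrightarrow> even (length w) \<and> (\<forall>i<length w. is_Y (w ! i) \<longleftrightarrow> even i)"
proof (induction w rule: induct_list012)
  case (3 a b w)
  have "(\<forall>i<length (a # b # w). is_Y ((a # b # w) ! i) \<longleftrightarrow> even i) \<longleftrightarrow>
    is_Y a \<and> \<not> is_Y b \<and> (\<forall>i<length w. is_Y (w ! i) \<longleftrightarrow> even i)"
    by (simp add: All_less_Suc2)
  thus ?case using 3 by (auto simp: product_of_AB_Cons_Cons)
qed (auto simp: product_of_AB_Nil product_of_AB_singleton)

lemma product_of_AB_even_length: "product_of_AB w \<Longrightarrow> even (length w)"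
  by (simp add: product_of_AB_nth)

lemma product_of_AB_rotate:
  assumes w: "product_of_AB w" "w \<noteq> []"
  shows "product_of_AB (rotate r w) \<longleftrightarrow> even r"
proof -
  have L: "even (length w)" using w(1) by (rule product_of_AB_even_length)
  have "is_Y (rotate r w ! i) \<longleftrightarrow> even (i + r)" if "i < length w" for i
  proof -
    have "(r + i) mod length w < length w" using w(2) by simp
    hence "is_Y (w ! ((r + i) mod length w)) \<longleftrightarrow> even ((r + i) mod length w)"
      using w(1) by (simp add: product_of_AB_nth)
    also have "\<dots> \<longleftrightarrow> even (i + r)" using L by (simp add: dvd_mod_iff add.commute)
    finally show ?thesis using that by (simp add: nth_rotate)
  qed
  hence "(\<forall>i<length w. is_Y (rotate r w ! i) \<longleftrightarrow> even i) \<longleftrightarrow> (\<forall>i<length w. even (i + r) \<longleftrightarrow> even i)" by auto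
  also have "\<dots> \<longleftrightarrow> even r" using w(2) by auto
  finally show ?thesis using L by (simp add: product_of_AB_nth)
qed

lemma nth_word_tr: "i < length w \<Longrightarrow> word_tr w ! i = letter_tr (w ! (length w - Suc i))"
  by (simp add: word_tr_def rev_nth)

text \<open>Transposition keeps the kind of a letter but moves position i to L - 1 - i, of the
  opposite parity since the length L is even; an odd shift repairs this.\<close>

lemma product_of_AB_rotate_word_tr:
  assumes w: "product_of_AB w" "w \<noteq> []"
  shows "product_of_AB (rotate r (word_tr w)) \<longleftrightarrow> odd r"
proof -
  have L: "even (length w)" using w(1) by (rule product_of_AB_even_length)
  have "is_Y (rotate r (word_tr w) ! i) \<longleftrightarrow> odd (i + r)" if "i < length w" for i
  proof -
    let ?k = "(r + i) mod length w"
    have k: "?k < length w" using w(2) by simp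
    hence "is_Y (word_tr w ! ?k) \<longleftrightarrow> even (length w - Suc ?k)"
      using w(1) by (simp add: product_of_AB_nth nth_word_tr)
    also have "\<dots> \<longleftrightarrow> odd ?k" using L k by auto
    also have "\<dots> \<longleftrightarrow> odd (i + r)" using L by (simp add: dvd_mod_iff add.commute)
    finally show ?thesis using that by (simp add: nth_rotate)
  qed
  hence "(\<forall>i<length w. is_Y (rotate r (word_tr w) ! i) \<longleftrightarrow> even i) \<longleftrightarrow> (\<forall>i<length w. odd (i + r) \<longleftrightarrow> even i)" by auto
  also have "\<dots> \<longleftrightarrow> odd r" using w(2) by auto
  finally show ?thesis using L by (simp add: product_of_AB_nth)
qed

lemma product_of_AB_append:
  assumes "product_of_AB u"
  shows "product_of_AB (u @ v) \<longleftrightarrow> product_of_AB v"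
  using assms by (induction u rule: induct_list012) (auto simp: product_of_AB_Cons_Cons product_of_AB_singleton)

lemma product_of_AB_wpow: "product_of_AB c \<Longrightarrow> product_of_AB (wpow c k)"
  by (induction k) (simp_all add: product_of_AB_Nil product_of_AB_append)

lemma product_of_AB_wpowD:
  assumes "product_of_AB (wpow c k)" "k > 0"
  shows "product_of_AB c"
proof (cases "k = 1")
  case False
  then obtain l where k: "k = Suc (Suc l)" using assms(2) by (metis One_nat_def not0_implies_Suc less_not_refl)
  have nth: "is_Y (wpow c k ! i) \<longleftrightarrow> even i" if "i < k * length c" for i
    using assms that by (simp add: product_of_AB_nth length_wpow)
  have c: "is_Y (c ! i) \<longleftrightarrow> even i" if "i < length c" for i
    using nth[of i] that by (simp add: k nth_append)
  \<comment> \<open>The second copy of \<open>c\<close> starts at position \<open>length c\<close>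
    with the same letter as position 0, so that position is even.\<close>
  have "even (length c)"
  proof (cases "c = []")
    case False
    thus ?thesis using nth[of "length c"] c[of 0] by (simp add: k nth_append)
  qed simp
  thus ?thesis using c by (simp add: product_of_AB_nth)
qed (use assms in simp)

definition AB_words :: "nat \<Rightarrow> lword set" where
  "AB_words j = {w. product_of_AB w \<and> length w = 2 * j}"

definition primitive_AB :: "lword set" where
  "primitive_AB = {c. primitive_word c \<and> product_of_AB c}"

text \<open>A reflection of a cyclic word that preserves the parity of positions fixes a position, but
  \<^const>\<open>letter_tr\<close> fixes no letter.\<close>

lemma rotate_neq_rotate_word_tr:
  assumes c: "product_of_AB c" "c \<noteq> []" and r: "even r" and s: "odd s"
  shows "rotate r c \<noteq> rotate s (word_tr c)"
proof
  assume eq: "rotate r c = rotate s (word_tr c)"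
  let ?L = "length c"
  have L: "even ?L" "?L > 0" using c by (auto simp: product_of_AB_nth)
  define t where "t = (r + (?L - s mod ?L)) mod ?L"
  have t: "odd t" "t < ?L"
  proof -
    have "s mod ?L < ?L" using L by (intro mod_less_divisor)
    moreover have "odd (s mod ?L)" using L s by (simp add: dvd_mod_iff)
    ultimately have "odd (?L - s mod ?L)" using L(1) by auto
    thus "odd t" unfolding t_def using L r by (simp add: dvd_mod_iff)
    show "t < ?L" using L by (simp add: t_def)
  qed
  have "rotate t c = rotate (?L - s mod ?L) (rotate r c)"
    unfolding t_def rotate_rotate by (subst rotate_conv_mod) (simp add: add.commute)
  also have "\<dots> = word_tr c"
    unfolding eq using L(2)
    by (subst rotate_conv_mod[of s]) (simp add: rotate_rotate mod_less_divisor less_imp_le)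
  finally have tr: "rotate t c = word_tr c" .
  obtain q where q: "t = 2 * q + 1" using t(1) by (auto elim: oddE)
  obtain M where M: "?L = 2 * M" using L(1) by (auto elim: evenE)
  \<comment> \<open>The fixed position of the reflection: it solves p + t = L - 1 - p with L the
    length, so rotation by \<open>t\<close> and transposition read the same letter of
    \<open>c\<close> there.\<close>
  define p where "p = M - 1 - q"
  have p: "p < ?L" "?L - Suc p = M + q" "p + t = M + q" "M + q < ?L"
    using q M t(2) by (auto simp: p_def)
  have "word_tr c ! p = letter_tr (c ! (M + q))" using nth_word_tr[OF p(1)] p(2) by simp
  moreover have "rotate t c ! p = c ! (M + q)" using p by (simp add: nth_rotate add.commute)
  ultimately show False using tr by (metis letter_tr_neq)
qed

text \<open>Only even shifts of \<open>c\<close> and odd shifts of its transpose have the Y-letters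
  in the even positions.\<close>

lemma ct_class_primitive_AB:
  assumes c: "c \<in> primitive_AB"
  shows "{d \<in> primitive_AB. ct_eq d c} =
    (\<lambda>r. rotate r c) ` {r. r < length c \<and> even r} \<union> (\<lambda>r. rotate r (word_tr c)) ` {r. r < length c \<and> odd r}"
    (is "?l = ?r")
proof -
  have cp: "primitive_word c" "product_of_AB c" using c by (auto simp: primitive_AB_def)
  have ne: "c \<noteq> []" using primitive_word_not_Nil[OF cp(1)] .
  have rotE: "\<exists>r<length v. d = rotate r v" if "rot d v" "v \<noteq> []" for d v :: lword
  proof -
    from rot_sym[OF that(1)] obtain k where "rotate k v = d" by (auto simp: rot_def)
    thus ?thesis using that(2) by (intro exI[of _ "k mod length v"]) (auto simp: rotate_conv_mod[of k])
  qed
  have ntr: "word_tr c \<noteq> []" using ne by (metis length_word_tr length_0_conv)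
  show ?thesis
  proof (intro equalityI subsetI)
    fix d assume d: "d \<in> ?l"
    hence dAB: "product_of_AB d" by (auto simp: primitive_AB_def)
    from d have "rot d c \<or> rot d (word_tr c)" by (simp add: ct_eq_rot)
    thus "d \<in> ?r"
    proof
      assume "rot d c"
      then obtain r where r: "r < length c" "d = rotate r c" using rotE[OF _ ne] by blast
      hence "even r" using dAB product_of_AB_rotate[OF cp(2) ne] by simp
      thus ?thesis using r by auto
    next
      assume "rot d (word_tr c)"
      then obtain r where r: "r < length c" "d = rotate r (word_tr c)" using rotE[OF _ ntr] by auto
      hence "odd r" using dAB product_of_AB_rotate_word_tr[OF cp(2) ne] by simp
      thus ?thesis using r by auto
    qed
  next
    fix d assume "d \<in> ?r"
    thus "d \<in> ?l"
    proof
      assume "d \<in> (\<lambda>r. rotate r c) ` {r. r < length c \<and> even r}"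
      then obtain r where r: "even r" "d = rotate r c" by auto
      hence "rot c d" by (auto simp: rot_def)
      thus ?thesis
        using r cp by (auto simp: primitive_AB_def primitive_word_rotate product_of_AB_rotate ne ct_eq_rot intro: rot_sym)
    next
      assume "d \<in> (\<lambda>r. rotate r (word_tr c)) ` {r. r < length c \<and> odd r}"
      then obtain r where r: "odd r" "d = rotate r (word_tr c)" by auto
      hence "rot (word_tr c) d" by (auto simp: rot_def)
      thus ?thesis
        using r cp by (auto simp: primitive_AB_def primitive_word_rotate primitive_word_tr
          product_of_AB_rotate_word_tr ne ct_eq_rot intro: rot_sym)
    qed
  qed
qed

text \<open>Shifts within one family are distinct by primitivity, and the two families are disjoint
  by \<open>rotate_neq_rotate_word_tr\<close>, so even and odd shifts together are counted by all
  residues modulo the length.\<close>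

lemma card_ct_class_primitive_AB:
  assumes c: "c \<in> primitive_AB"
  shows "card {d \<in> primitive_AB. ct_eq d c} = length c"
proof -
  have cp: "primitive_word c" "product_of_AB c" using c by (auto simp: primitive_AB_def)
  have ne: "c \<noteq> []" using primitive_word_not_Nil[OF cp(1)] .
  let ?E = "{r. r < length c \<and> even r}" and ?O = "{r. r < length c \<and> odd r}"
  have "card {d \<in> primitive_AB. ct_eq d c} = card ((\<lambda>r. rotate r c) ` ?E) + card ((\<lambda>r. rotate r (word_tr c)) ` ?O)"
    unfolding ct_class_primitive_AB[OF c]
  proof (rule card_Un_disjoint)
    show "(\<lambda>r. rotate r c) ` ?E \<inter> (\<lambda>r. rotate r (word_tr c)) ` ?O = {}"
      using rotate_neq_rotate_word_tr[OF cp(2) ne] by auto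
  qed auto
  also have "card ((\<lambda>r. rotate r c) ` ?E) = card ?E"
    by (intro card_image inj_onI) (use primitive_word_rotate_inj[OF cp(1)] in auto)
  also have "card ((\<lambda>r. rotate r (word_tr c)) ` ?O) = card ?O"
    by (intro card_image inj_onI) (use primitive_word_rotate_inj[of "word_tr c"] cp(1) in \<open>auto simp: primitive_word_tr\<close>)
  also have "card ?E + card ?O = card (?E \<union> ?O)"
    by (rule card_Un_disjoint[symmetric]) auto
  also have "?E \<union> ?O = {..<length c}" by auto
  finally show ?thesis by simp
qed

subsection \<open>Traces of word matrices\<close>

lemma pow_mat_add:
  assumes "A \<in> carrier_mat n n"
  shows "A ^\<^sub>m (k + l) = A ^\<^sub>m k * (A ^\<^sub>m l :: 'a::comm_ring_1 mat)"
proof (induction l)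
  case (Suc l)
  thus ?case using assms by (simp add: assoc_mult_mat[of _ n n _ n _ n])
qed (use assms in \<open>simp add: right_mult_one_mat[of _ n n]\<close>)

lemma pow_mat_Suc':
  assumes "A \<in> carrier_mat n n"
  shows "A ^\<^sub>m Suc k = A * (A ^\<^sub>m k :: 'a::comm_ring_1 mat)"
  using pow_mat_add[OF assms, of 1 k] left_mult_one_mat[OF assms] assms by simp

text \<open>Moves one factor U around the trace, using (U V)^k U = U (V U)^k.\<close>

lemma mtrace_pow_comm:
  assumes U: "U \<in> carrier_mat n n" and V: "V \<in> carrier_mat n n"
  shows "mtrace ((U * V) ^\<^sub>m i) = mtrace ((V * U) ^\<^sub>m i)"
proof (cases i)
  case 0
  thus ?thesis using assms by simp
next
  case (Suc k)
  have c: "(U * V) ^\<^sub>m k \<in> carrier_mat n n" "(V * U) ^\<^sub>m k \<in> carrier_mat n n" using assms by auto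
  have "(U * V) ^\<^sub>m i = ((U * V) ^\<^sub>m k * U) * V"
    using assms c Suc by (simp add: assoc_mult_mat[of _ n n _ n _ n])
  also have "\<dots> = U * ((V * U) ^\<^sub>m k * V)"
    unfolding pow_mat_mult_swap[OF U V] using assms c by (simp add: assoc_mult_mat[of _ n n _ n _ n])
  finally have "mtrace ((U * V) ^\<^sub>m i) = mtrace (((V * U) ^\<^sub>m k * V) * U)"
    using mtrace_mult_comm[OF U, of "(V * U) ^\<^sub>m k * V"] V c by simp
  also have "((V * U) ^\<^sub>m k * V) * U = (V * U) ^\<^sub>m i"
    using assms c Suc by (simp add: assoc_mult_mat[of _ n n _ n _ n])
  finally show ?thesis .
qed

text \<open>Newton's identities recover the coefficients from the traces once the integer k can be
  cancelled. Invariance of \<open>sigma\<close> under cyclic shifts and transposition is thereby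
  reduced to invariance of traces.\<close>

lemma signed_sigma_eqI:
  fixes A B :: "'a::{idom,ring_char_0} mat"
  assumes A: "A \<in> carrier_mat n n" and B: "B \<in> carrier_mat n n"
    and tr: "\<And>i. mtrace (A ^\<^sub>m i) = mtrace (B ^\<^sub>m i)"
  shows "signed_sigma A k = signed_sigma B k"
proof (induction k rule: less_induct)
  case (less k)
  show ?case
  proof (cases "k = 0")
    case False
    have "of_nat k * signed_sigma A k = of_nat k * signed_sigma B k"
      unfolding newton_identity[OF A] newton_identity[OF B] tr
      by (intro arg_cong[of _ _ uminus] sum.cong refl arg_cong2[where f="(*)"] less) auto
    thus ?thesis using False by simp
  qed (simp add: signed_sigma_0[OF A] signed_sigma_0[OF B])
qed

lemma sigma_eq_signed_sigma: "sigma k A = (-1) ^ k * signed_sigma A k"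
  by (simp add: signed_sigma_def mult.assoc[symmetric] flip: power_add mult_2)

locale matrix_pair =
  fixes n :: nat and Y Z :: "'a::comm_ring_1 mat"
  assumes Y: "Y \<in> carrier_mat n n" and Z: "Z \<in> carrier_mat n n"
begin

lemma letter_mat_carrier: "letter_mat Y Z a \<in> carrier_mat n n"
  using Y Z by (cases a) auto

lemma word_mat_carrier: "word_mat n Y Z w \<in> carrier_mat n n"
  by (induction w) (auto simp: word_mat_def intro!: mult_carrier_mat[OF letter_mat_carrier])

lemma word_mat_Nil: "word_mat n Y Z [] = 1\<^sub>m n"
  by (simp add: word_mat_def)

lemma word_mat_Cons: "word_mat n Y Z (a # w) = letter_mat Y Z a * word_mat n Y Z w"
  by (simp add: word_mat_def)

lemma word_mat_append: "word_mat n Y Z (u @ v) = word_mat n Y Z u * word_mat n Y Z v"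
proof (induction u)
  case Nil
  show ?case using left_mult_one_mat[OF word_mat_carrier] by (simp add: word_mat_Nil)
next
  case (Cons a u)
  thus ?case
    by (simp add: word_mat_Cons assoc_mult_mat[OF letter_mat_carrier word_mat_carrier word_mat_carrier])
qed

lemma word_mat_wpow: "word_mat n Y Z (wpow w k) = word_mat n Y Z w ^\<^sub>m k"
proof (induction k)
  case 0
  show ?case using word_mat_carrier[of w] by (simp add: word_mat_Nil)
next
  case (Suc k)
  thus ?case using pow_mat_Suc'[OF word_mat_carrier, of w k] by (simp add: word_mat_append)
qed

lemma letter_mat_tr: "letter_mat Y Z (letter_tr a) = transpose_mat (letter_mat Y Z a)"
  by (cases a) simp_all

lemma word_mat_tr: "word_mat n Y Z (word_tr w) = transpose_mat (word_mat n Y Z w)"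
proof (induction w)
  case Nil
  show ?case by (simp add: word_mat_Nil word_tr_def)
next
  case (Cons a w)
  have "word_tr (a # w) = word_tr w @ [letter_tr a]" by (simp add: word_tr_def)
  hence "word_mat n Y Z (word_tr (a # w)) = transpose_mat (word_mat n Y Z w) * transpose_mat (letter_mat Y Z a)"
    using Cons right_mult_one_mat[OF transpose_carrier_mat[THEN iffD2, OF letter_mat_carrier[of a]]]
    by (simp add: word_mat_append word_mat_Cons word_mat_Nil letter_mat_tr)
  thus ?case
    by (simp add: word_mat_Cons transpose_mult[OF letter_mat_carrier word_mat_carrier])
qed

lemma mtrace_word_mat_ct:
  assumes "ct_eq a b"
  shows "mtrace (word_mat n Y Z a ^\<^sub>m i) = mtrace (word_mat n Y Z b ^\<^sub>m i)"
proof -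
  have rotated: "mtrace (word_mat n Y Z (rotate k w) ^\<^sub>m i) = mtrace (word_mat n Y Z w ^\<^sub>m i)" for k w
  proof -
    let ?k = "k mod length w"
    have "mtrace (word_mat n Y Z (rotate k w) ^\<^sub>m i) =
      mtrace ((word_mat n Y Z (drop ?k w) * word_mat n Y Z (take ?k w)) ^\<^sub>m i)"
      by (simp add: rotate_drop_take word_mat_append)
    also have "\<dots> = mtrace ((word_mat n Y Z (take ?k w) * word_mat n Y Z (drop ?k w)) ^\<^sub>m i)"
      by (rule mtrace_pow_comm[OF word_mat_carrier word_mat_carrier])
    also have "\<dots> = mtrace (word_mat n Y Z w ^\<^sub>m i)"
      by (simp flip: word_mat_append)
    finally show ?thesis .
  qed
  have tr: "mtrace (word_mat n Y Z (word_tr w) ^\<^sub>m i) = mtrace (word_mat n Y Z w ^\<^sub>m i)" for w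
    unfolding word_mat_tr transpose_pow_mat[OF word_mat_carrier, symmetric]
    by (rule mtrace_transpose[OF pow_carrier_mat[OF word_mat_carrier]])
  from assms obtain k where "rotate k a = b \<or> rotate k a = word_tr b" by (auto simp: ct_eq_def)
  thus ?thesis using rotated[of k a] tr[of b] by auto
qed

end

lemma sigma_word_mat_ct:
  fixes Y Z :: "'a::{idom,ring_char_0} mat"
  assumes "Y \<in> carrier_mat n n" "Z \<in> carrier_mat n n" "ct_eq a b"
  shows "sigma k (word_mat n Y Z a) = sigma k (word_mat n Y Z b)"
proof -
  interpret matrix_pair n Y Z using assms by unfold_locales
  show ?thesis
    unfolding sigma_eq_signed_sigma
    using signed_sigma_eqI[OF word_mat_carrier word_mat_carrier mtrace_word_mat_ct[OF assms(3)]] by simp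
qed

text \<open>The sign of \<open>w\<close> in the expansion of a power of (Y - Y^t)(Z - Z^t). That
  sign counts the transposed letters, but an admissible word has even length, so counting
  \<open>LY\<close> and \<open>LZ\<close> gives the same parity.\<close>

definition word_sign :: "lword \<Rightarrow> 'a::comm_ring_1" where
  "word_sign w = (-1) ^ (deg LY w + deg LZ w)"

lemma word_sign_Nil: "word_sign [] = 1"
  by (simp add: word_sign_def deg_def)

lemma word_sign_append: "word_sign (u @ v) = word_sign u * word_sign v"
  by (simp add: word_sign_def deg_def power_add mult_ac)

lemma word_sign_wpow: "word_sign (wpow u k) = word_sign u ^ k"
  by (induction k) (simp_all add: word_sign_Nil word_sign_append)

lemma word_sign_Cons: "word_sign (a # w) = (if a = LY \<or> a = LZ then -1 else 1) * word_sign w"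
  by (auto simp: word_sign_def deg_def)

lemma word_sign_rotate: "word_sign (rotate k w) = (word_sign w :: 'a::comm_ring_1)"
  using word_sign_append[of "take (k mod length w) w" "drop (k mod length w) w", where 'a='a]
  by (simp add: rotate_drop_take word_sign_append mult.commute)

lemma deg_product_of_AB:
  assumes "product_of_AB w"
  shows "deg LY w + deg LYt w = length w div 2" "deg LZ w + deg LZt w = length w div 2"
  using assms
proof (induction w rule: induct_list012)
  case (3 a b w)
  {
    case 1
    thus ?case using 3(1) by (cases a; cases b) (auto simp: product_of_AB_Cons_Cons deg_def is_Y_def)
  next
    case 2
    thus ?case using 3(2) by (cases a; cases b) (auto simp: product_of_AB_Cons_Cons deg_def is_Y_def)
  }
qed (auto simp: deg_def product_of_AB_singleton)

lemma deg_word_tr: "deg (letter_tr a) (word_tr w) = deg a w"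
proof -
  have "count_list (map letter_tr w) (letter_tr a) = count_list w a"
    by (induction w) (auto dest: arg_cong[of _ _ letter_tr])
  thus ?thesis by (simp add: deg_def word_tr_def)
qed

text \<open>Transposition exchanges each letter count with that of its transpose. The Y-letters and
  the Z-letters each number half the length, so the four counts have an even sum and the parity
  survives.\<close>

lemma word_sign_word_tr:
  assumes "product_of_AB w"
  shows "word_sign (word_tr w) = (word_sign w :: 'a::comm_ring_1)"
proof -
  have "deg LY (word_tr w) = deg LYt w" "deg LZ (word_tr w) = deg LZt w"
    using deg_word_tr[of LYt w] deg_word_tr[of LZt w] by simp_all
  moreover have "even (deg LYt w + deg LZt w) \<longleftrightarrow> even (deg LY w + deg LZ w)"
    using deg_product_of_AB[OF assms] by presburger
  ultimately show ?thesis by (auto simp: word_sign_def minus_one_power_iff)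
qed

lemma word_sign_ct:
  assumes "product_of_AB b" "ct_eq a b"
  shows "word_sign a = word_sign b"
proof -
  from assms(2) obtain k where "rotate k a = b \<or> rotate k a = word_tr b" by (auto simp: ct_eq_def)
  thus ?thesis using word_sign_rotate[of k a] word_sign_word_tr[OF assms(1)] by metis
qed

lemma AB_words_0: "AB_words 0 = {[]}"
  by (auto simp: AB_words_def product_of_AB_Nil)

lemma AB_words_Suc: "AB_words (Suc j) = (\<lambda>(a, b, w). a # b # w) ` ({LY, LYt} \<times> {LZ, LZt} \<times> AB_words j)"
proof (intro equalityI subsetI)
  fix w assume w: "w \<in> AB_words (Suc j)"
  then obtain a b v where v: "w = a # b # v"
    by (auto simp: AB_words_def length_Suc_conv)
  have "is_Y a" "\<not> is_Y b" "v \<in> AB_words j"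
    using w by (auto simp: v AB_words_def product_of_AB_Cons_Cons)
  moreover from this have "a \<in> {LY, LYt}" "b \<in> {LZ, LZt}" by (cases b; auto simp: is_Y_def)+
  ultimately show "w \<in> (\<lambda>(a, b, w). a # b # w) ` ({LY, LYt} \<times> {LZ, LZt} \<times> AB_words j)"
    unfolding v by (intro image_eqI[of _ _ "(a, b, v)"]) auto
qed (auto simp: AB_words_def product_of_AB_Cons_Cons is_Y_def)

lemma finite_AB_words: "finite (AB_words j)"
  by (induction j) (simp_all add: AB_words_0 AB_words_Suc)

context matrix_pair
begin

definition "wtrace w = word_sign w * mtrace (word_mat n Y Z w)"

text \<open>Stated for matrix entries rather than traces so that the induction can peel off one pair
  of letters.\<close>

lemma sum_AB_words:
  assumes pq: "p < n" "q < n"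
  shows "(\<Sum>w\<in>AB_words j. word_sign w * word_mat n Y Z w $$ (p, q)) =
    (((Y - transpose_mat Y) * (Z - transpose_mat Z)) ^\<^sub>m j) $$ (p, q)"
  using pq(1)
proof (induction j arbitrary: p)
  case 0
  have "dim_row Y = n" "dim_col Y = n" using Y by auto
  thus ?case by (simp add: AB_words_0 word_sign_Nil word_mat_Nil)
next
  case (Suc j)
  let ?A = "Y - transpose_mat Y" and ?B = "Z - transpose_mat Z"
  have A: "?A \<in> carrier_mat n n" and B: "?B \<in> carrier_mat n n" using Y Z by auto
  let ?s = "\<lambda>a. if a = LY \<or> a = LZ then -1 else (1 :: 'a)"
  have c: "(?A * ?B) ^\<^sub>m j \<in> carrier_mat n n" using A B by auto
  \<comment> \<open>With this choice of signs each difference appears negated; a pair of letters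
    contributes two such signs, which cancel.\<close>
  have As: "(\<Sum>a\<in>{LY, LYt}. ?s a * letter_mat Y Z a $$ (x, y)) = - ?A $$ (x, y)"
    and Bs: "(\<Sum>a\<in>{LZ, LZt}. ?s a * letter_mat Y Z a $$ (x, y)) = - ?B $$ (x, y)" if "x < n" "y < n" for x y
    using that Y Z by auto
  have inj: "inj_on (\<lambda>(a, b, w). a # b # w) S" for S :: "(letter \<times> letter \<times> lword) set"
    by (auto simp: inj_on_def)
  have "(\<Sum>w\<in>AB_words (Suc j). word_sign w * word_mat n Y Z w $$ (p, q)) =
    (\<Sum>(a, b, w)\<in>{LY, LYt} \<times> {LZ, LZt} \<times> AB_words j.
      ?s a * ?s b * word_sign w * (letter_mat Y Z a * letter_mat Y Z b * word_mat n Y Z w) $$ (p, q))"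
    unfolding AB_words_Suc sum.reindex[OF inj]
    by (rule sum.cong[OF refl])
      (auto simp: word_sign_Cons word_mat_Cons assoc_mult_mat[OF letter_mat_carrier letter_mat_carrier word_mat_carrier] mult.assoc
        simp del: letter_mat.simps)
  also have "\<dots> = (\<Sum>(a, b, w)\<in>{LY, LYt} \<times> {LZ, LZt} \<times> AB_words j. \<Sum>x<n. \<Sum>y<n.
      (?s a * letter_mat Y Z a $$ (p, x)) * ((?s b * letter_mat Y Z b $$ (x, y)) * (word_sign w * word_mat n Y Z w $$ (y, q))))"
    unfolding index_mult_mat_3[OF letter_mat_carrier letter_mat_carrier word_mat_carrier Suc.prems pq(2)] sum_distrib_left
    by (intro sum.cong refl) (simp add: mult_ac split: prod.split)
  also have "\<dots> = (\<Sum>x<n. \<Sum>y<n. \<Sum>(a, b, w)\<in>{LY, LYt} \<times> {LZ, LZt} \<times> AB_words j.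
      (?s a * letter_mat Y Z a $$ (p, x)) * ((?s b * letter_mat Y Z b $$ (x, y)) * (word_sign w * word_mat n Y Z w $$ (y, q))))"
    unfolding case_prod_unfold by (subst sum.swap, rule sum.cong[OF refl], rule sum.swap)
  also have "\<dots> = (\<Sum>x<n. \<Sum>y<n. (\<Sum>a\<in>{LY, LYt}. ?s a * letter_mat Y Z a $$ (p, x)) *
      ((\<Sum>b\<in>{LZ, LZt}. ?s b * letter_mat Y Z b $$ (x, y)) *
       (\<Sum>w\<in>AB_words j. word_sign w * word_mat n Y Z w $$ (y, q))))"
    unfolding sum_product sum.cartesian_product by (simp only: case_prod_unfold)
  also have "\<dots> = (\<Sum>x<n. \<Sum>y<n. ?A $$ (p, x) * ?B $$ (x, y) * ((?A * ?B) ^\<^sub>m j) $$ (y, q))"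
  proof (intro sum.cong refl)
    fix x y assume "x \<in> {..<n}" "y \<in> {..<n}"
    hence xy: "x < n" "y < n" by auto
    show "(\<Sum>a\<in>{LY, LYt}. ?s a * letter_mat Y Z a $$ (p, x)) * ((\<Sum>b\<in>{LZ, LZt}. ?s b * letter_mat Y Z b $$ (x, y)) *
       (\<Sum>w\<in>AB_words j. word_sign w * word_mat n Y Z w $$ (y, q))) =
       ?A $$ (p, x) * ?B $$ (x, y) * ((?A * ?B) ^\<^sub>m j) $$ (y, q)"
      unfolding As[OF Suc.prems xy(1)] Bs[OF xy] Suc.IH[OF xy(2)] by (simp only: minus_mult_minus mult_minus_left mult_minus_right minus_minus mult.assoc)
  qed
  also have "\<dots> = (?A * ?B * (?A * ?B) ^\<^sub>m j) $$ (p, q)"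
    by (rule index_mult_mat_3[OF A B c Suc.prems pq(2), symmetric])
  also have "?A * ?B * (?A * ?B) ^\<^sub>m j = (?A * ?B) ^\<^sub>m Suc j"
    using pow_mat_Suc'[of "?A * ?B" n j] A B by simp
  finally show ?case .
qed

lemma sum_wtrace_AB_words:
  "(\<Sum>w\<in>AB_words j. wtrace w) = mtrace (((Y - transpose_mat Y) * (Z - transpose_mat Z)) ^\<^sub>m j)"
proof -
  have c: "((Y - transpose_mat Y) * (Z - transpose_mat Z)) ^\<^sub>m j \<in> carrier_mat n n" using Y Z by auto
  have "(\<Sum>w\<in>AB_words j. wtrace w) = (\<Sum>w\<in>AB_words j. \<Sum>i<n. word_sign w * word_mat n Y Z w $$ (i, i))"
    unfolding wtrace_def mtrace_def using carrier_matD(1)[OF word_mat_carrier] by (simp add: sum_distrib_left)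
  also have "\<dots> = (\<Sum>i<n. (((Y - transpose_mat Y) * (Z - transpose_mat Z)) ^\<^sub>m j) $$ (i, i))"
    by (subst sum.swap) (simp add: sum_AB_words)
  finally show ?thesis using carrier_matD(1)[OF c] by (simp add: mtrace_def)
qed

end

subsection \<open>Generating functions\<close>

abbreviation wlen :: "lword \<Rightarrow> nat" where
  "wlen c \<equiv> length c div 2"

text \<open>The predicate under \<open>SOME\<close> depends on \<open>c\<close> only through its
  class, so equivalent words receive the same representative.\<close>

definition ct_rep :: "lword \<Rightarrow> lword" where
  "ct_rep c = (SOME d. d \<in> primitive_AB \<and> ct_eq d c)"

definition ct_reps :: "lword set" where
  "ct_reps = ct_rep ` primitive_AB"

lemma ct_rep:
  assumes "c \<in> primitive_AB"
  shows "ct_rep c \<in> primitive_AB" "ct_eq (ct_rep c) c"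
proof -
  have "\<exists>d. d \<in> primitive_AB \<and> ct_eq d c" using assms ct_eq_refl by blast
  from someI_ex[OF this] show "ct_rep c \<in> primitive_AB" "ct_eq (ct_rep c) c"
    by (simp_all add: ct_rep_def)
qed

lemma ct_rep_cong: "ct_eq c d \<Longrightarrow> ct_rep c = ct_rep d"
  unfolding ct_rep_def by (rule arg_cong[of _ _ Eps]) (auto simp: fun_eq_iff intro: ct_eq_trans ct_eq_sym)

lemma ct_reps_subset: "ct_reps \<subseteq> primitive_AB"
  by (auto simp: ct_reps_def ct_rep)

lemma ct_rep_ct_reps: "r \<in> ct_reps \<Longrightarrow> ct_rep r = r"
  unfolding ct_reps_def using ct_rep(2) ct_rep_cong by blast

lemma ct_rep_eq_iff:
  assumes "c \<in> primitive_AB" "r \<in> ct_reps"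
  shows "ct_rep c = r \<longleftrightarrow> ct_eq c r"
  using ct_rep[OF assms(1)] ct_rep_cong[of c r] ct_rep_ct_reps[OF assms(2)] ct_eq_sym by metis

lemma ct_reps_ct_eq: "r \<in> ct_reps \<Longrightarrow> s \<in> ct_reps \<Longrightarrow> ct_eq r s \<Longrightarrow> r = s"
  using ct_rep_cong ct_rep_ct_reps by metis

lemma length_primitive_AB:
  assumes "c \<in> primitive_AB"
  shows "length c = 2 * wlen c" "wlen c > 0"
proof -
  have "even (length c)" "c \<noteq> []"
    using assms product_of_AB_even_length primitive_word_not_Nil by (auto simp: primitive_AB_def)
  moreover from this have "length c > 0" by simp
  ultimately show "length c = 2 * wlen c" "wlen c > 0" by presburger+
qed

lemma finite_primitive_AB_le: "finite {c \<in> primitive_AB. wlen c \<le> j}"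
proof (rule finite_subset)
  show "{c \<in> primitive_AB. wlen c \<le> j} \<subseteq> (\<Union>i\<le>j. AB_words i)"
    using length_primitive_AB(1) by (auto simp: AB_words_def primitive_AB_def)
qed (simp add: finite_AB_words)

lemma finite_primitive_AB_dvd: "j > 0 \<Longrightarrow> finite {c \<in> primitive_AB. wlen c dvd j}"
  by (rule finite_subset[OF _ finite_primitive_AB_le[of j]]) (auto intro: dvd_imp_le)

text \<open>Existence and uniqueness of the primitive root: a word of half-length \<open>j\<close>
  is determined by its root \<open>c\<close>, whose half-length divides \<open>j\<close> and fixes
  the exponent.\<close>

lemma AB_words_eq_image:
  assumes j: "j > 0"
  shows "AB_words j = (\<lambda>c. wpow c (j div wlen c)) ` {c \<in> primitive_AB. wlen c dvd j}"
    and "inj_on (\<lambda>c. wpow c (j div wlen c)) {c \<in> primitive_AB. wlen c dvd j}"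
proof -
  have pos: "j div wlen c > 0" if "c \<in> primitive_AB" "wlen c dvd j" for c
    using that j by (auto elim!: dvdE)
  show "AB_words j = (\<lambda>c. wpow c (j div wlen c)) ` {c \<in> primitive_AB. wlen c dvd j}"
  proof (intro equalityI subsetI)
    fix w assume w: "w \<in> AB_words j"
    hence "w \<noteq> []" using j by (auto simp: AB_words_def)
    then obtain c k where c: "k > 0" "primitive_word c" "w = wpow c k" using primitive_root_exists by blast
    have AB: "c \<in> primitive_AB"
      using w c product_of_AB_wpowD[of k c] by (auto simp: AB_words_def primitive_AB_def)
    have "k * (2 * wlen c) = 2 * j" using w c(3) length_primitive_AB(1)[OF AB] by (simp add: AB_words_def length_wpow)
    hence "j = k * wlen c" by simp
    moreover from this have "j div wlen c = k" using length_primitive_AB(2)[OF AB] by simp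
    ultimately show "w \<in> (\<lambda>c. wpow c (j div wlen c)) ` {c \<in> primitive_AB. wlen c dvd j}"
      using AB c(3) by (intro image_eqI[of _ _ c]) auto
  next
    fix w assume "w \<in> (\<lambda>c. wpow c (j div wlen c)) ` {c \<in> primitive_AB. wlen c dvd j}"
    then obtain c where c: "c \<in> primitive_AB" "wlen c dvd j" "w = wpow c (j div wlen c)" by auto
    have "length w = j div wlen c * (2 * wlen c)"
      using c(3) length_primitive_AB(1)[OF c(1)] by (simp add: length_wpow)
    hence "length w = 2 * j" using c(2) by simp
    thus "w \<in> AB_words j" using c by (auto simp: AB_words_def primitive_AB_def product_of_AB_wpow)
  qed
  show "inj_on (\<lambda>c. wpow c (j div wlen c)) {c \<in> primitive_AB. wlen c dvd j}"
    by (rule inj_onI) (use pos primitive_root_unique(1) in \<open>auto simp: primitive_AB_def\<close>)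
qed

context matrix_pair
begin

abbreviation "wpowtrace c i \<equiv> word_sign c ^ i * mtrace (word_mat n Y Z c ^\<^sub>m i)"

text \<open>Words are grouped by the class of their primitive root. Sign and trace are constant on a
  class, and the factor \<open>2 * wlen c\<close> is the number of its words.\<close>

lemma sum_reps_wpowtrace:
  assumes j: "j > 0"
  shows "mtrace (((Y - transpose_mat Y) * (Z - transpose_mat Z)) ^\<^sub>m j) =
    (\<Sum>c | c \<in> ct_reps \<and> wlen c dvd j. of_nat (2 * wlen c) * wpowtrace c (j div wlen c))"
proof -
  let ?P = "{c \<in> primitive_AB. wlen c dvd j}"
  let ?\<psi> = "\<lambda>c. wpowtrace c (j div wlen c)"
  have "mtrace (((Y - transpose_mat Y) * (Z - transpose_mat Z)) ^\<^sub>m j) = (\<Sum>w\<in>AB_words j. wtrace w)"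
    by (rule sum_wtrace_AB_words[symmetric])
  also have "\<dots> = (\<Sum>c\<in>?P. wtrace (wpow c (j div wlen c)))"
    unfolding AB_words_eq_image(1)[OF j] sum.reindex[OF AB_words_eq_image(2)[OF j]] by simp
  also have "\<dots> = (\<Sum>c\<in>?P. ?\<psi> c)"
    by (simp add: wtrace_def word_sign_wpow word_mat_wpow)
  also have "\<dots> = (\<Sum>r | r \<in> ct_reps \<and> wlen r dvd j. \<Sum>c | c \<in> ?P \<and> ct_rep c = r. ?\<psi> c)"
  proof (rule sum.group[symmetric])
    show "finite {r. r \<in> ct_reps \<and> wlen r dvd j}"
      by (rule finite_subset[OF _ finite_primitive_AB_dvd[OF j]]) (use ct_reps_subset in auto)
    show "ct_rep ` ?P \<subseteq> {r. r \<in> ct_reps \<and> wlen r dvd j}"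
      using ct_eq_length[OF ct_rep(2)] by (auto simp: ct_reps_def)
  qed (rule finite_primitive_AB_dvd[OF j])
  also have "\<dots> = (\<Sum>r | r \<in> ct_reps \<and> wlen r dvd j. of_nat (2 * wlen r) * ?\<psi> r)"
  proof (rule sum.cong[OF refl])
    fix r assume "r \<in> {r. r \<in> ct_reps \<and> wlen r dvd j}"
    hence r: "r \<in> ct_reps" "wlen r dvd j" "r \<in> primitive_AB" using ct_reps_subset by auto
    \<comment> \<open>Equivalent words have equal length, so the divisibility condition holds for a
      whole class at once.\<close>
    have eq: "{c. c \<in> ?P \<and> ct_rep c = r} = {c \<in> primitive_AB. ct_eq c r}"
      using r ct_rep_eq_iff[OF _ r(1)] by (auto dest: ct_eq_length)
    have "(\<Sum>c | c \<in> ?P \<and> ct_rep c = r. ?\<psi> c) = (\<Sum>c\<in>{c \<in> primitive_AB. ct_eq c r}. ?\<psi> r)"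
    proof (rule sum.cong[OF eq])
      fix c assume "c \<in> {c \<in> primitive_AB. ct_eq c r}"
      hence c: "ct_eq c r" by simp
      have "product_of_AB r" using r(3) by (simp add: primitive_AB_def)
      thus "?\<psi> c = ?\<psi> r"
        using word_sign_ct[OF _ c, where 'a='a] mtrace_word_mat_ct[OF c] ct_eq_length[OF c] by simp
    qed
    also have "\<dots> = of_nat (length r) * ?\<psi> r"
      by (simp add: card_ct_class_primitive_AB[OF r(3)])
    finally show "(\<Sum>c | c \<in> ?P \<and> ct_rep c = r. ?\<psi> c) = of_nat (2 * wlen r) * ?\<psi> r"
      using length_primitive_AB(1)[OF r(3)] by simp
  qed
  finally show ?thesis .
qed

end

section \<open>Products of power series in powers of t, and their logarithmic derivatives\<close>

text \<open>The series with coefficients \<open>h\<close>, with t replaced by t^l.\<close>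

definition fps_stretch :: "nat \<Rightarrow> (nat \<Rightarrow> 'a::comm_ring_1) \<Rightarrow> 'a fps" where
  "fps_stretch l h = Abs_fps (\<lambda>k. if l dvd k then h (k div l) else 0)"

lemma sum_dvd_atMost:
  fixes k l :: nat
  assumes "l > 0"
  shows "(\<Sum>i\<le>k. if l dvd i then F (i div l) i else 0) = (\<Sum>q | q * l \<le> k. F q (q * l) :: 'a::comm_monoid_add)"
proof -
  have "(\<Sum>i\<le>k. if l dvd i then F (i div l) i else 0) = (\<Sum>i | i \<le> k \<and> l dvd i. F (i div l) i)"
    by (rule sum.mono_neutral_cong_right) auto
  also have "\<dots> = (\<Sum>q | q * l \<le> k. F q (q * l))"
    by (rule sum.reindex_bij_witness[of _ "\<lambda>q. q * l" "\<lambda>i. i div l"]) (use assms in auto)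
  finally show ?thesis .
qed

lemma fps_stretch_mult_nth:
  assumes "l > 0"
  shows "fps_nth (fps_stretch l h * F) k = (\<Sum>q | q * l \<le> k. h q * fps_nth F (k - q * l))"
proof -
  have "fps_nth (fps_stretch l h * F) k = (\<Sum>i\<le>k. if l dvd i then h (i div l) * fps_nth F (k - i) else 0)"
    unfolding fps_mult_nth atLeast0AtMost by (intro sum.cong refl) (simp add: fps_stretch_def)
  also have "\<dots> = (\<Sum>q | q * l \<le> k. h q * fps_nth F (k - q * l))"
    by (rule sum_dvd_atMost[OF assms, of "\<lambda>q i. h q * fps_nth F (k - i)"])
  finally show ?thesis .
qed

definition weighted_msets :: "('b \<Rightarrow> nat) \<Rightarrow> 'b set \<Rightarrow> nat \<Rightarrow> 'b multiset set" where
  "weighted_msets l R k = {M. set_mset M \<subseteq> R \<and> (\<Sum>c\<in>R. count M c * l c) = k}"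

text \<open>Splits a multiset by the multiplicity \<open>q\<close> of the new element, mirroring
  multiplication by one more stretched series.\<close>

lemma weighted_msets_insert:
  assumes R: "finite R" "c \<notin> R"
  shows "weighted_msets l (insert c R) k =
    (\<lambda>(q, M). M + replicate_mset q c) ` (SIGMA q:{q. q * l c \<le> k}. weighted_msets l R (k - q * l c))"
    and "inj_on (\<lambda>(q, M). M + replicate_mset q c) (SIGMA q:{q. q * l c \<le> k}. weighted_msets l R (k - q * l c))"
proof -
  have count_c: "count M c = 0" if "M \<in> weighted_msets l R k'" for M k'
    using that R(2) by (auto simp: weighted_msets_def count_eq_zero_iff)
  have sum_eq: "(\<Sum>d\<in>R. count (M + replicate_mset q c) d * l d) = (\<Sum>d\<in>R. count M d * l d)" for M q
    using R(2) by (intro sum.cong refl) auto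
  show "weighted_msets l (insert c R) k =
    (\<lambda>(q, M). M + replicate_mset q c) ` (SIGMA q:{q. q * l c \<le> k}. weighted_msets l R (k - q * l c))"
  proof (intro equalityI subsetI)
    fix M assume M: "M \<in> weighted_msets l (insert c R) k"
    let ?N = "{#d \<in># M. d \<noteq> c#}" and ?q = "count M c"
    have MN: "M = ?N + replicate_mset ?q c" by (rule multiset_eqI) simp
    have k: "?q * l c + (\<Sum>d\<in>R. count M d * l d) = k" using M R by (simp add: weighted_msets_def)
    moreover have "(\<Sum>d\<in>R. count M d * l d) = (\<Sum>d\<in>R. count ?N d * l d)"
      using R(2) by (intro sum.cong refl) auto
    ultimately have "?N \<in> weighted_msets l R (k - ?q * l c)"
      using M by (auto simp: weighted_msets_def)
    thus "M \<in> (\<lambda>(q, M). M + replicate_mset q c) ` (SIGMA q:{q. q * l c \<le> k}. weighted_msets l R (k - q * l c))"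
      using k MN by (intro image_eqI[of _ _ "(?q, ?N)"]) auto
  next
    fix M assume "M \<in> (\<lambda>(q, M). M + replicate_mset q c) ` (SIGMA q:{q. q * l c \<le> k}. weighted_msets l R (k - q * l c))"
    then obtain q N where N: "M = N + replicate_mset q c" "q * l c \<le> k" "N \<in> weighted_msets l R (k - q * l c)" by auto
    have "(\<Sum>d\<in>insert c R. count M d * l d) = count M c * l c + (\<Sum>d\<in>R. count M d * l d)"
      using R by simp
    also have "\<dots> = q * l c + (k - q * l c)"
      using N(3) count_c[OF N(3)] unfolding N(1) sum_eq by (simp add: weighted_msets_def)
    finally show "M \<in> weighted_msets l (insert c R) k"
      using N by (auto simp: weighted_msets_def split: if_splits)
  qed
  show "inj_on (\<lambda>(q, M). M + replicate_mset q c) (SIGMA q:{q. q * l c \<le> k}. weighted_msets l R (k - q * l c))"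
  proof (rule inj_onI, clarify)
    fix q M q' M'
    assume M: "M \<in> weighted_msets l R (k - q * l c)" "M' \<in> weighted_msets l R (k - q' * l c)"
      and eq: "M + replicate_mset q c = M' + replicate_mset q' c"
    have "q = q'" using arg_cong[OF eq, of "\<lambda>M. count M c"] count_c[OF M(1)] count_c[OF M(2)] by simp
    thus "q = q' \<and> M = M'" using eq by simp
  qed
qed

lemma finite_weighted_msets:
  assumes "finite R" "\<And>c. c \<in> R \<Longrightarrow> l c > 0"
  shows "finite (weighted_msets l R k)"
  using assms
proof (induction R arbitrary: k)
  case empty
  have "weighted_msets l {} k \<subseteq> {{#}}" by (auto simp: weighted_msets_def)
  thus ?case by (rule finite_subset) simp
next
  case (insert c R)
  have "finite {q. q * l c \<le> k}"
    by (rule finite_subset[of _ "{..k}"]) (use insert.prems[of c] in \<open>auto intro: order.trans[rotated]\<close>)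
  thus ?case unfolding weighted_msets_insert(1)[OF insert.hyps] using insert by auto
qed

text \<open>Choosing a term from every factor amounts to choosing a multiplicity for every element;
  elements of multiplicity 0 contribute \<open>h c 0\<close>.\<close>

lemma fps_prod_stretch_nth:
  assumes "finite R" "\<And>c. c \<in> R \<Longrightarrow> l c > 0"
  shows "fps_nth (\<Prod>c\<in>R. fps_stretch (l c) (h c)) k = (\<Sum>M\<in>weighted_msets l R k. \<Prod>c\<in>R. h c (count M c))"
  using assms
proof (induction R arbitrary: k)
  case empty
  have "weighted_msets l {} k = (if k = 0 then {{#}} else {})" by (auto simp: weighted_msets_def)
  thus ?case by simp
next
  case (insert c R)
  have fin: "finite {q. q * l c \<le> k}"
    by (rule finite_subset[of _ "{..k}"]) (use insert.prems[of c] in \<open>auto intro: order.trans[rotated]\<close>)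
  have "fps_nth (\<Prod>c\<in>insert c R. fps_stretch (l c) (h c)) k =
    (\<Sum>q | q * l c \<le> k. h c q * (\<Sum>M\<in>weighted_msets l R (k - q * l c). \<Prod>c\<in>R. h c (count M c)))"
    using insert by (simp add: fps_stretch_mult_nth)
  also have "\<dots> = (\<Sum>(q, M)\<in>(SIGMA q:{q. q * l c \<le> k}. weighted_msets l R (k - q * l c)). h c q * (\<Prod>c\<in>R. h c (count M c)))"
    unfolding sum_distrib_left using fin insert.hyps(1) insert.prems
    by (intro sum.Sigma) (auto intro!: finite_weighted_msets)
  also have "\<dots> = (\<Sum>(q, M)\<in>(SIGMA q:{q. q * l c \<le> k}. weighted_msets l R (k - q * l c)).
     \<Prod>d\<in>insert c R. h d (count (M + replicate_mset q c) d))"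
  proof (rule sum.cong[OF refl], clarify)
    fix q M assume "M \<in> weighted_msets l R (k - q * l c)"
    hence "count M c = 0" using insert.hyps(2) by (auto simp: weighted_msets_def count_eq_zero_iff)
    moreover have "(\<Prod>d\<in>R. h d (count (M + replicate_mset q c) d)) = (\<Prod>d\<in>R. h d (count M d))"
      using insert.hyps(2) by (intro prod.cong refl) auto
    ultimately show "h c q * (\<Prod>c\<in>R. h c (count M c)) = (\<Prod>d\<in>insert c R. h d (count (M + replicate_mset q c) d))"
      using insert.hyps by simp
  qed
  also have "\<dots> = (\<Sum>M\<in>weighted_msets l (insert c R) k. \<Prod>d\<in>insert c R. h d (count M d))"
    unfolding weighted_msets_insert(1)[OF insert.hyps] sum.reindex[OF weighted_msets_insert(2)[OF insert.hyps]]
    by (simp add: case_prod_unfold)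
  finally show ?case .
qed

text \<open>Additivity of logarithmic derivatives, written without division: each
  \<open>- S c\<close> plays the role of t g'/g.\<close>

lemma fps_X_deriv_prod:
  fixes g S :: "'b \<Rightarrow> 'a::comm_ring_1 fps"
  assumes "finite R" "\<And>c. c \<in> R \<Longrightarrow> fps_X * fps_deriv (g c) = - (S c * g c)"
  shows "fps_X * fps_deriv (\<Prod>c\<in>R. g c) = - ((\<Sum>c\<in>R. S c) * (\<Prod>c\<in>R. g c))"
  using assms
proof (induction R)
  case (insert c R)
  have "fps_X * fps_deriv (\<Prod>c\<in>insert c R. g c) =
    (fps_X * fps_deriv (g c)) * (\<Prod>c\<in>R. g c) + g c * (fps_X * fps_deriv (\<Prod>c\<in>R. g c))"
    using insert.hyps by (simp add: algebra_simps)
  also have "\<dots> = - ((\<Sum>c\<in>insert c R. S c) * (\<Prod>c\<in>insert c R. g c))"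
    using insert by (simp add: algebra_simps)
  finally show ?case .
qed simp

text \<open>Newton's identities as a differential equation. Replacing t by t^l multiplies the Euler
  derivative by l, and the series of power sums has no constant term, whence the case
  \<open>q = 0\<close>.\<close>

lemma fps_stretch_newton:
  fixes h p :: "nat \<Rightarrow> 'a::comm_ring_1"
  assumes l: "l > 0"
    and newton: "\<And>q. of_nat q * h q = - (\<Sum>i<q. p (Suc i) * h (q - Suc i))"
  shows "fps_X * fps_deriv (fps_stretch l h) =
    - (fps_stretch l (\<lambda>q. if q = 0 then 0 else of_nat l * p q) * fps_stretch l h)"
proof (rule fps_ext)
  fix k
  let ?p = "\<lambda>q. if q = 0 then 0 else of_nat l * p q"
  have lhs: "fps_nth (fps_X * fps_deriv (fps_stretch l h)) k = of_nat k * fps_nth (fps_stretch l h) k"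
    by (cases k) auto
  have rhs: "fps_nth (fps_stretch l ?p * fps_stretch l h) k = (\<Sum>q | q * l \<le> k. ?p q * fps_nth (fps_stretch l h) (k - q * l))"
    by (rule fps_stretch_mult_nth[OF l])
  show "fps_nth (fps_X * fps_deriv (fps_stretch l h)) k = fps_nth (- (fps_stretch l ?p * fps_stretch l h)) k"
  proof (cases "l dvd k")
    case False
    have "\<not> l dvd k - q * l" if "q * l \<le> k" for q
      using False that by (metis dvd_diffD dvd_triv_right)
    hence "(\<Sum>q | q * l \<le> k. ?p q * fps_nth (fps_stretch l h) (k - q * l)) = 0"
      by (intro sum.neutral) (auto simp: fps_stretch_def)
    thus ?thesis using False lhs rhs by (simp add: fps_stretch_def)
  next
    case True
    then obtain N where N: "k = l * N" by blast
    have set: "{q. q * l \<le> k} = {..N}" using l by (auto simp: N mult.commute)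
    have nth: "fps_nth (fps_stretch l h) (k - q * l) = h (N - q)" for q
      using l by (simp add: fps_stretch_def N mult.commute[of q] diff_mult_distrib2[symmetric])
    have "(\<Sum>q | q * l \<le> k. ?p q * fps_nth (fps_stretch l h) (k - q * l)) = (\<Sum>q\<le>N. ?p q * h (N - q))"
      unfolding set nth ..
    also have "\<dots> = (\<Sum>q<Suc N. ?p q * h (N - q))" by (simp add: lessThan_Suc_atMost)
    also have "\<dots> = of_nat l * (\<Sum>i<N. p (Suc i) * h (N - Suc i))"
      unfolding sum.lessThan_Suc_shift by (simp add: sum_distrib_left mult.assoc)
    also have "\<dots> = - (of_nat l * (of_nat N * h N))" unfolding newton by simp
    finally show ?thesis using l lhs rhs by (simp add: N fps_stretch_def mult.assoc)
  qed
qed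

definition ct_reps_le :: "nat \<Rightarrow> lword set" where
  "ct_reps_le m = {c \<in> ct_reps. wlen c \<le> m}"

lemma finite_ct_reps_le: "finite (ct_reps_le m)"
  by (rule finite_subset[OF _ finite_primitive_AB_le[of m]]) (use ct_reps_subset in \<open>auto simp: ct_reps_le_def\<close>)

lemma wlen_ct_reps_le: "c \<in> ct_reps_le m \<Longrightarrow> wlen c > 0"
  using ct_reps_subset length_primitive_AB(2) by (auto simp: ct_reps_le_def)

text \<open>The infinite product over classes is cut off at half-length \<open>m\<close> to stay
  finite, so its coefficients are shown to satisfy the recursion only up to degree \<open>m\<close>,
  which is all that \<open>G_H_closed_form\<close> needs.\<close>

lemma pf_bar_mult_pf_bar:
  fixes Y Z :: "'a::{idom,ring_char_0} mat"
  assumes Y: "Y \<in> carrier_mat (2 * m) (2 * m)" and Z: "Z \<in> carrier_mat (2 * m) (2 * m)"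
  shows "pf_bar Y * pf_bar Z = (\<Sum>M\<in>weighted_msets wlen (ct_reps_le m) m. \<Prod>c\<in>ct_reps_le m.
    word_sign c ^ count M c * signed_sigma (word_mat (2 * m) Y Z c) (count M c))"
proof -
  let ?R = "ct_reps_le m"
  interpret matrix_pair "2 * m" Y Z using Y Z by unfold_locales
  define a where "a = (\<lambda>x y. Y $$ (x, y) - Y $$ (y, x))"
  define b where "b = (\<lambda>x y. Z $$ (x, y) - Z $$ (y, x))"
  interpret skew_pair "2 * m" a b by unfold_locales (simp_all add: a_def b_def)
  have MA: "MA = Y - transpose_mat Y" and MB: "MB = Z - transpose_mat Z"
    using Y Z unfolding MA_def MB_def by (auto simp: a_def b_def)
  \<comment> \<open>With s the sign of \<open>c\<close>, \<open>h c\<close> lists the coefficients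
    of det (1 - s t c) and \<open>p c\<close> the traces of the powers of s c.\<close>
  define h where "h = (\<lambda>c q. word_sign c ^ q * signed_sigma (word_mat (2 * m) Y Z c) q)"
  define p where "p = (\<lambda>c q. word_sign c ^ q * mtrace (word_mat (2 * m) Y Z c ^\<^sub>m q))"
  define S where "S = (\<lambda>c. fps_stretch (wlen c) (\<lambda>q. if q = 0 then 0 else of_nat (wlen c) * p c q))"
  define P where "P = (\<Prod>c\<in>?R. fps_stretch (wlen c) (h c))"
  have newton: "of_nat q * h c q = - (\<Sum>i<q. p c (Suc i) * h c (q - Suc i))" for c q
  proof -
    have "of_nat q * h c q = word_sign c ^ q * (of_nat q * signed_sigma (word_mat (2 * m) Y Z c) q)"
      by (simp add: h_def mult_ac)
    also have "\<dots> = - (\<Sum>i<q. word_sign c ^ q *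
      (mtrace (word_mat (2 * m) Y Z c ^\<^sub>m Suc i) * signed_sigma (word_mat (2 * m) Y Z c) (q - Suc i)))"
      unfolding newton_identity[OF word_mat_carrier] by (simp add: sum_distrib_left)
    also have "(\<Sum>i<q. word_sign c ^ q *
      (mtrace (word_mat (2 * m) Y Z c ^\<^sub>m Suc i) * signed_sigma (word_mat (2 * m) Y Z c) (q - Suc i))) =
      (\<Sum>i<q. p c (Suc i) * h c (q - Suc i))"
    proof (rule sum.cong[OF refl])
      fix i assume "i \<in> {..<q}"
      hence "(word_sign c :: 'a) ^ q = word_sign c ^ Suc i * word_sign c ^ (q - Suc i)"
        by (simp only: power_add[symmetric]) simp
      thus "word_sign c ^ q * (mtrace (word_mat (2 * m) Y Z c ^\<^sub>m Suc i) * signed_sigma (word_mat (2 * m) Y Z c) (q - Suc i)) =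
        p c (Suc i) * h c (q - Suc i)" unfolding p_def h_def by (simp only: mult_ac)
    qed
    finally show ?thesis .
  qed
  have deriv: "fps_X * fps_deriv P = - ((\<Sum>c\<in>?R. S c) * P)"
    unfolding P_def S_def
    by (intro fps_X_deriv_prod finite_ct_reps_le fps_stretch_newton newton wlen_ct_reps_le)
  have h0: "h c 0 = 1" for c
    by (simp add: h_def signed_sigma_0[OF word_mat_carrier])
  have P0: "fps_nth P 0 = 1"
  proof -
    have "fps_nth (\<Prod>c\<in>R. fps_stretch (wlen c) (h c)) 0 = 1" if "finite R" for R
      using that by induction (simp_all add: fps_stretch_def h0)
    thus ?thesis unfolding P_def using finite_ct_reps_le by blast
  qed
  have S0: "fps_nth (\<Sum>c\<in>?R. S c) 0 = 0" by (simp add: S_def fps_stretch_def fps_sum_nth)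
  \<comment> \<open>A class whose half-length divides \<open>j\<close> has half-length at most
    \<open>m\<close>, so the cut-off loses nothing here. The logarithmic derivative carries
    \<open>wlen c\<close> where the trace carries the class size \<open>2 * wlen c\<close>.\<close>
  have ST: "2 * fps_nth (\<Sum>c\<in>?R. S c) j = T j" if j: "j > 0" "j \<le> m" for j
  proof -
    have "2 * fps_nth (\<Sum>c\<in>?R. S c) j = (\<Sum>c\<in>?R. if wlen c dvd j then of_nat (2 * wlen c) * p c (j div wlen c) else 0)"
      unfolding fps_sum_nth sum_distrib_left S_def fps_stretch_def
      using j by (intro sum.cong refl) (auto elim!: dvdE)
    also have "\<dots> = (\<Sum>c | c \<in> ct_reps \<and> wlen c dvd j. of_nat (2 * wlen c) * p c (j div wlen c))"
    proof (rule sum.mono_neutral_cong_right[OF finite_ct_reps_le])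
      show "{c. c \<in> ct_reps \<and> wlen c dvd j} \<subseteq> ?R"
        using j by (auto simp: ct_reps_le_def dest!: dvd_imp_le)
    qed (auto simp: ct_reps_le_def)
    also have "\<dots> = T j"
      unfolding T_def MA MB p_def sum_reps_wpowtrace[OF j(1)] ..
    finally show ?thesis .
  qed
  have rec: "of_nat (2 * k) * fps_nth P k = - (\<Sum>j<k. T (Suc j) * fps_nth P (k - Suc j))" if k: "k \<le> m" for k
  proof -
    have "of_nat k * fps_nth P k = fps_nth (fps_X * fps_deriv P) k" by (cases k) auto
    also have "\<dots> = - (\<Sum>i\<le>k. fps_nth (\<Sum>c\<in>?R. S c) i * fps_nth P (k - i))"
      unfolding deriv by (simp add: fps_mult_nth atLeast0AtMost)
    also have "(\<Sum>i\<le>k. fps_nth (\<Sum>c\<in>?R. S c) i * fps_nth P (k - i)) =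
      (\<Sum>j<k. fps_nth (\<Sum>c\<in>?R. S c) (Suc j) * fps_nth P (k - Suc j))"
      unfolding lessThan_Suc_atMost[symmetric] sum.lessThan_Suc_shift by (simp add: S0)
    finally have "of_nat (2 * k) * fps_nth P k = - (\<Sum>j<k. 2 * fps_nth (\<Sum>c\<in>?R. S c) (Suc j) * fps_nth P (k - Suc j))"
      by (simp add: sum_distrib_left mult.assoc)
    also have "(\<Sum>j<k. 2 * fps_nth (\<Sum>c\<in>?R. S c) (Suc j) * fps_nth P (k - Suc j)) =
      (\<Sum>j<k. T (Suc j) * fps_nth P (k - Suc j))"
      using k by (intro sum.cong refl) (simp add: ST)
    finally show ?thesis .
  qed
  let ?c = "of_nat (2 ^ m * fact m) :: 'a"
  have c0: "?c \<noteq> 0" by (simp only: of_nat_eq_0_iff) simp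
  have "?c ^ 2 * (pf_bar Y * pf_bar Z) = perm_pf m a id * perm_pf m b id"
  proof -
    have "perm_pf m a id = ?c * pf MA" "perm_pf m b id = ?c * pf MB"
      unfolding MA_def MB_def by (rule perm_pf_id_eq_pf, rule skew_a skew_b)+
    thus ?thesis unfolding MA MB by (simp add: pf_bar_def power2_eq_square mult_ac)
  qed
  also have "\<dots> = G m" unfolding G_def by (rule pf_pairing_square[symmetric])
  also have "\<dots> = ?c ^ 2 * fps_nth P m"
    unfolding of_nat_power[symmetric]
    by (rule G_H_closed_form(1)[of _ m, OF P0 rec]) simp_all
  finally have "pf_bar Y * pf_bar Z = fps_nth P m"
    using c0 by simp
  also have "\<dots> = (\<Sum>M\<in>weighted_msets wlen ?R m. \<Prod>c\<in>?R. h c (count M c))"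
    unfolding P_def by (rule fps_prod_stretch_nth[OF finite_ct_reps_le wlen_ct_reps_le])
  finally show ?thesis by (simp add: h_def)
qed

subsection \<open>Sums over classes of multisets\<close>

text \<open>The exponent splits into the word sign and the extra 1; the latter gives (-1)^i, which
  turns \<open>sigma\<close> into \<open>signed_sigma\<close>.\<close>

lemma summand_eq_prod:
  "summand n Y Z M = (\<Prod>c\<in>set_mset M. word_sign c ^ count M c * signed_sigma (word_mat n Y Z c) (count M c))"
proof -
  have "(-1 :: 'a) ^ (\<Sum>c\<in>set_mset M. count M c * (deg LY c + deg LZ c + 1)) =
    (\<Prod>c\<in>set_mset M. word_sign c ^ count M c * (-1) ^ count M c)"
    unfolding power_sum word_sign_def
    by (intro prod.cong refl) (simp add: algebra_simps flip: power_mult power_add)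
  thus ?thesis
    unfolding summand_def signed_sigma_def by (simp only: prod.distrib[symmetric] mult.assoc)
qed

definition admissible_reps :: "nat \<Rightarrow> lword multiset set" where
  "admissible_reps n = {M \<in> admissible n. set_mset M \<subseteq> ct_reps}"

lemma inj_on_ct_rep: "inj_on ct_rep ct_reps"
  by (rule inj_on_inverseI[of _ id]) (simp add: ct_rep_ct_reps)

text \<open>In an admissible word the Y-letters and the Z-letters each number half the length, so
  the two degree conditions coincide. On primitive admissible words, equivalence is equality of
  representatives.\<close>

lemma admissible_iff:
  "M \<in> admissible n \<longleftrightarrow> set_mset M \<subseteq> primitive_AB \<and> inj_on ct_rep (set_mset M) \<and>
     (\<Sum>c\<in>set_mset M. count M c * wlen c) = n div 2"
proof (cases "set_mset M \<subseteq> primitive_AB")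
  case True
  have inj: "inj_on ct_rep (set_mset M) \<longleftrightarrow> (\<forall>c\<in>#M. \<forall>d\<in>#M. c \<noteq> d \<longrightarrow> \<not> ct_eq c d)"
  proof -
    have "ct_rep c = ct_rep d \<longleftrightarrow> ct_eq c d" if "c \<in># M" "d \<in># M" for c d
    proof
      assume "ct_rep c = ct_rep d"
      moreover have "ct_eq (ct_rep c) c" "ct_eq (ct_rep d) d" using ct_rep(2) True that by blast+
      ultimately have "ct_eq (ct_rep c) c" "ct_eq (ct_rep c) d" by simp_all
      thus "ct_eq c d" using ct_eq_sym ct_eq_trans by blast
    qed (rule ct_rep_cong)
    thus ?thesis unfolding inj_on_def by blast
  qed
  have "deg LY c + deg LYt c = wlen c" "deg LZ c + deg LZt c = wlen c" if "c \<in># M" for c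
    using deg_product_of_AB[of c] True that by (auto simp: primitive_AB_def)
  hence "(\<Sum>c\<in>set_mset M. count M c * (deg LY c + deg LYt c)) = (\<Sum>c\<in>set_mset M. count M c * wlen c)"
    "(\<Sum>c\<in>set_mset M. count M c * (deg LZ c + deg LZt c)) = (\<Sum>c\<in>set_mset M. count M c * wlen c)"
    by simp_all
  thus ?thesis unfolding admissible_def inj using True by (auto simp: primitive_AB_def)
qed (auto simp: admissible_def primitive_AB_def)

text \<open>An element of half-length above \<open>m\<close> would already exceed the total
  weight.\<close>

lemma admissible_reps_eq: "admissible_reps (2 * m) = weighted_msets wlen (ct_reps_le m) m"
proof (intro equalityI subsetI)
  fix M assume "M \<in> admissible_reps (2 * m)"
  hence M: "set_mset M \<subseteq> ct_reps" "(\<Sum>c\<in>set_mset M. count M c * wlen c) = m"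
    by (auto simp: admissible_reps_def admissible_iff)
  have sub: "set_mset M \<subseteq> ct_reps_le m"
  proof
    fix c assume c: "c \<in># M"
    have "wlen c \<le> count M c * wlen c" using c by (simp add: Suc_leI)
    also have "\<dots> \<le> m" unfolding M(2)[symmetric] using c by (intro member_le_sum) auto
    finally show "c \<in> ct_reps_le m" using c M(1) by (auto simp: ct_reps_le_def)
  qed
  have "(\<Sum>c\<in>ct_reps_le m. count M c * wlen c) = (\<Sum>c\<in>set_mset M. count M c * wlen c)"
    by (rule sum.mono_neutral_right[OF finite_ct_reps_le sub]) (auto simp: count_eq_zero_iff)
  thus "M \<in> weighted_msets wlen (ct_reps_le m) m" using sub M(2) by (simp add: weighted_msets_def)
next
  fix M assume "M \<in> weighted_msets wlen (ct_reps_le m) m"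
  hence M: "set_mset M \<subseteq> ct_reps_le m" "(\<Sum>c\<in>ct_reps_le m. count M c * wlen c) = m"
    by (auto simp: weighted_msets_def)
  have "(\<Sum>c\<in>ct_reps_le m. count M c * wlen c) = (\<Sum>c\<in>set_mset M. count M c * wlen c)"
    by (rule sum.mono_neutral_right[OF finite_ct_reps_le M(1)]) (auto simp: count_eq_zero_iff)
  moreover have reps: "set_mset M \<subseteq> ct_reps" using M(1) by (auto simp: ct_reps_le_def)
  moreover have "inj_on ct_rep (set_mset M)" using inj_on_subset[OF inj_on_ct_rep reps] .
  ultimately show "M \<in> admissible_reps (2 * m)"
    using M(2) ct_reps_subset by (auto simp: admissible_reps_def admissible_iff)
qed

lemma summand_reps:
  assumes Y: "Y \<in> carrier_mat n n" and Z: "Z \<in> carrier_mat n n" and M: "M \<in> weighted_msets wlen (ct_reps_le m) m"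
  shows "summand n Y Z M = (\<Prod>c\<in>ct_reps_le m. word_sign c ^ count M c * signed_sigma (word_mat n Y Z c) (count M c))"
proof -
  interpret matrix_pair n Y Z using Y Z by unfold_locales
  show ?thesis
    unfolding summand_eq_prod
    by (rule prod.mono_neutral_left[OF finite_ct_reps_le])
      (use M in \<open>auto simp: weighted_msets_def signed_sigma_0[OF word_mat_carrier] dest: not_in_iff[THEN iffD1]\<close>)
qed

lemma count_image_ct_rep:
  assumes M: "M \<in> admissible n" and c: "c \<in># M"
  shows "count (image_mset ct_rep M) (ct_rep c) = count M c"
proof -
  have "inj_on ct_rep (set_mset M)" using M by (simp add: admissible_iff)
  hence "ct_rep -` {ct_rep c} \<inter> set_mset M = {c}" using c by (auto simp: inj_on_def)
  thus ?thesis by (simp add: count_image_mset)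
qed

text \<open>Normal form of a class of multisets: replace every word by its representative.
  Multiplicities do not merge, because the distinct words are inequivalent.\<close>

lemma image_ct_rep_admissible:
  assumes M: "M \<in> admissible n"
  shows "image_mset ct_rep M \<in> admissible_reps n" and "ct_eq_mset M (image_mset ct_rep M)"
proof -
  have PAB: "set_mset M \<subseteq> primitive_AB" and inj: "inj_on ct_rep (set_mset M)"
    using M by (auto simp: admissible_iff)
  have reps: "ct_rep ` set_mset M \<subseteq> ct_reps" using PAB by (auto simp: ct_reps_def)
  have wl: "wlen (ct_rep c) = wlen c" if "c \<in># M" for c
    using ct_eq_length[OF ct_rep(2)[OF subsetD[OF PAB that]]] by simp
  have "(\<Sum>c\<in>ct_rep ` set_mset M. count (image_mset ct_rep M) c * wlen c) = (\<Sum>c\<in>set_mset M. count M c * wlen c)"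
    unfolding sum.reindex[OF inj] by (intro sum.cong refl) (simp add: count_image_ct_rep[OF M] wl)
  moreover have "inj_on ct_rep (ct_rep ` set_mset M)" using inj_on_subset[OF inj_on_ct_rep reps] .
  ultimately show "image_mset ct_rep M \<in> admissible_reps n"
    using M reps ct_reps_subset by (auto simp: admissible_reps_def admissible_iff)
  show "ct_eq_mset M (image_mset ct_rep M)"
    unfolding ct_eq_mset_def
  proof (intro conjI allI)
    fix w
    have "ct_eq (ct_rep u) w \<longleftrightarrow> ct_eq u w" if "u \<in># M" for u
    proof -
      have "ct_eq (ct_rep u) u" using ct_rep(2)[OF subsetD[OF PAB that]] .
      thus ?thesis using ct_eq_trans[of "ct_rep u" u w] ct_eq_trans[OF ct_eq_sym, of "ct_rep u" u w] by blast
    qed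
    hence "{#u \<in># M. ct_eq u w#} = {#u \<in># M. ct_eq (ct_rep u) w#}"
      by (intro filter_mset_cong) auto
    thus "size {#u \<in># M. ct_eq u w#} = size {#u \<in># image_mset ct_rep M. ct_eq u w#}"
      by (simp add: filter_mset_image_mset)
  qed simp
qed

text \<open>Between representatives equivalence is equality, so the class counts are ordinary
  multiplicities.\<close>

lemma ct_eq_mset_reps_unique:
  assumes "set_mset M \<subseteq> ct_reps" "set_mset N \<subseteq> ct_reps" "ct_eq_mset M N"
  shows "M = N"
proof (rule multiset_eqI)
  fix w
  show "count M w = count N w"
  proof (cases "w \<in> ct_reps")
    case True
    have *: "size {#u \<in># K. ct_eq u w#} = count K w" if K: "set_mset K \<subseteq> ct_reps" for K
    proof -
      have "ct_eq u w \<longleftrightarrow> u = w" if "u \<in># K" for u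
      proof
        have "u \<in> ct_reps" using K that by blast
        thus "ct_eq u w \<Longrightarrow> u = w" using ct_reps_ct_eq[OF _ True] by blast
      qed (simp add: ct_eq_refl)
      hence "{#u \<in># K. ct_eq u w#} = {#u \<in># K. u = w#}"
        by (intro filter_mset_cong refl)
      thus ?thesis by (simp add: filter_eq_replicate_mset)
    qed
    have "size {#u \<in># M. ct_eq u w#} = size {#u \<in># N. ct_eq u w#}"
      using assms(3) unfolding ct_eq_mset_def by blast
    thus ?thesis unfolding *[OF assms(1)] *[OF assms(2)] .
  next
    case False
    hence "w \<notin># M" "w \<notin># N" using assms by auto
    thus ?thesis by (metis not_in_iff)
  qed
qed

lemma ct_eq_mset_refl: "ct_eq_mset M M"
  and ct_eq_mset_sym: "ct_eq_mset M N \<Longrightarrow> ct_eq_mset N M"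
  and ct_eq_mset_trans: "ct_eq_mset M N \<Longrightarrow> ct_eq_mset N K \<Longrightarrow> ct_eq_mset M K"
  by (simp_all add: ct_eq_mset_def)

text \<open>Each class contains exactly one multiset of representatives, and \<open>summand\<close>
  is constant on classes. Invariance of \<open>sigma\<close> is a hypothesis because the argument
  through traces works only over a domain of characteristic 0.\<close>

lemma sum_ct_classes:
  fixes Y Z :: "'a::comm_ring_1 mat"
  assumes sigma_ct: "\<And>a b k. ct_eq a b \<Longrightarrow> sigma k (word_mat n Y Z a) = sigma k (word_mat n Y Z b)"
  shows "(\<Sum>C\<in>admissible n // ct_rel n. the_elem (summand n Y Z ` C)) = (\<Sum>M\<in>admissible_reps n. summand n Y Z M)"
proof -
  have inv: "summand n Y Z (image_mset ct_rep M) = summand n Y Z M" if M: "M \<in> admissible n" for M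
  proof -
    have PAB: "set_mset M \<subseteq> primitive_AB" and inj: "inj_on ct_rep (set_mset M)"
      using M by (auto simp: admissible_iff)
    show ?thesis
      unfolding summand_eq_prod set_image_mset prod.reindex[OF inj] comp_apply
    proof (rule prod.cong[OF refl])
      fix c assume c: "c \<in># M"
      hence "c \<in> primitive_AB" using PAB by auto
      hence ct: "ct_eq (ct_rep c) c" and AB: "product_of_AB c"
        using ct_rep(2) by (blast, simp add: primitive_AB_def)
      have "signed_sigma (word_mat n Y Z (ct_rep c)) k = signed_sigma (word_mat n Y Z c) k" for k
        using sigma_ct[OF ct] by (simp add: signed_sigma_def)
      thus "word_sign (ct_rep c) ^ count (image_mset ct_rep M) (ct_rep c) *
        signed_sigma (word_mat n Y Z (ct_rep c)) (count (image_mset ct_rep M) (ct_rep c)) =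
        word_sign c ^ count M c * signed_sigma (word_mat n Y Z c) (count M c)"
        using word_sign_ct[OF AB ct, where 'a='a] count_image_ct_rep[OF M c] by simp
    qed
  qed
  let ?cl = "\<lambda>M. ct_rel n `` {M}"
  have cl: "?cl M = {N \<in> admissible n. ct_eq_mset M N}" if "M \<in> admissible n" for M
    using that by (auto simp: ct_rel_def)
  have reps_adm: "M \<in> admissible n" "set_mset M \<subseteq> ct_reps" if "M \<in> admissible_reps n" for M
    using that by (auto simp: admissible_reps_def)
  have img: "admissible n // ct_rel n = ?cl ` admissible_reps n"
  proof (intro equalityI subsetI)
    fix C assume "C \<in> admissible n // ct_rel n"
    then obtain M where M: "M \<in> admissible n" "C = ?cl M" by (auto simp: quotient_def)
    note norm = image_ct_rep_admissible[OF M(1)]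
    have "ct_eq_mset M N \<longleftrightarrow> ct_eq_mset (image_mset ct_rep M) N" for N
      by (rule iffI) (rule ct_eq_mset_trans[OF ct_eq_mset_sym[OF norm(2)]] ct_eq_mset_trans[OF norm(2)], assumption)+
    hence "C = ?cl (image_mset ct_rep M)"
      unfolding M(2) cl[OF M(1)] cl[OF reps_adm(1)[OF norm(1)]] by (intro Collect_cong conj_cong refl)
    thus "C \<in> ?cl ` admissible_reps n" using norm(1) by blast
  qed (auto simp: quotient_def admissible_reps_def)
  have inj: "inj_on ?cl (admissible_reps n)"
  proof (rule inj_onI)
    fix M N assume M: "M \<in> admissible_reps n" and N: "N \<in> admissible_reps n" and eq: "?cl M = ?cl N"
    have "N \<in> ?cl N" unfolding cl[OF reps_adm(1)[OF N]] using reps_adm(1)[OF N] by (simp add: ct_eq_mset_refl)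
    hence "ct_eq_mset M N" unfolding eq[symmetric] cl[OF reps_adm(1)[OF M]] by simp
    thus "M = N" by (rule ct_eq_mset_reps_unique[OF reps_adm(2)[OF M] reps_adm(2)[OF N]])
  qed
  show ?thesis
    unfolding img sum.reindex[OF inj] comp_apply
  proof (rule sum.cong[OF refl])
    fix M assume M: "M \<in> admissible_reps n"
    note M' = reps_adm[OF M]
    have "summand n Y Z N = summand n Y Z M" if "N \<in> ?cl M" for N
    proof -
      have N: "N \<in> admissible n" "ct_eq_mset M N" using that unfolding cl[OF M'(1)] by auto
      note norm = image_ct_rep_admissible[OF N(1)]
      have "M = image_mset ct_rep N"
        by (rule ct_eq_mset_reps_unique[OF M'(2) reps_adm(2)[OF norm(1)] ct_eq_mset_trans[OF N(2) norm(2)]])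
      thus ?thesis using inv[OF N(1)] by simp
    qed
    moreover have "M \<in> ?cl M" unfolding cl[OF M'(1)] using M'(1) by (simp add: ct_eq_mset_refl)
    ultimately have "summand n Y Z ` ?cl M = {summand n Y Z M}"
      by (intro equalityI subsetI) (blast, metis imageI singletonD)
    thus "the_elem (summand n Y Z ` ?cl M) = summand n Y Z M" by (simp only: the_elem_eq)
  qed
qed

subsection \<open>Reduction to generic matrices\<close>

text \<open>Evaluation of an integer polynomial in countably many variables at \<open>v\<close>.
  Monomials are multisets of variables: multiset union adds exponents, and the linear order on
  multisets compatible with it makes this polynomial ring an integral domain.\<close>

definition insertion :: "(nat \<Rightarrow> 'a::comm_ring_1) \<Rightarrow> (nat multiset \<Rightarrow>\<^sub>0 int) \<Rightarrow> 'a" where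
  "insertion v f = (\<Sum>k\<in>Poly_Mapping.keys f. of_int (Poly_Mapping.lookup f k) * (\<Prod>i\<in>#k. v i))"

lemma insertion_superset:
  assumes "finite K" "Poly_Mapping.keys f \<subseteq> K"
  shows "insertion v f = (\<Sum>k\<in>K. of_int (Poly_Mapping.lookup f k) * (\<Prod>i\<in>#k. v i))"
  unfolding insertion_def using assms by (intro sum.mono_neutral_left) (auto simp: in_keys_iff)

lemma insertion_zero: "insertion v 0 = 0"
  by (simp add: insertion_def)

lemma insertion_add: "insertion v (f + g) = insertion v f + insertion v g"
proof -
  let ?K = "Poly_Mapping.keys f \<union> Poly_Mapping.keys g"
  have "finite ?K" "Poly_Mapping.keys (f + g) \<subseteq> ?K" "Poly_Mapping.keys f \<subseteq> ?K" "Poly_Mapping.keys g \<subseteq> ?K"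
    using keys_add[of f g] by auto
  thus ?thesis
    by (simp add: insertion_superset[of ?K] lookup_add distrib_right sum.distrib)
qed

lemma insertion_sum: "insertion v (\<Sum>x\<in>A. f x) = (\<Sum>x\<in>A. insertion v (f x))"
  by (induction A rule: infinite_finite_induct) (simp_all add: insertion_zero insertion_add)

lemma insertion_single: "insertion v (Poly_Mapping.single k a) = of_int a * (\<Prod>i\<in>#k. v i)"
  by (cases "a = 0") (simp_all add: insertion_def)

lemma insertion_mult: "insertion v (f * g) = insertion v f * insertion v g"
proof -
  have dec: "f = (\<Sum>k\<in>Poly_Mapping.keys f. Poly_Mapping.single k (Poly_Mapping.lookup f k))" for f :: "nat multiset \<Rightarrow>\<^sub>0 int"
    by (rule poly_mapping_eqI) (simp add: lookup_sum lookup_single when_def in_keys_iff)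
  have "f * g = (\<Sum>k\<in>Poly_Mapping.keys f. \<Sum>l\<in>Poly_Mapping.keys g. Poly_Mapping.single (k + l) (Poly_Mapping.lookup f k * Poly_Mapping.lookup g l))"
    unfolding mult_single[symmetric] sum_product[symmetric]
    by (rule arg_cong2[where f="(*)", OF dec dec])
  hence "insertion v (f * g) = (\<Sum>k\<in>Poly_Mapping.keys f. \<Sum>l\<in>Poly_Mapping.keys g.
      (of_int (Poly_Mapping.lookup f k) * (\<Prod>i\<in>#k. v i)) * (of_int (Poly_Mapping.lookup g l) * (\<Prod>i\<in>#l. v i)))"
    by (simp add: insertion_sum insertion_single mult_ac)
  thus ?thesis by (simp add: insertion_def sum_product)
qed

lemma comm_ring_hom_insertion: "comm_ring_hom (insertion v)"
proof
  show "insertion v 1 = 1"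
    using insertion_single[of v 0 1] by simp
qed (simp_all add: insertion_zero insertion_add insertion_mult)

context comm_ring_hom
begin

lemma pf_hom:
  assumes "X \<in> carrier_mat n n"
  shows "pf (map_mat hom X) = hom (pf X)"
proof -
  have n: "dim_row X = n" "dim_col X = n" using assms by auto
  show ?thesis
    unfolding pf_def Let_def index_map_mat(2) hom_sum hom_mult hom_prod n
  proof (intro sum.cong refl arg_cong2[where f="(*)"] prod.cong)
    fix p i assume p: "p \<in> {p. p permutes {0..<n} \<and> strict_mono_on {..<n div 2} (\<lambda>i. p (2 * i)) \<and>
      (\<forall>i<n div 2. p (2 * i) < p (2 * i + 1))}" and i: "i \<in> {..<n div 2}"
    have "p (2 * i) < n" "p (2 * i + 1) < n"
      using p i permutes_in_image[of p "{0..<n}" "2 * i"] permutes_in_image[of p "{0..<n}" "2 * i + 1"] by auto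
    thus "map_mat hom X $$ (p (2 * i), p (2 * i + 1)) = hom (X $$ (p (2 * i), p (2 * i + 1)))"
      using n by simp
  qed simp
qed

lemma pf_bar_hom:
  assumes "X \<in> carrier_mat n n"
  shows "pf_bar (map_mat hom X) = hom (pf_bar X)"
proof -
  have "map_mat hom X - transpose_mat (map_mat hom X) = map_mat hom (X - transpose_mat X)"
    using assms by (auto simp: hom_minus)
  moreover have "X - transpose_mat X \<in> carrier_mat n n"
    using assms by (intro minus_carrier_mat) simp
  ultimately show ?thesis unfolding pf_bar_def by (simp only: pf_hom)
qed

lemma sigma_hom:
  assumes "X \<in> carrier_mat n n"
  shows "sigma k (map_mat hom X) = hom (sigma k X)"
  using assms by (simp add: sigma_def char_poly_hom[OF assms] hom_mult hom_power hom_uminus)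

lemma word_mat_hom:
  assumes "Y \<in> carrier_mat n n" "Z \<in> carrier_mat n n"
  shows "word_mat n (map_mat hom Y) (map_mat hom Z) w = map_mat hom (word_mat n Y Z w)"
proof (induction w)
  case Nil
  show ?case by (simp add: word_mat_def mat_hom_one)
next
  case (Cons a w)
  interpret matrix_pair n Y Z using assms by unfold_locales
  have "letter_mat (map_mat hom Y) (map_mat hom Z) a = map_mat hom (letter_mat Y Z a)"
    by (cases a) (auto intro!: eq_matI)
  thus ?case
    using Cons mat_hom_mult[OF letter_mat_carrier word_mat_carrier, of a w] by (simp add: word_mat_def)
qed

lemma summand_hom:
  assumes "Y \<in> carrier_mat n n" "Z \<in> carrier_mat n n"
  shows "summand n (map_mat hom Y) (map_mat hom Z) M = hom (summand n Y Z M)"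
proof -
  interpret matrix_pair n Y Z using assms by unfold_locales
  show ?thesis
    unfolding summand_def word_mat_hom[OF assms] sigma_hom[OF word_mat_carrier]
      hom_mult hom_prod hom_power hom_uminus hom_one ..
qed

end

text \<open>Each entry of \<open>Y\<close> and \<open>Z\<close> becomes a variable of its own,
  numbered by encoding the triple (which matrix, row, column); the valuation decodes the number and
  looks up the entry.\<close>

lemma generic_lift:
  fixes Y Z :: "'a::comm_ring_1 mat"
  assumes Y: "Y \<in> carrier_mat n n" and Z: "Z \<in> carrier_mat n n"
  obtains v and Y' Z' :: "(nat multiset \<Rightarrow>\<^sub>0 int) mat"
  where "Y' \<in> carrier_mat n n" "Z' \<in> carrier_mat n n"
    "Y = map_mat (insertion v) Y'" "Z = map_mat (insertion v) Z'"
proof -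
  define v where "v = (\<lambda>x :: nat. case Countable.from_nat x of (b, i, j) \<Rightarrow> if b then Y $$ (i, j) else Z $$ (i, j))"
  define X where "X = (\<lambda>b. mat n n (\<lambda>(i, j). Poly_Mapping.single {#Countable.to_nat (b :: bool, i, j)#} (1 :: int)))"
  show thesis
  proof (rule that[of "X True" "X False" v])
    show "X True \<in> carrier_mat n n" "X False \<in> carrier_mat n n" by (simp_all add: X_def)
    show "Y = map_mat (insertion v) (X True)" "Z = map_mat (insertion v) (X False)"
      using Y Z by (auto simp: X_def insertion_single v_def)
  qed
qed

theorem corollary12:
  fixes scale :: "'k::field \<Rightarrow> 'a::comm_ring_1 \<Rightarrow> 'a"
    and Y Z :: "'a mat"
    and n :: nat
  assumes "infinite (UNIV :: 'k set)"
    and "comm_unital_algebra scale"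
    and "even n"
    and "Y \<in> carrier_mat n n"
    and "Z \<in> carrier_mat n n"
  shows "pf_bar Y * pf_bar Z =
    (\<Sum>C \<in> admissible n // ct_rel n. the_elem (summand n Y Z ` C))"
proof -
  obtain v and Y' Z' :: "(nat multiset \<Rightarrow>\<^sub>0 int) mat"
    where Y': "Y' \<in> carrier_mat n n" and Z': "Z' \<in> carrier_mat n n"
      and Y_eq: "Y = map_mat (insertion v) Y'" and Z_eq: "Z = map_mat (insertion v) Z'"
    using generic_lift[OF assms(4,5)] .
  interpret h: comm_ring_hom "insertion v" by (rule comm_ring_hom_insertion)
  interpret matrix_pair n Y' Z' using Y' Z' by unfold_locales
  obtain m where n: "n = 2 * m" using assms(3) by (auto elim: evenE)
  have "pf_bar Y' * pf_bar Z' = (\<Sum>M\<in>admissible_reps n. summand n Y' Z' M)"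
    using pf_bar_mult_pf_bar[of Y' m Z'] Y' Z' summand_reps[OF Y' Z', of _ m]
    unfolding n admissible_reps_eq by simp
  hence "insertion v (pf_bar Y' * pf_bar Z') = (\<Sum>M\<in>admissible_reps n. insertion v (summand n Y' Z' M))"
    by (simp only: h.hom_sum)
  hence "pf_bar Y * pf_bar Z = (\<Sum>M\<in>admissible_reps n. summand n Y Z M)"
    unfolding Y_eq Z_eq h.pf_bar_hom[OF Y'] h.pf_bar_hom[OF Z'] h.summand_hom[OF Y' Z'] h.hom_mult .
  also have "\<dots> = (\<Sum>C\<in>admissible n // ct_rel n. the_elem (summand n Y Z ` C))"
  \<comment> \<open>Invariance of \<open>sigma\<close> over the given ring is inherited from the
    generic matrices through the evaluation homomorphism.\<close>
  proof (rule sum_ct_classes[symmetric])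
    fix a b k assume "ct_eq a b"
    thus "sigma k (word_mat n Y Z a) = sigma k (word_mat n Y Z b)"
      unfolding Y_eq Z_eq h.word_mat_hom[OF Y' Z'] h.sigma_hom[OF word_mat_carrier]
      using sigma_word_mat_ct[OF Y' Z'] by metis
  qed
  finally show ?thesis .
qed

end
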